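(* Let $\omega=(\omega_x)_{x\in\mathbb{Z}}$ be a sequence of i.i.d. real random variables on a probability space $(\Omega,\mathcal{F},\mathbb{P})$ satisfying: $\omega_0\stackrel{\text{(law)}}{=}-\omega_0$, $\mathbb{E}(|\omega_0|^k)<+\infty$ for all $k\geq1$, and $\mathbb{E}(\omega_0^2)=1$. Let $(X_n)_{n\geq1}$ be i.i.d. random variables on another probability space $(\Omega',\mathcal{A},P)$, whose support is an aperiodic subset of $\mathbb{N}^*=\{1,2,\dots\}$, with $m:=E[X_1]<+\infty$ and $E[X_1^2]<+\infty$. Let $S_0=0$, $S_n=\sum_{k=1}^n X_k$, and $Z_n=\sum_{k=1}^n\omega_{S_k}$. Then for $\mathbb{P}$-almost every $\omega$, under $P$, $$\frac{Z_n-E[Z_n]}{\sqrt{n}}\xrightarrow[n\to\infty]{\text{(law)}}\mathcal{N}(0,1-1/m).$$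
   Context: $E$ denotes expectation with respect to $P$ (the law of the walk) with the scenery $\omega$ held fixed, so $E[Z_n]$ is a function of $\omega$. $(S_n)$ is a renewal process. *)

theory Defs
  imports "HOL-Probability.Probability"
begin

definition normal_law :: "real \<Rightarrow> real \<Rightarrow> real measure" where
  "normal_law mu v = (if v = 0 then return borel mu
                      else density lborel (normal_density mu (sqrt v)))"

end

theory Submission
  imports Defs
begin

text \<open>Fix the scenery and cut it off at a site \<open>N\<close> slightly beyond the typical position \<open>n m\<close> of the
  \<open>n\<close>-th renewal. Let \<open>g(s)\<close> and \<open>V(s)\<close> be the mean and the variance of the scenery still to be collected up
  to \<open>N\<close> by the walk started at \<open>s\<close>. Both solve renewal recursions, so that
  \<open>exp (i \<theta> Z\<^sub>k + i \<theta> g(S\<^sub>k) - \<theta>\<^sup>2 V(S\<^sub>k) / 2)\<close> has constant expectation up to an error of third order per step. At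
  \<open>k = n\<close> the walk is close to \<open>N\<close> and the last two terms are negligible; hence
  \<open>E[exp (i \<theta> Z\<^sub>n)] \<approx> exp (i \<theta> g(0) - \<theta>\<^sup>2 V(0) / 2)\<close> for \<open>\<theta> = t / sqrt n\<close>, and \<open>g(0) \<approx> E[Z\<^sub>n]\<close>.

  The increments of \<open>g\<close> and \<open>V\<close> over a step are small because the renewal sequence satisfies
  \<open>\<Sum>\<^sub>k \<bar>u\<^sub>k - 1/m\<bar> < \<infinity>\<close> (a Fourier argument, using \<open>E[X\<^sup>2] < \<infinity>\<close>) and because almost surely the partial sums
  of the scenery over an interval of length \<open>l\<close> near the origin are \<open>O(n\<^sup>\<epsilon> l\<^sup>1\<^sup>/\<^sup>2)\<close> (all moments are finite).
  Finally \<open>V(0)\<close> is an explicit quadratic form in the scenery, and \<open>V(0) / n \<rightarrow> 1 - 1/m\<close> almost surely by a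
  fourth-moment bound.\<close>

section \<open>The renewal sequence\<close>

text \<open>The number of steps is fixed, so the walk stops at a random place, and
  \<open>E[Z_n]\<close> is itself of order \<open>sqrt n\<close> for a typical scenery. Stopping at
  a site instead makes the remaining mean and variance functions of the current site alone, hence
  potentials of the renewal chain. The cutoff overshoots by \<open>n^(3/4)\<close>: more than the
  fluctuation \<open>n^(1/2)\<close> of \<open>S_n\<close>, so the walk rarely gets past
  \<open>N\<close>, yet small enough that the uncollected mean, of order
  \<open>n^\<epsilon> * n^(3/8)\<close>, is negligible against \<open>sqrt n\<close> when
  \<open>\<epsilon> < 1/8\<close>. Over a step of length \<open>k\<close> the increment of
  \<open>g\<close> is \<open>O(n^\<epsilon> sqrt k)\<close> and that of \<open>V\<close> is
  \<open>O(n^(2 \<epsilon>) k)\<close>. The error per step therefore grows no faster than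
  \<open>k^2\<close> and is controlled by the second moment of a step. The limit
  \<open>1 - 1/m\<close> is \<open>m\<close> sites per step times the variance
  \<open>(1/m) (1 - 1/m)\<close> of the indicator that a distant site is visited; this is the
  diagonal of the quadratic form, and its off-diagonal part averages out over the scenery.\<close>

lemma finite_parseval:
  fixes b :: "nat \<Rightarrow> complex"
  assumes J: "J > 0"
  shows "(\<Sum>j<J. (norm (\<Sum>n<J. b n * cis (2 * pi * real j / real J) ^ n))\<^sup>2)
           = real J * (\<Sum>n<J. (norm (b n))\<^sup>2)"
proof -
  let ?w = "\<lambda>j. cis (2 * pi * real j / real J)"
  \<comment> \<open>Orthogonality of the characters of the cyclic group of order \<open>J\<close>:
    off the diagonal the terms are powers of a \<open>J\<close>-th root of unity different from 1,
    and their geometric sum is zero.\<close>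
  have orth: "(\<Sum>j<J. ?w j ^ n * cnj (?w j) ^ l) = (if n = l then of_nat J else 0)"
    if "n < J" "l < J" for n l
  proof -
    define z where "z = cis (2 * pi * (real n - real l) / real J)"
    have eq: "?w j ^ n * cnj (?w j) ^ l = z ^ j" for j
      unfolding z_def
      by (simp add: Complex.DeMoivre cis_cnj cis_mult algebra_simps diff_divide_distrib)
    show ?thesis
    proof (cases "n = l")
      case True
      then show ?thesis using eq by (simp add: z_def)
    next
      case False
      have "z \<noteq> 1"
      proof
        assume "z = 1"
        then have "cis (2 * pi * real n / real J) * cnj (cis (2 * pi * real l / real J)) = 1"
          by (simp add: z_def cis_cnj cis_mult algebra_simps diff_divide_distrib)
        then have "cis (2 * pi * real n / real J) * (cnj (cis (2 * pi * real l / real J)) * cis (2 * pi * real l / real J)) 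
            = cis (2 * pi * real l / real J)"
          by (metis mult.assoc mult_1)
        then have "cis (2 * pi * real n / real J) = cis (2 * pi * real l / real J)"
          by (simp add: cis_cnj cis_mult)
        moreover have "inj_on (\<lambda>k. cis (2 * pi * real k / real J)) {..<J}"
          using Complex.bij_betw_roots_unity[OF J] by (simp add: bij_betw_def)
        ultimately show False using False that by (auto dest: inj_onD)
      qed
      moreover have "z ^ J = 1"
      proof -
        have "z ^ J = cis (2 * pi * (real n - real l))"
          using J by (simp only: z_def Complex.DeMoivre) simp
        also have "\<dots> = 1" by (rule cis_multiple_2pi) simp
        finally show ?thesis .
      qed
      ultimately have "(\<Sum>j<J. z ^ j) = 0" by (simp add: geometric_sum)
      then show ?thesis using eq False by simp
    qed
  qed
  have "complex_of_real (\<Sum>j<J. (norm (\<Sum>n<J. b n * ?w j ^ n))\<^sup>2)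
      = (\<Sum>j<J. (\<Sum>n<J. b n * ?w j ^ n) * (\<Sum>l<J. cnj (b l) * cnj (?w j) ^ l))"
    by (simp only: of_real_sum complex_norm_square cnj_sum complex_cnj_mult complex_cnj_power)
  also have "\<dots> = (\<Sum>j<J. \<Sum>n<J. \<Sum>l<J. b n * cnj (b l) * (?w j ^ n * cnj (?w j) ^ l))"
    by (simp add: sum_product algebra_simps)
  also have "\<dots> = (\<Sum>n<J. \<Sum>l<J. \<Sum>j<J. b n * cnj (b l) * (?w j ^ n * cnj (?w j) ^ l))"
    by (rule trans[OF sum.swap], rule sum.cong[OF refl], rule sum.swap)
  also have "\<dots> = (\<Sum>n<J. \<Sum>l<J. b n * cnj (b l) * (if n = l then of_nat J else 0))"
    by (intro sum.cong refl) (simp only: sum_distrib_left[symmetric] orth lessThan_iff)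
  also have "\<dots> = (\<Sum>n<J. b n * cnj (b n) * of_nat J)"
    by (intro sum.cong refl) (simp add: if_distrib cong: if_cong)
  also have "\<dots> = complex_of_real (real J * (\<Sum>n<J. (norm (b n))\<^sup>2))"
    by (simp only: complex_norm_square of_real_mult of_real_sum of_real_of_nat_eq sum_distrib_left mult.commute)
  finally show ?thesis by (simp only: of_real_eq_iff)
qed

text \<open>Bessel's inequality for a bounded power series. Instead of integrating over a circle,
  partial sums are sampled at \<open>J\<close> equidistant points of the circle of radius
  \<open>\<rho>\<close>, where the discrete Parseval identity is exact; then \<open>J\<close> tends
  to infinity and \<open>\<rho>\<close> to 1.\<close>

lemma bessel_unit_disc:
  fixes a :: "nat \<Rightarrow> complex"
  assumes sm: "\<And>\<rho>::real. 0 \<le> \<rho> \<Longrightarrow> \<rho> < 1 \<Longrightarrow> summable (\<lambda>n. norm (a n) * \<rho> ^ n)"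
    and bd: "\<And>z. norm z < 1 \<Longrightarrow> norm (\<Sum>n. a n * z ^ n) \<le> B"
  shows "(\<Sum>n<k. (norm (a n))\<^sup>2) \<le> B\<^sup>2"
proof -
  have radius: "(\<Sum>n<k. (norm (a n))\<^sup>2 * \<rho> ^ (2 * n)) \<le> B\<^sup>2" if \<rho>: "0 \<le> \<rho>" "\<rho> < 1" for \<rho> :: real
  proof -
    let ?f = "\<lambda>n. norm (a n) * \<rho> ^ n"
    \<comment> \<open>The truncation to \<open>J\<close> terms changes the series by at most this
      tail, uniformly on the circle of radius \<open>\<rho>\<close>.\<close>
    define \<delta> where "\<delta> J = (\<Sum>n. ?f (n + J))" for J
    have sf: "summable ?f" using sm \<rho> by blast
    have "(\<lambda>J. suminf ?f - sum ?f {..<J}) \<longlonglongrightarrow> suminf ?f - suminf ?f"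
      by (intro tendsto_intros summable_LIMSEQ sf)
    moreover have "suminf ?f - sum ?f {..<J} = \<delta> J" for J
      unfolding \<delta>_def using suminf_minus_initial_segment[OF sf, of J] by simp
    ultimately have \<delta>0: "\<delta> \<longlonglongrightarrow> 0" by simp
    have part: "norm (\<Sum>n<J. a n * z ^ n) \<le> B + \<delta> J" if z: "norm z = \<rho>" for z J
    proof -
      have s: "summable (\<lambda>n. norm (a n * z ^ n))" using sf by (simp add: norm_mult norm_power z)
      then have s': "summable (\<lambda>n. a n * z ^ n)" by (rule summable_norm_cancel)
      have "(\<Sum>n<J. a n * z ^ n) = (\<Sum>n. a n * z ^ n) - (\<Sum>n. a (n + J) * z ^ (n + J))"
        using suminf_minus_initial_segment[OF s', of J] by simp
      also have "norm \<dots> \<le> norm (\<Sum>n. a n * z ^ n) + norm (\<Sum>n. a (n + J) * z ^ (n + J))"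
        by (rule norm_triangle_ineq4)
      also have "norm (\<Sum>n. a (n + J) * z ^ (n + J)) \<le> (\<Sum>n. norm (a (n + J) * z ^ (n + J)))"
        by (rule summable_norm[OF summable_ignore_initial_segment[OF s]])
      also have "\<dots> = \<delta> J" by (simp add: \<delta>_def norm_mult norm_power z)
      finally show ?thesis using bd[of z] z \<rho> by simp
    qed
    have fin: "(\<Sum>n<k. (norm (a n))\<^sup>2 * \<rho> ^ (2 * n)) \<le> (B + \<delta> J)\<^sup>2" if J: "J \<ge> k" "J > 0" for J
    proof -
      have "(\<Sum>n<k. (norm (a n))\<^sup>2 * \<rho> ^ (2 * n)) \<le> (\<Sum>n<J. (norm (a n))\<^sup>2 * \<rho> ^ (2 * n))"
        using J \<rho> by (intro sum_mono2) auto
      also have "\<dots> = (\<Sum>n<J. (norm (a n * of_real \<rho> ^ n))\<^sup>2)"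
        using \<rho> by (simp add: norm_mult norm_power power_mult_distrib power_mult [symmetric] mult.commute)
      finally have "real J * (\<Sum>n<k. (norm (a n))\<^sup>2 * \<rho> ^ (2 * n)) \<le> real J * (\<Sum>n<J. (norm (a n * of_real \<rho> ^ n))\<^sup>2)"
        by (intro mult_left_mono) auto
      also have "\<dots> = (\<Sum>j<J. (norm (\<Sum>n<J. a n * of_real \<rho> ^ n * cis (2 * pi * real j / real J) ^ n))\<^sup>2)"
        by (rule finite_parseval[symmetric]) fact
      also have "\<dots> = (\<Sum>j<J. (norm (\<Sum>n<J. a n * (of_real \<rho> * cis (2 * pi * real j / real J)) ^ n))\<^sup>2)"
        by (simp add: power_mult_distrib mult.assoc)
      also have "\<dots> \<le> (\<Sum>j<J. (B + \<delta> J)\<^sup>2)"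
        by (intro sum_mono power_mono part) (use \<rho> in \<open>auto simp: norm_mult\<close>)
      finally show ?thesis using J by simp
    qed
    have "(\<lambda>J. (B + \<delta> J)\<^sup>2) \<longlonglongrightarrow> (B + 0)\<^sup>2" by (intro tendsto_intros \<delta>0)
    then show ?thesis
      by (intro tendsto_lowerbound[where F = sequentially and f = "\<lambda>J. (B + \<delta> J)\<^sup>2"])
        (auto intro!: eventually_sequentiallyI[of "max k 1"] fin)
  qed
  have "((\<lambda>\<rho>::real. \<Sum>n<k. (norm (a n))\<^sup>2 * \<rho> ^ (2 * n)) \<longlongrightarrow> (\<Sum>n<k. (norm (a n))\<^sup>2 * 1 ^ (2 * n))) (at_left 1)"
    by (intro tendsto_intros)
  then have "(\<Sum>n<k. (norm (a n))\<^sup>2 * 1 ^ (2 * n)) \<le> B\<^sup>2"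
  proof (rule tendsto_upperbound)
    show "\<forall>\<^sub>F \<rho> in at_left (1::real). (\<Sum>n<k. (norm (a n))\<^sup>2 * \<rho> ^ (2 * n)) \<le> B\<^sup>2"
      unfolding eventually_at_left_field by (rule exI[of _ 0]) (auto intro: radius)
  qed simp
  then show ?thesis by simp
qed


section \<open>Renewal probabilities and tails of the step law\<close>

abbreviation "expect \<equiv> measure_pmf.expectation"

text \<open>The probability that \<open>n\<close> is a renewal, decomposed according to the first
  step; the origin counts as a renewal.\<close>

fun renewal :: "nat pmf \<Rightarrow> nat \<Rightarrow> real" where
  "renewal p n = (if n = 0 then 1 else \<Sum>k\<in>{1..n}. pmf p k * renewal p (n - k))"

declare renewal.simps [simp del]

lemma renewal_0 [simp]: "renewal p 0 = 1"
  by (simp add: renewal.simps)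

lemma renewal_rec: "n > 0 \<Longrightarrow> renewal p n = (\<Sum>k\<in>{1..n}. pmf p k * renewal p (n - k))"
  by (subst renewal.simps) simp

lemma renewal_bounds: "0 \<le> renewal p n" "renewal p n \<le> 1"
proof -
  have "0 \<le> renewal p n \<and> renewal p n \<le> 1"
  proof (induction n rule: less_induct)
    case (less n)
    show ?case
    proof (cases "n = 0")
      case False
      have *: "0 \<le> renewal p (n - k)" "renewal p (n - k) \<le> 1" if "k \<in> {1..n}" for k
        using less[of "n - k"] that False by auto
      have "(\<Sum>k\<in>{1..n}. pmf p k * renewal p (n - k)) \<le> (\<Sum>k\<in>{1..n}. pmf p k * 1)"
        by (intro sum_mono mult_left_mono *) auto
      also have "\<dots> = measure_pmf.prob p {1..n}" by (simp add: measure_measure_pmf_finite)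
      also have "\<dots> \<le> 1" by simp
      finally have "renewal p n \<le> 1" using False by (simp add: renewal_rec)
      moreover have "0 \<le> renewal p n" using False * by (auto simp: renewal_rec intro!: sum_nonneg)
      ultimately show ?thesis by simp
    qed simp
  qed
  then show "0 \<le> renewal p n" "renewal p n \<le> 1" by auto
qed

text \<open>Identities are proved between formal power series, where no convergence is at stake; the
  Cauchy product carries them over to values at points of absolute convergence.\<close>

lemma power_series_times:
  fixes a b :: "real fps" and z :: complex
  assumes "summable (\<lambda>n. norm (of_real (fps_nth a n) * z ^ n))"
    and "summable (\<lambda>n. norm (of_real (fps_nth b n) * z ^ n))"
  shows "(\<Sum>n. of_real (fps_nth a n) * z ^ n) * (\<Sum>n. of_real (fps_nth b n) * z ^ n)
    = (\<Sum>n. of_real (fps_nth (a * b) n) * z ^ n)"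
proof -
  have "(\<Sum>i\<le>n. of_real (fps_nth a i) * z ^ i * (of_real (fps_nth b (n - i)) * z ^ (n - i)))
      = of_real (fps_nth (a * b) n) * z ^ n" for n
  proof -
    have "(\<Sum>i\<le>n. of_real (fps_nth a i) * z ^ i * (of_real (fps_nth b (n - i)) * z ^ (n - i)))
      = (\<Sum>i\<le>n. of_real (fps_nth a i * fps_nth b (n - i)) * z ^ n)"
      by (intro sum.cong refl) (simp add: power_add[symmetric] mult_ac flip: power_add)
    then show ?thesis
      by (simp add: fps_mult_nth atLeast0AtMost sum_distrib_right)
  qed
  with Cauchy_product[OF assms] show ?thesis by simp
qed

lemma summable_linear_power_series:
  fixes a :: "nat \<Rightarrow> real" and z :: complex
  assumes "\<And>n. \<bar>a n\<bar> \<le> B * real (Suc n)" "norm z < 1"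
  shows "summable (\<lambda>n. norm (of_real (a n) * z ^ n))"
proof (rule summable_comparison_test')
  have "summable (\<lambda>n. of_nat (Suc n) * norm z ^ n)"
    using geometric_deriv_sums[of "norm z"] assms by (auto simp: sums_iff)
  then show "summable (\<lambda>n. B * (of_nat (Suc n) * norm z ^ n))" by (rule summable_mult)
  fix n :: nat
  have "\<bar>a n\<bar> * norm z ^ n \<le> B * real (Suc n) * norm z ^ n"
    by (intro mult_right_mono assms) auto
  then show "norm (norm (of_real (a n) * z ^ n)) \<le> B * (of_nat (Suc n) * norm z ^ n)"
    by (simp add: norm_mult norm_power algebra_simps)
qed

lemma sum_inverse_squares_le:
  assumes "k > 0"
  shows "(\<Sum>n\<in>{k<..l}. (1 / real n)\<^sup>2) \<le> 1 / real k"
proof (cases "k \<le> l")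
  case True
  then have "(\<Sum>n\<in>{k<..l}. (1 / real n)\<^sup>2) \<le> 1 / real k - 1 / real l"
  proof (induction l rule: dec_induct)
    case (step l)
    have "{k<..Suc l} = insert (Suc l) {k<..l}" using step by auto
    moreover have "(1 / real (Suc l))\<^sup>2 \<le> 1 / real l - 1 / real (Suc l)"
    proof -
      have "(1 / real (Suc l))\<^sup>2 \<le> 1 / (real l * real (Suc l))"
        using assms step by (auto simp: power2_eq_square intro!: divide_left_mono)
      also have "\<dots> = 1 / real l - 1 / real (Suc l)"
        using assms step by (simp add: field_simps)
      finally show ?thesis .
    qed
    ultimately show ?case using step by simp
  qed simp
  then show ?thesis by (smt (verit) divide_nonneg_nonneg of_nat_0_le_iff)
qed simp

locale renewal_law =
  fixes p :: "nat pmf"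
  assumes step_pos: "0 \<notin> set_pmf p"
    and aperiodic: "Gcd (set_pmf p) = 1"
    and square_integrable: "integrable p (\<lambda>k. (real k)\<^sup>2)"
begin

definition mean :: real where "mean = expect p real"
definition tail :: "nat \<Rightarrow> real" where "tail n = measure_pmf.prob p {n<..}"
text \<open>Equals both \<open>E[(X - n - 1)^+]\<close> and the sum of \<open>tail k\<close> over
  \<open>k > n\<close>. Divided by \<open>mean\<close>, it is the source term of the convolution
  equation for \<open>dev\<close>.\<close>

definition excess :: "nat \<Rightarrow> real" where "excess n = mean - (\<Sum>k\<le>n. tail k)"
text \<open>The coefficients of \<open>(1 - z) U(z)\<close>, with \<open>U\<close> the generating
  function of \<open>renewal\<close> and the value 0 at index -1. This series is the reciprocal of
  the tail series.\<close>

definition diff :: "nat \<Rightarrow> real" where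
  "diff n = renewal p n - (if n = 0 then 0 else renewal p (n - 1))"
definition dev :: "nat \<Rightarrow> real" where "dev n = renewal p n - 1 / mean"
definition second_moment :: real where
  "second_moment = expect p (\<lambda>k. (real k)\<^sup>2)"

lemma integrable_le_square:
  fixes f :: "nat \<Rightarrow> 'c::{banach, second_countable_topology}"
  assumes "\<And>k. norm (f k) \<le> C * (real k)\<^sup>2"
  shows "integrable p f"
  by (rule Bochner_Integration.integrable_bound[where f = "\<lambda>k. C * (real k)\<^sup>2"])
    (use square_integrable assms in \<open>auto intro: order_trans[OF _ abs_ge_self]\<close>)

lemma le_square: "real k \<le> (real k)\<^sup>2"
  by (metis of_nat_mono of_nat_power le_square power2_eq_square)

lemma integrable_indicator_step [simp]: "integrable p (indicator A :: nat \<Rightarrow> real)"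
  by (rule measure_pmf.integrable_const_bound[where B = 1]) (auto simp: indicator_def)

lemma integrable_step [simp]: "integrable p real"
  by (rule integrable_le_square[where C = 1]) (use le_square in auto)

lemma AE_step: "AE k in p. k \<ge> 1"
  using step_pos by (auto simp: AE_measure_pmf_iff) (metis not_less_eq_eq not_one_le_zero One_nat_def le_zero_eq)

lemma mean_ge_1: "mean \<ge> 1"
proof -
  have "expect p (\<lambda>_. 1) \<le> mean"
    unfolding mean_def using AE_step by (intro integral_mono_AE) auto
  then show ?thesis by simp
qed

lemma tail_bounds: "0 \<le> tail n" "tail n \<le> 1"
  by (auto simp: tail_def)

lemma tail_0: "tail 0 = 1"
proof -
  have "AE k in p. k \<in> {0<..}" using AE_step by eventually_elim simp
  then show ?thesis unfolding tail_def by (subst measure_pmf.prob_eq_1) auto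
qed

lemma tail_Suc: "tail (Suc n) = tail n - pmf p (Suc n)"
proof -
  have "{n<..} = insert (Suc n) {Suc n<..}" by auto
  then have "tail n = measure_pmf.prob p {Suc n} + tail (Suc n)"
    unfolding tail_def by (simp only: insert_is_Un[of "Suc n" "{Suc n<..}"])
      (subst measure_pmf.finite_measure_Union, auto)
  then show ?thesis by (simp add: measure_pmf_single)
qed

lemma tail_eq: "tail n = expect p (indicator {n<..})"
  by (simp add: tail_def)

lemma excess_eq: "excess n = expect p (\<lambda>k. real (k - Suc n))"
proof -
  have *: "real (k - Suc n) = real k - (\<Sum>i\<le>n. indicator {i<..} k)" for k
  proof (induction n)
    case 0
    show ?case by (cases k) (auto simp: indicator_def)
  qed (auto simp: indicator_def of_nat_diff)
  show ?thesis
    unfolding * excess_def mean_def tail_eq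
    by (subst Bochner_Integration.integral_diff) (auto simp: Bochner_Integration.integral_sum)
qed

lemma excess_nonneg: "excess n \<ge> 0"
  by (simp add: excess_eq)

text \<open>At most \<open>k\<close> terms are positive, each at most \<open>k\<close>. Taken in
  expectation over the step, this yields both consequences of the second moment: summability of
  \<open>excess\<close> and of \<open>n * tail n\<close>.\<close>

lemma sum_le_square:
  fixes f :: "nat \<Rightarrow> real"
  assumes "\<And>n. n < k \<Longrightarrow> f n \<le> real k" "\<And>n. n \<ge> k \<Longrightarrow> f n \<le> 0"
  shows "(\<Sum>n<l. f n) \<le> (real k)\<^sup>2"
proof -
  have "(\<Sum>n<l. f n) \<le> (\<Sum>n<l. if n < k then real k else 0)"
    using assms by (intro sum_mono) (auto simp: not_less)
  also have "\<dots> = real (card ({..<l} \<inter> {..<k})) * real k"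
    by (simp add: sum.If_cases lessThan_def Int_def)
  also have "\<dots> \<le> real k * real k"
    by (intro mult_right_mono) (metis Int_lower2 card_lessThan card_mono finite_lessThan of_nat_mono, simp)
  finally show ?thesis by (simp add: power2_eq_square)
qed

lemma summable_excess: "summable excess"
proof (rule bounded_imp_summable[where B = second_moment])
  fix l
  have "(\<Sum>n\<le>l. excess n) = expect p (\<lambda>k. \<Sum>n<Suc l. real (k - Suc n))"
    unfolding excess_eq lessThan_Suc_atMost
    by (intro Bochner_Integration.integral_sum[symmetric] integrable_le_square[where C = 1])
      (metis diff_le_self le_square mult_1 norm_of_nat of_nat_mono order_trans)
  also have "\<dots> \<le> second_moment" unfolding second_moment_def
  proof (rule integral_mono)
    show *: "(\<Sum>n<Suc l. real (k - Suc n)) \<le> (real k)\<^sup>2" for k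
      by (intro sum_le_square) auto
    show "integrable p (\<lambda>k. \<Sum>n<Suc l. real (k - Suc n))"
      by (rule integrable_le_square[where C = 1]) (use * in \<open>simp add: sum_nonneg del: sum.lessThan_Suc\<close>)
  qed (rule square_integrable)
  finally show "(\<Sum>n\<le>l. excess n) \<le> second_moment" .
qed (rule excess_nonneg)

lemma tail_sums: "tail sums mean"
proof -
  have "excess \<longlonglongrightarrow> 0" using summable_excess by (rule summable_LIMSEQ_zero)
  then have "(\<lambda>n. mean - excess n) \<longlonglongrightarrow> mean - 0" by (intro tendsto_intros)
  then have "(\<lambda>n. \<Sum>k\<le>n. tail k) \<longlonglongrightarrow> mean" by (simp add: excess_def)
  then show ?thesis by (simp add: sums_def_le)
qed

lemma summable_tail_weighted: "summable (\<lambda>n. real n * tail n)"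
proof (rule bounded_imp_summable[where B = second_moment])
  fix l
  have "(\<Sum>n\<le>l. real n * tail n) = (\<Sum>n<Suc l. expect p (\<lambda>k. real n * indicator {n<..} k))"
    by (simp only: tail_eq integral_mult_right_zero lessThan_Suc_atMost)
  also have "\<dots> = expect p (\<lambda>k. \<Sum>n<Suc l. real n * indicator {n<..} k)"
    by (rule Bochner_Integration.integral_sum[symmetric]) (rule integrable_mult_right, rule integrable_indicator_step)
  also have "\<dots> \<le> second_moment" unfolding second_moment_def
  proof (rule integral_mono)
    have *: "(\<Sum>n<Suc l. real n * indicator {n<..} k) \<le> (real k)\<^sup>2" for k
      by (intro sum_le_square) (auto simp: indicator_def)
    then show "(\<Sum>n<Suc l. real n * indicator {n<..} k) \<le> (real k)\<^sup>2" for k .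
    show "integrable p (\<lambda>k. \<Sum>n<Suc l. real n * indicator {n<..} k)"
      by (intro Bochner_Integration.integrable_sum integrable_mult_right integrable_indicator_step)
  qed (rule square_integrable)
  finally show "(\<Sum>n\<le>l. real n * tail n) \<le> second_moment" .
qed (simp add: tail_bounds)

text \<open>The term of index \<open>k\<close> is the probability that the last renewal up to
  \<open>n\<close> is at \<open>n - k\<close>; these events are disjoint and exhaustive.\<close>

lemma renewal_equation: "(\<Sum>k\<le>n. tail k * renewal p (n - k)) = 1"
proof (induction n)
  case (Suc n)
  have "(\<Sum>k\<le>Suc n. tail k * renewal p (Suc n - k))
      = renewal p (Suc n) + (\<Sum>k\<le>n. tail (Suc k) * renewal p (n - k))"
    by (subst sum.atMost_Suc_shift) (simp add: tail_0)
  also have "(\<Sum>k\<le>n. tail (Suc k) * renewal p (n - k))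
      = (\<Sum>k\<le>n. tail k * renewal p (n - k)) - (\<Sum>k\<le>n. pmf p (Suc k) * renewal p (n - k))"
    by (simp add: tail_Suc sum_subtractf algebra_simps)
  also have "(\<Sum>k\<le>n. pmf p (Suc k) * renewal p (n - k)) = renewal p (Suc n)"
    unfolding lessThan_Suc_atMost[symmetric] using renewal_rec[of "Suc n" p] by (simp only: sum.atLeast1_atMost_eq diff_Suc_Suc zero_less_Suc One_nat_def)
  finally show ?case using Suc by simp
qed (simp add: tail_0)


section \<open>The tail generating function on the closed unit disc\<close>

definition tail_series :: "complex \<Rightarrow> complex" where
  "tail_series z = (\<Sum>n. of_real (tail n) * z ^ n)"

lemma norm_tail_term_le:
  fixes z :: complex
  assumes "norm z \<le> 1"
  shows "norm (of_real (tail n) * z ^ n) \<le> tail n"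
proof -
  have "norm z ^ n \<le> 1" using assms by (simp add: power_le_one)
  then show ?thesis
    using tail_bounds[of n] by (simp add: norm_mult norm_power mult_left_le)
qed

lemma summable_tail_series:
  fixes z :: complex
  assumes "norm z \<le> 1"
  shows "summable (\<lambda>n. norm (of_real (tail n) * z ^ n))"
proof (rule summable_comparison_test')
  show "summable tail" using tail_sums by (rule sums_summable)
  show "norm (norm (of_real (tail n) * z ^ n)) \<le> tail n" for n
    using norm_tail_term_le[OF assms] by simp
qed

text \<open>For a fixed step \<open>k\<close> the truncated sum telescopes to
  \<open>1 - z ^ min k l\<close>; dominated convergence removes the truncation. The boundary of the
  disc is included because the tails are summable.\<close>

lemma one_minus_pgf:
  assumes z: "norm z \<le> 1"
  shows "(1 - z) * tail_series z = 1 - expect p (\<lambda>k. z ^ k)"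
proof -
  have nz: "norm (z ^ n) \<le> 1" for n using z by (simp add: norm_power power_le_one)
  have int: "integrable p (\<lambda>k. z ^ f k)" for f :: "nat \<Rightarrow> nat"
    by (rule measure_pmf.integrable_const_bound[where B = 1]) (auto simp: nz)
  have part: "(\<Sum>n<l. of_real (tail n) * z ^ n) * (1 - z) = 1 - expect p (\<lambda>k. z ^ min k l)" for l
  proof -
    have "(\<Sum>n<l. indicator {n<..} k *\<^sub>R z ^ n) * (1 - z) = 1 - z ^ min k l" for k
    proof (induction l)
      case (Suc l)
      show ?case
      proof (cases "l < k")
        case True
        then have "min k (Suc l) = Suc l" "min k l = l" by auto
        from Suc True this have *: "(\<Sum>n<Suc l. indicator {n<..} k *\<^sub>R z ^ n) * (1 - z) = 1 - z ^ l + z ^ l * (1 - z)"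
          by (simp only: sum.lessThan_Suc distrib_right) (simp add: indicator_def)
        show ?thesis by (simp only: * \<open>min k (Suc l) = Suc l\<close>) (simp add: algebra_simps)
      next
        case False
        then have "min k (Suc l) = k" "min k l = k" by auto
        then show ?thesis using Suc False by simp
      qed
    qed simp
    moreover have "(\<Sum>n<l. of_real (tail n) * z ^ n) * (1 - z)
        = expect p (\<lambda>k. (\<Sum>n<l. indicator {n<..} k *\<^sub>R z ^ n) * (1 - z))"
      by (subst Bochner_Integration.integral_mult_left) (simp_all add: tail_eq scaleR_conv_of_real)
    ultimately show ?thesis using int by (simp add: measure_pmf.prob_space)
  qed
  have "(\<lambda>l. \<Sum>n<l. of_real (tail n) * z ^ n) \<longlonglongrightarrow> tail_series z"
    unfolding tail_series_def by (rule summable_LIMSEQ[OF summable_norm_cancel[OF summable_tail_series[OF z]]])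
  then have "(\<lambda>l. (\<Sum>n<l. of_real (tail n) * z ^ n) * (1 - z)) \<longlonglongrightarrow> tail_series z * (1 - z)"
    by (intro tendsto_intros)
  moreover have "(\<lambda>l. expect p (\<lambda>k. z ^ min k l)) \<longlonglongrightarrow> expect p (\<lambda>k. z ^ k)"
  proof (rule integral_dominated_convergence[where w = "\<lambda>_. 1"])
    have "(\<lambda>l. z ^ min k l) \<longlonglongrightarrow> z ^ k" for k
      by (rule tendsto_eventually) (auto intro!: eventually_sequentiallyI[of k] simp: min_def)
    then show "AE k in p. (\<lambda>l. z ^ min k l) \<longlonglongrightarrow> z ^ k" by simp
  qed (auto simp: nz)
  then have "(\<lambda>l. 1 - expect p (\<lambda>k. z ^ min k l)) \<longlonglongrightarrow> 1 - expect p (\<lambda>k. z ^ k)"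
    by (intro tendsto_intros)
  ultimately show ?thesis unfolding part by (metis LIMSEQ_unique mult.commute)
qed

lemma tail_series_1: "tail_series 1 = of_real mean"
  using suminf_of_real[OF sums_summable[OF tail_sums], where 'a = complex] sums_unique[OF tail_sums]
  by (simp add: tail_series_def)

text \<open>If the series vanished at \<open>z \<noteq> 1\<close>, then \<open>E[z ^ X] = 1\<close>, which forces \<open>z ^ k = 1\<close> for every
  possible step \<open>k\<close>; aperiodicity excludes this.\<close>

lemma tail_series_nonzero:
  assumes z: "norm z \<le> 1"
  shows "tail_series z \<noteq> 0"
proof
  assume 0: "tail_series z = 0"
  then have z1: "z \<noteq> 1" using tail_series_1 mean_ge_1 by auto
  have nz: "norm (z ^ n) \<le> 1" for n using z by (simp add: norm_power power_le_one)
  have int: "integrable p (\<lambda>k. z ^ k)"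
    by (rule measure_pmf.integrable_const_bound[where B = 1]) (auto simp: nz)
  have "expect p (\<lambda>k. z ^ k) = 1" using one_minus_pgf[OF z] 0 by simp
  then have "expect p (\<lambda>k. 1 - Re (z ^ k)) = 0"
    using integral_Re[OF int] int by (simp add: measure_pmf.prob_space)
  moreover have "AE k in p. 0 \<le> 1 - Re (z ^ k)"
    using nz complex_Re_le_cmod order_trans by (auto intro!: AE_I2) blast
  ultimately have "AE k in p. 1 - Re (z ^ k) = 0"
    using int by (subst (asm) integral_nonneg_eq_0_iff_AE) auto
  then have unit: "z ^ k = 1" if "k \<in> set_pmf p" for k
  proof -
    have re: "Re (z ^ k) = 1" using \<open>AE k in p. 1 - Re (z ^ k) = 0\<close> that by (auto simp: AE_measure_pmf_iff)
    have "(Re (z ^ k))\<^sup>2 + (Im (z ^ k))\<^sup>2 \<le> 1"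
      using nz[of k] by (metis cmod_power2 norm_ge_zero one_power2 power_mono)
    then have "Im (z ^ k) = 0" using re by simp
    then show ?thesis using re by (simp add: complex_eq_iff)
  qed
  define d where "d = (LEAST n. n > 0 \<and> z ^ n = 1)"
  obtain k where k: "k \<in> set_pmf p" using set_pmf_not_empty by fast
  then have "k > 0 \<and> z ^ k = 1" using unit step_pos by (metis gr0I)
  then have d: "d > 0" "z ^ d = 1"
    using LeastI[of "\<lambda>n. n > 0 \<and> z ^ n = 1" k] by (auto simp: d_def)
  have "d dvd k" if "k \<in> set_pmf p" for k
  proof (rule ccontr)
    assume "\<not> d dvd k"
    then have "k mod d > 0" by (simp add: dvd_eq_mod_eq_0)
    moreover have "z ^ (k mod d) = 1"
    proof -
      have "z ^ k = (z ^ d) ^ (k div d) * z ^ (k mod d)"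
        by (metis div_mult_mod_eq mult.commute power_add power_mult)
      then show ?thesis using unit[OF that] d by simp
    qed
    ultimately have "d \<le> k mod d" unfolding d_def by (intro Least_le) (auto simp: d_def)
    then show False using mod_less_divisor[OF d(1), of k] by linarith
  qed
  then have "d dvd 1" using aperiodic by (metis Gcd_greatest)
  then show False using d z1 by simp
qed

text \<open>A continuous function without zeros on a compact disc is bounded away from zero;
  continuity up to the boundary comes from the Weierstrass test with the summable tails.\<close>

lemma tail_series_lower_bound: "\<exists>c>0. \<forall>z. norm z \<le> 1 \<longrightarrow> c \<le> norm (tail_series z)"
proof -
  have "continuous_on (cball 0 1) tail_series"
  proof (rule uniform_limit_theorem[where F = sequentially])
    show "uniform_limit (cball 0 1) (\<lambda>n z. \<Sum>i<n. of_real (tail i) * z ^ i) tail_series sequentially"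
      unfolding tail_series_def
    proof (rule Weierstrass_m_test)
      show "summable tail" using tail_sums by (rule sums_summable)
      show "norm (of_real (tail n) * z ^ n) \<le> tail n" if "z \<in> cball 0 1" for n and z :: complex
        using norm_tail_term_le[of z n] that by simp
    qed
  qed (auto intro!: always_eventually continuous_intros)
  then have "continuous_on (cball 0 1) (\<lambda>z. norm (tail_series z))" by (intro continuous_intros)
  then obtain z0 where z0: "z0 \<in> cball 0 1" "\<And>z. z \<in> cball 0 1 \<Longrightarrow> norm (tail_series z0) \<le> norm (tail_series z)"
    using continuous_attains_inf[of "cball (0::complex) 1" "\<lambda>z. norm (tail_series z)"] by auto
  then show ?thesis using tail_series_nonzero[of z0] by (intro exI[of _ "norm (tail_series z0)"]) auto
qed

lemma abs_diff_le_1: "\<bar>diff n\<bar> \<le> 1"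
  using renewal_bounds[of p n] renewal_bounds[of p "n - 1"] by (auto simp: diff_def)

text \<open>The difference of \<open>renewal_equation\<close> at \<open>n\<close> and at
  \<open>n - 1\<close>: as series, \<open>T(z) (1 - z) U(z) = 1\<close>.\<close>

lemma tail_times_diff: "Abs_fps tail * Abs_fps diff = 1"
proof (rule fps_ext)
  fix n
  have "(\<Sum>i\<le>n. tail i * diff (n - i)) = (if n = 0 then 1 else 0)"
  proof (cases n)
    case (Suc l)
    have "(\<Sum>i\<le>n. tail i * diff (n - i)) = (\<Sum>i\<le>n. tail i * renewal p (n - i)) 
        - (\<Sum>i\<le>n. tail i * (if n - i = 0 then 0 else renewal p (n - i - 1)))"
      by (simp add: diff_def sum_subtractf algebra_simps)
    also have "(\<Sum>i\<le>n. tail i * (if n - i = 0 then 0 else renewal p (n - i - 1)))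
       = (\<Sum>i\<le>l. tail i * renewal p (l - i))"
      unfolding Suc by (simp add: Suc_diff_le)
    finally show ?thesis by (simp add: renewal_equation Suc)
  qed (simp add: diff_def tail_0)
  then show "fps_nth (Abs_fps tail * Abs_fps diff) n = fps_nth 1 n" 
    by (simp add: fps_mult_nth atLeast0AtMost)
qed

text \<open>The operator \<open>z d/dz\<close> applied to \<open>T D = 1\<close>, that is
  \<open>T (z D') = - (z T') D\<close>, read off coefficientwise.\<close>

lemma tail_times_weighted_diff:
  "Abs_fps tail * Abs_fps (\<lambda>n. real n * diff n) = Abs_fps (\<lambda>n. - (real n * tail n)) * Abs_fps diff"
proof (rule fps_ext)
  fix n
  have "(\<Sum>i\<le>n. tail i * (real (n - i) * diff (n - i))) + (\<Sum>i\<le>n. real i * tail i * diff (n - i))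
      = real n * (\<Sum>i\<le>n. tail i * diff (n - i))"
    unfolding sum.distrib[symmetric] sum_distrib_left by (intro sum.cong) (auto simp: of_nat_diff algebra_simps)
  also have "(\<Sum>i\<le>n. tail i * diff (n - i)) = fps_nth (Abs_fps tail * Abs_fps diff) n"
    by (simp add: fps_mult_nth atLeast0AtMost)
  finally show "fps_nth (Abs_fps tail * Abs_fps (\<lambda>n. real n * diff n)) n
      = fps_nth (Abs_fps (\<lambda>n. - (real n * tail n)) * Abs_fps diff) n"
    by (simp add: fps_mult_nth atLeast0AtMost tail_times_diff sum_negf eq_neg_iff_add_eq_0)
qed

text \<open>In the disc \<open>z D' = - z T' / T^2\<close>. The numerator is bounded by the sum of
  \<open>n * tail n\<close> and the denominator is bounded below, so Bessel's inequality puts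
  \<open>n * diff n\<close> in \<open>l^2\<close>. This takes the place of Wiener's theorem on
  reciprocals of absolutely convergent Fourier series.\<close>

lemma weighted_diff_square_bound: "\<exists>B\<ge>0. \<forall>k. (\<Sum>n<k. (real n * diff n)\<^sup>2) \<le> B\<^sup>2"
proof -
  obtain c where c: "c > 0" "\<And>z. norm z \<le> 1 \<Longrightarrow> c \<le> norm (tail_series z)"
    using tail_series_lower_bound by blast
  define A where "A = (\<Sum>n. real n * tail n)"
  have A0: "A \<ge> 0" unfolding A_def by (rule suminf_nonneg[OF summable_tail_weighted]) (simp add: tail_bounds)
  define B where "B = A / (c * c)"
  have weighted: "\<bar>real n * diff n\<bar> \<le> 1 * real (Suc n)" for n
    using mult_left_mono[OF abs_diff_le_1[of n], of "real n"] by (simp add: abs_mult)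
  have bd: "norm (\<Sum>n. of_real (real n * diff n) * z ^ n) \<le> B" if z: "norm z < 1" for z :: complex
  proof -
    have sd: "summable (\<lambda>n. norm (of_real (diff n) * z ^ n))"
      by (rule summable_linear_power_series[where B = 1])
        (use z in \<open>auto intro: order_trans[OF abs_diff_le_1]\<close>)
    have snd: "summable (\<lambda>n. norm (of_real (real n * diff n) * z ^ n))"
      by (rule summable_linear_power_series[OF weighted z])
    have st: "summable (\<lambda>n. norm (of_real (tail n) * z ^ n))" using summable_tail_series z by simp
    have le: "norm (of_real (- (real n * tail n)) * z ^ n) \<le> real n * tail n" for n
      using mult_left_mono[OF norm_tail_term_le[of z n], of "real n"] z by (simp add: norm_mult mult.assoc)
    have snt: "summable (\<lambda>n. norm (of_real (- (real n * tail n)) * z ^ n))"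
      by (rule summable_comparison_test'[OF summable_tail_weighted]) (use le in auto)
    let ?D = "\<Sum>n. of_real (diff n) * z ^ n" and ?E = "\<Sum>n. of_real (real n * diff n) * z ^ n"
      and ?K = "\<Sum>n. of_real (- (real n * tail n)) * z ^ n"
    have RD: "tail_series z * ?D = 1"
    proof -
      have "tail_series z * ?D = (\<Sum>n. of_real (fps_nth (1 :: real fps) n) * z ^ n)"
        using power_series_times[of "Abs_fps tail" z "Abs_fps diff"] st sd
        by (simp add: tail_series_def tail_times_diff)
      also have "\<dots> = 1" using powser_sums_if[of 0 z] by (simp add: if_distrib sums_iff cong: if_cong)
      finally show ?thesis .
    qed
    have RE: "tail_series z * ?E = ?K * ?D"
      using power_series_times[of "Abs_fps tail" z "Abs_fps (\<lambda>n. real n * diff n)"] st snd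
        power_series_times[of "Abs_fps (\<lambda>n. - (real n * tail n))" z "Abs_fps diff"] snt sd
      by (simp add: tail_series_def tail_times_weighted_diff)
    have "?E * (tail_series z * tail_series z) = (tail_series z * ?E) * tail_series z" by (simp only: mult_ac)
    also have "\<dots> = ?K * (tail_series z * ?D)" unfolding RE by (simp only: mult_ac)
    also have "\<dots> = ?K" unfolding RD by simp
    finally have "?E * (tail_series z * tail_series z) = ?K" .
    moreover have "norm ?K \<le> A"
      unfolding A_def using norm_suminf_le[OF le summable_tail_weighted] by simp
    ultimately have "norm ?E * (norm (tail_series z) * norm (tail_series z)) \<le> A"
      by (simp only: norm_mult[symmetric])
    moreover have "norm ?E * (c * c) \<le> norm ?E * (norm (tail_series z) * norm (tail_series z))"
      using c z by (intro mult_left_mono mult_mono) auto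
    ultimately show ?thesis using c by (simp add: B_def field_simps)
  qed
  have "(\<Sum>n<k. (norm (complex_of_real (real n * diff n)))\<^sup>2) \<le> B\<^sup>2" for k
  proof (rule bessel_unit_disc[OF _ bd])
    fix \<rho> :: real assume "0 \<le> \<rho>" "\<rho> < 1"
    then show "summable (\<lambda>n. norm (complex_of_real (real n * diff n)) * \<rho> ^ n)"
      using summable_linear_power_series[OF weighted, of "of_real \<rho>"]
      by (simp add: norm_mult norm_power)
  qed
  then show ?thesis using A0 c by (intro exI[of _ B]) (auto simp: B_def norm_mult power_mult_distrib)
qed

text \<open>Cauchy-Schwarz between \<open>n * diff n\<close> in \<open>l^2\<close> and
  \<open>1 / n\<close>, whose squares beyond \<open>k\<close> sum to at most \<open>1 / k\<close>.
  The rate in \<open>k\<close>, and not only summability, is wanted for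
  \<open>dev_decay\<close>.\<close>

lemma sum_abs_diff_bound: "\<exists>B\<ge>0. \<forall>k>0. \<forall>l. (\<Sum>n\<in>{k<..l}. \<bar>diff n\<bar>) \<le> B / sqrt (real k)"
proof -
  obtain B where B: "B \<ge> 0" "\<And>k. (\<Sum>n<k. (real n * diff n)\<^sup>2) \<le> B\<^sup>2"
    using weighted_diff_square_bound by blast
  have "(\<Sum>n\<in>{k<..l}. \<bar>diff n\<bar>) \<le> B / sqrt (real k)" if k: "k > 0" for k l
  proof -
    have "(\<Sum>n\<in>{k<..l}. \<bar>diff n\<bar>) = (\<Sum>n\<in>{k<..l}. \<bar>real n * diff n\<bar> * (1 / real n))"
      using k by (intro sum.cong) (auto simp: abs_mult)
    also have "\<dots> \<le> L2_set (\<lambda>n. real n * diff n) {k<..l} * L2_set (\<lambda>n. 1 / real n) {k<..l}"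
      using L2_set_mult_ineq[of "\<lambda>n. real n * diff n" "\<lambda>n. 1 / real n" "{k<..l}"] by (simp add: abs_mult)
    also have "\<dots> \<le> sqrt (B\<^sup>2) * sqrt (1 / real k)"
      unfolding L2_set_def
      by (intro mult_mono real_sqrt_le_mono sum_inverse_squares_le k
          order_trans[OF sum_mono2[of "{..<Suc l}"] B(2)]) (auto simp: sum_nonneg)
    finally show ?thesis using B by (simp add: real_sqrt_divide)
  qed
  then show ?thesis using B by blast
qed

lemma summable_diff: "summable (\<lambda>n. \<bar>diff n\<bar>)"
proof -
  obtain B where B: "B \<ge> 0" "\<And>k l. k > 0 \<Longrightarrow> (\<Sum>n\<in>{k<..l}. \<bar>diff n\<bar>) \<le> B / sqrt (real k)"
    using sum_abs_diff_bound by blast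
  show ?thesis
  proof (rule bounded_imp_summable[where B = "B + 2"])
    fix l
    have "(\<Sum>n\<le>l. \<bar>diff n\<bar>) \<le> (\<Sum>n\<in>{..1} \<union> {1<..l}. \<bar>diff n\<bar>)" by (intro sum_mono2) auto
    also have "\<dots> = (\<Sum>n\<le>1. \<bar>diff n\<bar>) + (\<Sum>n\<in>{1<..l}. \<bar>diff n\<bar>)" by (rule sum.union_disjoint) auto
    also have "\<dots> \<le> 2 + B / sqrt (real 1)"
      using abs_diff_le_1[of 0] abs_diff_le_1[of 1] by (intro add_mono B) auto
    finally show "(\<Sum>n\<le>l. \<bar>diff n\<bar>) \<le> B + 2" by simp
  qed simp
qed

text \<open>By the renewal equation the convolution of \<open>tail\<close> and \<open>dev\<close> is
  \<open>excess / mean\<close>; multiplying by \<open>diff\<close>, the inverse of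
  \<open>tail\<close>, solves for \<open>dev\<close>. Both factors are summable, hence so is
  \<open>dev\<close>.\<close>

lemma dev_convolution: "dev n = (\<Sum>i\<le>n. diff i * (excess (n - i) / mean))"
proof -
  have *: "Abs_fps tail * Abs_fps dev = Abs_fps (\<lambda>n. excess n / mean)"
  proof (rule fps_ext)
    fix n
    have "(\<Sum>i\<le>n. tail i * dev (n - i)) = 1 - (\<Sum>i\<le>n. tail i) / mean"
      by (simp add: dev_def right_diff_distrib sum_subtractf renewal_equation sum_divide_distrib)
    then show "fps_nth (Abs_fps tail * Abs_fps dev) n = fps_nth (Abs_fps (\<lambda>n. excess n / mean)) n"
      using mean_ge_1 by (simp add: fps_mult_nth atLeast0AtMost excess_def diff_divide_distrib)
  qed
  have "Abs_fps diff * (Abs_fps tail * Abs_fps dev) = Abs_fps tail * Abs_fps diff * Abs_fps dev"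
    by (simp only: mult_ac)
  then have "Abs_fps diff * Abs_fps (\<lambda>n. excess n / mean) = Abs_fps tail * Abs_fps diff * Abs_fps dev"
    by (simp only: *)
  then have "Abs_fps dev = Abs_fps diff * Abs_fps (\<lambda>n. excess n / mean)"
    by (simp add: tail_times_diff)
  then have "fps_nth (Abs_fps dev) n = fps_nth (Abs_fps diff * Abs_fps (\<lambda>n. excess n / mean)) n" by simp
  then show ?thesis by (simp add: fps_mult_nth atLeast0AtMost)
qed

lemma summable_dev: "summable (\<lambda>n. \<bar>dev n\<bar>)"
proof -
  have "summable (\<lambda>n. \<Sum>i\<le>n. \<bar>diff i\<bar> * (excess (n - i) / mean))"
  proof (rule summable_Cauchy_product[where a = "\<lambda>n. \<bar>diff n\<bar>" and b = "\<lambda>n. excess n / mean"])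
    show "summable (\<lambda>k. norm \<bar>diff k\<bar>)" using summable_diff by simp
    have "norm (excess k / mean) = excess k / mean" for k
      using mean_ge_1 excess_nonneg[of k] by simp
    then show "summable (\<lambda>k. norm (excess k / mean))"
      using summable_divide[OF summable_excess] by simp
  qed
  then show ?thesis
  proof (rule summable_comparison_test')
    fix n
    have "\<bar>dev n\<bar> \<le> (\<Sum>i\<le>n. \<bar>diff i * (excess (n - i) / mean)\<bar>)"
      unfolding dev_convolution by (rule sum_abs)
    also have "\<dots> = (\<Sum>i\<le>n. \<bar>diff i\<bar> * (excess (n - i) / mean))"
      using mean_ge_1 excess_nonneg by (intro sum.cong refl) (simp add: abs_mult abs_of_nonneg)
    finally show "norm \<bar>dev n\<bar> \<le> (\<Sum>i\<le>n. \<bar>diff i\<bar> * (excess (n - i) / mean))" by simp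
  qed
qed

text \<open>As \<open>dev\<close> tends to 0, \<open>dev k\<close> is minus the sum of all later
  differences, which is \<open>O(1 / sqrt k)\<close>. Summability of \<open>dev\<close> gives no
  such pointwise bound, and \<open>quadratic_coefficients\<close> requires it: there
  \<open>(dev y)^2\<close> occurs \<open>y - 1\<close> times.\<close>

lemma dev_decay: "\<exists>C. \<forall>n. real n * (dev n)\<^sup>2 \<le> C"
proof -
  obtain B where B: "B \<ge> 0" "\<And>k l. k > 0 \<Longrightarrow> (\<Sum>n\<in>{k<..l}. \<bar>diff n\<bar>) \<le> B / sqrt (real k)"
    using sum_abs_diff_bound by blast
  have "dev \<longlonglongrightarrow> 0"
    using summable_LIMSEQ_zero[OF summable_dev] by (simp add: tendsto_rabs_zero_iff)
  have abs_dev: "\<bar>dev k\<bar> \<le> B / sqrt (real k)" if k: "k > 0" for k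
  proof -
    have "\<bar>dev k - dev l\<bar> \<le> B / sqrt (real k)" if l: "l \<ge> k" for l
    proof -
      have "dev l - dev k = (\<Sum>n\<in>{k<..l}. diff n)" using l
      proof (induction l rule: dec_induct)
        case (step l)
        then have "{k<..Suc l} = insert (Suc l) {k<..l}" by auto
        then show ?case using step by (simp add: diff_def dev_def)
      qed simp
      then have "\<bar>dev k - dev l\<bar> \<le> (\<Sum>n\<in>{k<..l}. \<bar>diff n\<bar>)"
        using sum_abs[of diff "{k<..l}"] by (simp only: abs_minus_commute[of "dev k"])
      then show ?thesis using B(2)[OF k, of l] by simp
    qed
    moreover have "(\<lambda>l. \<bar>dev k - dev l\<bar>) \<longlonglongrightarrow> \<bar>dev k - 0\<bar>" by (intro tendsto_intros \<open>dev \<longlonglongrightarrow> 0\<close>)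
    ultimately show ?thesis
      by (intro tendsto_upperbound[where f = "\<lambda>l. \<bar>dev k - dev l\<bar>" and F = sequentially and x = "\<bar>dev k\<bar>"])
        (auto intro: eventually_sequentiallyI[of k])
  qed
  have "real k * (dev k)\<^sup>2 \<le> B\<^sup>2" for k
  proof (cases "k = 0")
    case False
    then have "\<bar>dev k\<bar>\<^sup>2 \<le> (B / sqrt (real k))\<^sup>2"
      by (intro power_mono abs_dev) auto
    then have "(dev k)\<^sup>2 \<le> B\<^sup>2 / real k" by (simp add: power_divide)
    then have "real k * (dev k)\<^sup>2 \<le> real k * (B\<^sup>2 / real k)" by (intro mult_left_mono) auto
    then show ?thesis using False by simp
  qed simp
  then show ?thesis by blast
qed

end

section \<open>Mean and variance of the remaining scenery\<close>

lemma exp_minus_bounds: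
  fixes x y :: real
  assumes "x \<ge> 0" "y \<ge> 0"
  shows "\<bar>exp (-x) - exp (-y)\<bar> \<le> \<bar>x - y\<bar>"
    and "\<bar>exp (-x) - exp (-y) - exp (-y) * (y - x)\<bar> \<le> (x - y)\<^sup>2 / 2"
proof -
  have "\<bar>exp (-x) - exp (-y)\<bar> \<le> \<bar>x - y\<bar> \<and>
        \<bar>exp (-x) - exp (-y) - exp (-y) * (y - x)\<bar> \<le> (x - y)\<^sup>2 / 2"
  proof (cases "x = y")
    case False
    define d where "d = (\<lambda>(m::nat) t::real. (-1) ^ m * exp (-t))"
    have der: "(d m has_real_derivative d (Suc m) t) (at t)" for m t
      unfolding d_def by (auto intro!: derivative_eq_intros)
    have T: "\<exists>t\<ge>0. exp (-x) = (\<Sum>m<n. (d m y / fact m) * (x - y)^m) + (d n t / fact n) * (x - y)^n"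
      if "n > 0" for n
    proof -
      have "\<exists>t. (if x < y then x < t \<and> t < y else y < t \<and> t < x) \<and>
        exp (-x) = (\<Sum>m<n. (d m y / fact m) * (x - y)^m) + (d n t / fact n) * (x - y)^n"
        \<comment> \<open>The interval from 0 to \<open>x + y\<close> contains both points, and the
          intermediate point is nonnegative, so that \<open>exp (- t) \<le> 1\<close> there.\<close>
        by (rule Taylor[where a = 0 and b = "x + y" and f = "\<lambda>x. exp (-x)"])
          (use that der False assms in \<open>auto simp: d_def\<close>)
      then obtain t where t: "if x < y then x < t \<and> t < y else y < t \<and> t < x"
        "exp (-x) = (\<Sum>m<n. (d m y / fact m) * (x - y)^m) + (d n t / fact n) * (x - y)^n" by blast
      have "t \<ge> 0" using t(1) assms by (auto split: if_splits)
      then show ?thesis using t(2) by blast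
    qed
    obtain t where t: "t \<ge> 0" "exp (-x) - exp (-y) = - exp (-t) * (x - y)"
      using T[of 1] by (auto simp: d_def)
    have "\<bar>exp (-x) - exp (-y)\<bar> \<le> 1 * \<bar>x - y\<bar>"
      unfolding t(2) abs_mult using t(1) by (intro mult_right_mono) auto
    moreover obtain t where t0: "t \<ge> 0" "exp (-x) = (\<Sum>m<2. (d m y / fact m) * (x - y)^m) + (d 2 t / fact 2) * (x - y)^2"
      using T[of 2] by auto
    then have t: "t \<ge> 0" "exp (-x) - exp (-y) - exp (-y) * (y - x) = exp (-t) * ((x - y)\<^sup>2 / 2)"
      unfolding t0(2) by (simp_all add: d_def lessThan_nat_numeral lessThan_Suc algebra_simps)
    have "\<bar>exp (-x) - exp (-y) - exp (-y) * (y - x)\<bar> \<le> 1 * ((x - y)\<^sup>2 / 2)"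
      unfolding t(2) abs_mult using t(1) by (intro mult_mono) auto
    ultimately show ?thesis by simp
  qed simp
  then show "\<bar>exp (-x) - exp (-y)\<bar> \<le> \<bar>x - y\<bar>"
    and "\<bar>exp (-x) - exp (-y) - exp (-y) * (y - x)\<bar> \<le> (x - y)\<^sup>2 / 2" by auto
qed

text \<open>Prepared for one step of the walk: \<open>d\<close> is the centred change of the
  conditional mean, \<open>v\<close> and \<open>w\<close> are the remaining variances before and
  after. \<open>t^2 (v - w)\<close> counts as second order like \<open>(t d)^2\<close>; the bracket
  contains everything up to order two.\<close>

lemma iexp_gauss_expansion:
  fixes t d v w :: real
  assumes "v \<ge> 0" "w \<ge> 0"
  shows "norm (iexp (t * d) * exp (- (t\<^sup>2 * w / 2)) - exp (- (t\<^sup>2 * v / 2))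
       - exp (- (t\<^sup>2 * v / 2)) * (\<i> * (t * d) - (t * d)\<^sup>2 / 2 + t\<^sup>2 * (v - w) / 2))
     \<le> \<bar>t\<bar> ^ 3 * \<bar>d\<bar> ^ 3 + t ^ 4 * (v - w)\<^sup>2 + \<bar>t\<bar> ^ 3 * (\<bar>d\<bar> * \<bar>v - w\<bar>)"
proof -
  define y where "y = t * d"
  define A where "A = iexp y"
  define B where "B = exp (- (t\<^sup>2 * w / 2))"
  define b where "b = exp (- (t\<^sup>2 * v / 2))"
  have b: "0 \<le> b" "b \<le> 1" using assms by (auto simp: b_def)
  have A1: "norm (A - 1) \<le> \<bar>y\<bar>" using iexp_approx1[of y 0] by (simp add: A_def)
  have A2: "norm (A - (1 + \<i> * y - y\<^sup>2 / 2)) \<le> \<bar>y\<bar> ^ 3"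
  proof -
    have "norm (A - (\<Sum>k\<le>2. (\<i> * y) ^ k / fact k)) \<le> \<bar>y\<bar> ^ 3 / fact 3"
      using iexp_approx1[of y 2] by (simp add: A_def numeral_3_eq_3)
    also have "\<dots> \<le> \<bar>y\<bar> ^ 3" by (simp add: fact_numeral)
    also have "(\<Sum>k\<le>2. (\<i> * y) ^ k / fact k) = 1 + \<i> * y - y\<^sup>2 / 2"
      by (simp add: numeral_2_eq_2 power_mult_distrib)
    finally show ?thesis .
  qed
  have eq: "t\<^sup>2 * w / 2 - t\<^sup>2 * v / 2 = - (t\<^sup>2 * (v - w) / 2)" by (simp add: field_simps)
  have B1: "\<bar>B - b\<bar> \<le> t\<^sup>2 * \<bar>v - w\<bar> / 2"
    using exp_minus_bounds(1)[of "t\<^sup>2 * w / 2" "t\<^sup>2 * v / 2"] assms unfolding eq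
    by (simp add: B_def b_def abs_mult)
  have B2: "\<bar>B - b - b * (t\<^sup>2 * (v - w) / 2)\<bar> \<le> t ^ 4 * (v - w)\<^sup>2"
  proof -
    have "\<bar>B - b - b * (t\<^sup>2 * v / 2 - t\<^sup>2 * w / 2)\<bar> \<le> (t\<^sup>2 * w / 2 - t\<^sup>2 * v / 2)\<^sup>2 / 2"
      using exp_minus_bounds(2)[of "t\<^sup>2 * w / 2" "t\<^sup>2 * v / 2"] assms by (simp add: B_def b_def)
    also have "(t\<^sup>2 * w / 2 - t\<^sup>2 * v / 2)\<^sup>2 / 2 = t ^ 4 * (v - w)\<^sup>2 / 8"
      unfolding eq by (simp add: power_divide power_mult_distrib)
    also have "\<dots> \<le> t ^ 4 * (v - w)\<^sup>2" by simp
    finally show ?thesis by (simp add: right_diff_distrib diff_divide_distrib)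
  qed
  \<comment> \<open>Exact algebra: the remainder of the product is the sum of the remainders of the
    factors and the product of their first-order differences.\<close>
  have "A * B - b - b * (\<i> * y - y\<^sup>2 / 2 + t\<^sup>2 * (v - w) / 2)
      = b * (A - (1 + \<i> * y - y\<^sup>2 / 2)) + of_real (B - b - b * (t\<^sup>2 * (v - w) / 2)) + (A - 1) * of_real (B - b)"
  proof -
    have "a * b1 - b2 - b2 * (m + t) = b2 * (a - (1 + m)) + (b1 - b2 - b2 * t) + (a - 1) * (b1 - b2)"
      for a b1 b2 m t :: complex by (simp add: algebra_simps)
    from this[of A B b "\<i> * y - y\<^sup>2 / 2" "t\<^sup>2 * (v - w) / 2"] show ?thesis
      by (simp only: of_real_diff of_real_mult of_real_divide of_real_power of_real_numeral add_diff_eq)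
  qed
  also have "norm \<dots> \<le> norm (b * (A - (1 + \<i> * y - y\<^sup>2 / 2)))
      + norm (complex_of_real (B - b - b * (t\<^sup>2 * (v - w) / 2))) + norm ((A - 1) * of_real (B - b))"
    by (rule order_trans[OF norm_triangle_ineq add_right_mono[OF norm_triangle_ineq]])
  also have "\<dots> \<le> 1 * \<bar>y\<bar> ^ 3 + t ^ 4 * (v - w)\<^sup>2 + \<bar>y\<bar> * (t\<^sup>2 * \<bar>v - w\<bar> / 2)"
  proof (intro add_mono)
    show "norm (b * (A - (1 + \<i> * y - y\<^sup>2 / 2))) \<le> 1 * \<bar>y\<bar> ^ 3"
      unfolding norm_mult norm_of_real by (rule mult_mono) (use b A2 in auto)
    show "norm (complex_of_real (B - b - b * (t\<^sup>2 * (v - w) / 2))) \<le> t ^ 4 * (v - w)\<^sup>2"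
      unfolding norm_of_real by (rule B2)
    show "norm ((A - 1) * of_real (B - b)) \<le> \<bar>y\<bar> * (t\<^sup>2 * \<bar>v - w\<bar> / 2)"
      unfolding norm_mult norm_of_real by (rule mult_mono[OF A1 B1]) auto
  qed
  also have "\<dots> \<le> \<bar>t\<bar> ^ 3 * \<bar>d\<bar> ^ 3 + t ^ 4 * (v - w)\<^sup>2 + \<bar>t\<bar> ^ 3 * (\<bar>d\<bar> * \<bar>v - w\<bar>)"
  proof -
    have "\<bar>y\<bar> * (t\<^sup>2 * \<bar>v - w\<bar> / 2) = \<bar>t\<bar> ^ 3 * (\<bar>d\<bar> * \<bar>v - w\<bar>) / 2"
    proof -
      have "a * e * (a\<^sup>2 * z / 2) = a ^ 3 * (e * z) / 2" for a e z :: real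
        by (simp add: power2_eq_square power3_eq_cube)
      from this[of "\<bar>t\<bar>" "\<bar>d\<bar>" "\<bar>v - w\<bar>"] show ?thesis
        by (simp only: y_def abs_mult power2_abs)
    qed
    then have "\<bar>y\<bar> * (t\<^sup>2 * \<bar>v - w\<bar> / 2) \<le> \<bar>t\<bar> ^ 3 * (\<bar>d\<bar> * \<bar>v - w\<bar>)"
      by (simp only:) simp
    moreover have "\<bar>y\<bar> ^ 3 = \<bar>t\<bar> ^ 3 * \<bar>d\<bar> ^ 3" by (simp only: y_def abs_mult power_mult_distrib)
    ultimately show ?thesis by linarith
  qed
  finally show ?thesis by (simp add: A_def B_def b_def y_def)
qed

section \<open>The walk as a list of steps, and conditioning on the first step\<close>

primrec scenery_sum :: "(nat \<Rightarrow> real) \<Rightarrow> nat \<Rightarrow> nat list \<Rightarrow> real" where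
  "scenery_sum w s [] = 0"
| "scenery_sum w s (x # xs) = w (s + x) + scenery_sum w (s + x) xs"

lemma expectation_replicate_pmf_Suc:
  fixes f :: "nat list \<Rightarrow> real"
  assumes "\<And>xs. \<bar>f xs\<bar> \<le> B"
  shows "expect (replicate_pmf (Suc n) p) f
    = expect p (\<lambda>x. expect (replicate_pmf n p) (\<lambda>xs. f (x # xs)))"
proof -
  have "replicate_pmf (Suc n) p = bind_pmf p (\<lambda>x. map_pmf ((#) x) (replicate_pmf n p))"
    by (simp add: map_pmf_def)
  also have "expect \<dots> f
      = expect p (\<lambda>x. expect (map_pmf ((#) x) (replicate_pmf n p)) f)"
    unfolding measure_pmf_bind
    by (rule integral_bind[where K = "count_space UNIV" and B = B and B' = 1])
      (auto simp: assms measure_pmf.emeasure_space_1 measure_pmf.finite_measure_axioms measure_pmf_in_subprob_algebra)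
  finally show ?thesis by simp
qed

lemma complex_expectation_replicate_pmf_Suc:
  fixes f :: "nat list \<Rightarrow> complex"
  assumes B: "\<And>xs. norm (f xs) \<le> B"
  shows "expect (replicate_pmf (Suc n) p) f
    = expect p (\<lambda>x. expect (replicate_pmf n p) (\<lambda>xs. f (x # xs)))"
proof -
  have int: "integrable (measure_pmf q) (\<lambda>x. f (g x))" for q :: "'z pmf" and g
    by (rule measure_pmf.integrable_const_bound[where B = B]) (auto simp: B)
  have le: "norm (expect q (\<lambda>xs. f (g xs))) \<le> B" for q :: "'z pmf" and g
  proof -
    have "norm (expect q (\<lambda>xs. f (g xs))) \<le> expect q (\<lambda>xs. norm (f (g xs)))"
      by (rule integral_norm_bound)
    also have "\<dots> \<le> expect q (\<lambda>_. B)"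
      by (intro integral_mono integrable_norm int) (auto simp: B)
    finally show ?thesis by simp
  qed
  have int': "integrable p (\<lambda>x. expect (replicate_pmf n p) (\<lambda>xs. f (x # xs)))"
    by (rule measure_pmf.integrable_const_bound[where B = B])
      (auto simp: le)
  show ?thesis
  proof (rule complex_eqI)
    have "\<bar>Re (f xs)\<bar> \<le> B" for xs using B order_trans abs_Re_le_cmod by blast
    then show "Re (expect (replicate_pmf (Suc n) p) f) = 
      Re (expect p (\<lambda>x. expect (replicate_pmf n p) (\<lambda>xs. f (x # xs))))"
      using expectation_replicate_pmf_Suc[of "\<lambda>xs. Re (f xs)" B n p]
      by (subst integral_Re[OF int', symmetric], subst integral_Re[OF int[of _ "\<lambda>x. x"], symmetric], subst integral_Re[OF int, symmetric])
        simp
    have "\<bar>Im (f xs)\<bar> \<le> B" for xs using B order_trans abs_Im_le_cmod by blast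
    then show "Im (expect (replicate_pmf (Suc n) p) f) = 
      Im (expect p (\<lambda>x. expect (replicate_pmf n p) (\<lambda>xs. f (x # xs))))"
      using expectation_replicate_pmf_Suc[of "\<lambda>xs. Im (f xs)" B n p]
      by (subst integral_Im[OF int', symmetric], subst integral_Im[OF int[of _ "\<lambda>x. x"], symmetric], subst integral_Im[OF int, symmetric])
        simp
  qed
qed

section \<open>Potentials of the renewal chain\<close>

context renewal_law
begin

text \<open>The expected sum of \<open>f\<close> over the renewals in \<open>{s..N}\<close> for a
  chain started at \<open>s\<close>, with \<open>s\<close> included: the Green operator of the chain
  killed beyond \<open>N\<close>.\<close>

definition potential :: "nat \<Rightarrow> (nat \<Rightarrow> real) \<Rightarrow> nat \<Rightarrow> real" where
  "potential N f s = (\<Sum>x\<in>{s..N}. renewal p (x - s) * f x)"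

lemma potential_beyond [simp]: "N < s \<Longrightarrow> potential N f s = 0"
  by (simp add: potential_def)

lemma integrable_cutoff:
  fixes h :: "nat \<Rightarrow> real"
  assumes "\<And>t. t > N \<Longrightarrow> h t = 0"
  shows "integrable p (\<lambda>k. h (s + k))"
proof (rule measure_pmf.integrable_const_bound[where B = "\<Sum>t\<le>N. \<bar>h t\<bar>"])
  have "\<bar>h t\<bar> \<le> (\<Sum>t\<le>N. \<bar>h t\<bar>)" for t
    using assms[of t] by (cases "t \<le> N") (auto intro: member_le_sum simp: sum_nonneg)
  then show "AE k in p. norm (h (s + k)) \<le> (\<Sum>t\<le>N. \<bar>h t\<bar>)" by simp
qed simp

text \<open>Rewritten over the target site \<open>t = s + k\<close>. The strict lower end expresses
  that steps are positive; it makes all recursions triangular.\<close>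

lemma expectation_cutoff:
  fixes h :: "nat \<Rightarrow> real"
  assumes "\<And>t. t > N \<Longrightarrow> h t = 0"
  shows "expect p (\<lambda>k. h (s + k)) = (\<Sum>t\<in>{s<..N}. pmf p (t - s) * h t)"
proof -
  have "expect p (\<lambda>k. h (s + k)) = (\<Sum>k\<in>{0<..N - s}. h (s + k) * pmf p k)"
  proof (rule integral_measure_pmf_real)
    fix k assume k: "k \<in> set_pmf p" "h (s + k) \<noteq> 0"
    then have "k > 0" using step_pos by (metis gr0I)
    moreover have "s + k \<le> N" using k assms[of "s + k"] by (meson not_le)
    ultimately show "k \<in> {0<..N - s}" by auto
  qed simp
  also have "\<dots> = (\<Sum>t\<in>{s<..N}. pmf p (t - s) * h t)"
    by (rule sum.reindex_bij_witness[where i = "\<lambda>t. t - s" and j = "\<lambda>k. s + k"]) auto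
  finally show ?thesis .
qed

lemma renewal_rec_shifted:
  assumes "s < x"
  shows "renewal p (x - s) = (\<Sum>t\<in>{s<..x}. pmf p (t - s) * renewal p (x - t))"
proof -
  have "renewal p (x - s) = (\<Sum>k\<in>{1..x - s}. pmf p k * renewal p (x - s - k))"
    using assms by (intro renewal_rec) simp
  also have "\<dots> = (\<Sum>t\<in>{s<..x}. pmf p (t - s) * renewal p (x - t))"
    using assms by (intro sum.reindex_bij_witness[where i = "\<lambda>t. t - s" and j = "\<lambda>k. s + k"]) auto
  finally show ?thesis .
qed

text \<open>Once the sums over the first site \<open>t\<close> and the later site \<open>x\<close>
  are exchanged, the inner sum is the renewal recursion for \<open>x - s\<close>. Compared with the
  potential, only the term \<open>x = s\<close> is lost.\<close>

lemma expectation_potential: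
  "expect p (\<lambda>k. potential N f (s + k)) = (\<Sum>x\<in>{s<..N}. renewal p (x - s) * f x)"
proof -
  have "expect p (\<lambda>k. potential N f (s + k))
      = (\<Sum>t\<in>{s<..N}. pmf p (t - s) * potential N f t)"
    by (rule expectation_cutoff) simp
  also have "\<dots> = (\<Sum>t\<in>{s<..N}. \<Sum>x | x \<in> {s<..N} \<and> t \<le> x. pmf p (t - s) * renewal p (x - t) * f x)"
    unfolding potential_def sum_distrib_left by (intro sum.cong) (auto simp: mult_ac)
  also have "\<dots> = (\<Sum>x\<in>{s<..N}. \<Sum>t | t \<in> {s<..N} \<and> t \<le> x. pmf p (t - s) * renewal p (x - t) * f x)"
    by (rule sum.swap_restrict) auto
  also have "\<dots> = (\<Sum>x\<in>{s<..N}. renewal p (x - s) * f x)"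
  proof (intro sum.cong refl)
    fix x assume x: "x \<in> {s<..N}"
    then have set: "{t. t \<in> {s<..N} \<and> t \<le> x} = {s<..x}" by auto
    have "renewal p (x - s) * f x = (\<Sum>t\<in>{s<..x}. pmf p (t - s) * renewal p (x - t) * f x)"
      using x by (simp only: renewal_rec_shifted[of s x] sum_distrib_right greaterThanAtMost_iff)
    then show "(\<Sum>t | t \<in> {s<..N} \<and> t \<le> x. pmf p (t - s) * renewal p (x - t) * f x) = renewal p (x - s) * f x"
      unfolding set by (rule sym)
  qed
  finally show ?thesis .
qed

lemma potential_rec:
  assumes "s \<le> N"
  shows "potential N f s = f s + expect p (\<lambda>k. potential N f (s + k))"
proof -
  have "{s..N} = insert s {s<..N}" using assms by auto
  then show ?thesis unfolding expectation_potential by (simp add: potential_def)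
qed

text \<open>The expectation sees only sites after \<open>s\<close>, so the recursion determines
  \<open>h\<close> downwards from \<open>N\<close>. It serves to recognise a closed formula for the
  remaining variance.\<close>

lemma potential_unique:
  assumes "\<And>s. s \<le> N \<Longrightarrow> h s = f s + expect p (\<lambda>k. h (s + k))"
    and "\<And>s. s > N \<Longrightarrow> h s = 0"
  shows "h s = potential N f s"
proof (induction "Suc N - s" arbitrary: s rule: less_induct)
  case less
  show ?case
  proof (cases "s \<le> N")
    case True
    have "h t = potential N f t" if "t \<in> {s<..N}" for t
      using that by (intro less) auto
    then have "expect p (\<lambda>k. h (s + k)) = expect p (\<lambda>k. potential N f (s + k))"
      using assms by (subst (1 2) expectation_cutoff[where N = N]) auto
    then show ?thesis using assms True by (simp add: potential_rec)
  qed (use assms in auto)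
qed

definition dev_sum :: real where "dev_sum = (\<Sum>n. \<bar>dev n\<bar>)"

lemma dev_sum_nonneg: "dev_sum \<ge> 0"
  unfolding dev_sum_def by (rule suminf_nonneg[OF summable_dev]) simp

lemma sum_dev_le: "s \<le> t \<Longrightarrow> (\<Sum>x\<in>{t..N}. \<bar>dev (x - s)\<bar>) \<le> dev_sum"
proof -
  assume st: "s \<le> t"
  have "(\<Sum>x\<in>{t..N}. \<bar>dev (x - s)\<bar>) = (\<Sum>i\<in>(\<lambda>x. x - s) ` {t..N}. \<bar>dev i\<bar>)"
    using st by (subst sum.reindex) (auto simp: inj_on_def)
  also have "\<dots> \<le> dev_sum"
    unfolding dev_sum_def by (rule sum_le_suminf[OF summable_dev]) auto
  finally show ?thesis .
qed

lemma renewal_dev: "renewal p n = 1 / mean + dev n"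
  by (simp add: dev_def)

end

text \<open>\<open>w\<close> is a fixed scenery. Up to the cutoff \<open>N\<close>, \<open>site + future\<close> is the conditional expectation,
  given that \<open>s\<close> is a renewal, of the scenery collected from \<open>s\<close> on, and \<open>variance_left\<close> is its conditional variance.\<close>

locale renewal_scenery = renewal_law +
  fixes w :: "nat \<Rightarrow> real" and N :: nat and K :: real
  assumes partial_sums: "\<And>s t. s < t \<Longrightarrow> t \<le> N \<Longrightarrow> \<bar>\<Sum>x\<in>{s<..t}. w x\<bar> \<le> K * sqrt (real (t - s))"
    and K_nonneg: "K \<ge> 0"
begin

definition site :: "nat \<Rightarrow> real" where "site x = (if x \<le> N then w x else 0)"
definition future :: "nat \<Rightarrow> real" where "future s = (\<Sum>x\<in>{s<..N}. renewal p (x - s) * w x)"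
text \<open>The variance, over the next step from \<open>s\<close>, of the conditional mean of what
  is then still to be collected; its sum along the renewals is the whole remaining variance.\<close>

definition step_var :: "nat \<Rightarrow> real" where
  "step_var s = expect p (\<lambda>k. (potential N w (s + k))\<^sup>2) - (future s)\<^sup>2"
definition variance_left :: "nat \<Rightarrow> real" where "variance_left = potential N step_var"
text \<open>The 1 stands for the sites jumped over by a step, each \<open>dev_sum\<close> for one of
  the two convolutions with \<open>dev\<close> in a difference of potentials.\<close>

definition C0 :: real where "C0 = 1 + 2 * dev_sum"

lemma potential_eq_site_future: "potential N w s = site s + future s"
proof (cases "s \<le> N")
  case True
  then have "{s..N} = insert s {s<..N}" by auto
  then show ?thesis using True by (simp add: potential_def site_def future_def)
qed (simp add: potential_def site_def future_def)

lemma expectation_step: "expect p (\<lambda>k. potential N w (s + k)) = future s"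
  by (simp add: expectation_potential future_def)

lemma C0_ge_1: "C0 \<ge> 1"
  using dev_sum_nonneg by (simp add: C0_def)

lemma abs_site_le: "x \<ge> 1 \<Longrightarrow> \<bar>site x\<bar> \<le> K"
proof (cases "x \<le> N")
  assume "x \<ge> 1" "x \<le> N"
  then have "{x - 1<..x} = {x}" by auto
  then show ?thesis using partial_sums[of "x - 1" x] \<open>x \<ge> 1\<close> \<open>x \<le> N\<close> by (simp add: site_def)
qed (use K_nonneg in \<open>simp add: site_def\<close>)

text \<open>The weights are absolutely summable, so a bound on single scenery values is enough here;
  cancellation in the scenery is needed only for the part with constant weight
  \<open>1 / mean\<close>.\<close>

lemma dev_scenery_le:
  assumes "s \<le> t" "1 \<le> t"
  shows "\<bar>\<Sum>x\<in>{t..N}. dev (x - s) * w x\<bar> \<le> K * dev_sum"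
proof -
  have "\<bar>\<Sum>x\<in>{t..N}. dev (x - s) * w x\<bar> \<le> (\<Sum>x\<in>{t..N}. \<bar>dev (x - s) * w x\<bar>)" by (rule sum_abs)
  also have "\<dots> \<le> (\<Sum>x\<in>{t..N}. \<bar>dev (x - s)\<bar> * K)"
  proof (intro sum_mono)
    fix x assume "x \<in> {t..N}"
    then have "\<bar>w x\<bar> \<le> K" using abs_site_le[of x] assms by (simp add: site_def)
    then show "\<bar>dev (x - s) * w x\<bar> \<le> \<bar>dev (x - s)\<bar> * K" unfolding abs_mult by (intro mult_left_mono) auto
  qed
  also have "\<dots> \<le> dev_sum * K"
    unfolding sum_distrib_right[symmetric] using assms by (intro mult_right_mono sum_dev_le K_nonneg)
  finally show ?thesis by (simp add: mult.commute)
qed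

lemma atLeastSucAtMost: "{s<..t} = {Suc s..t}"
  by auto

lemma future_eq: "future s = (\<Sum>x\<in>{s<..N}. w x) / mean + (\<Sum>x\<in>{Suc s..N}. dev (x - s) * w x)"
  by (simp add: future_def renewal_dev distrib_right sum.distrib sum_divide_distrib atLeastSucAtMost)

lemma mean_partial_sums:
  assumes "s \<le> t" "t \<le> N"
  shows "\<bar>(\<Sum>x\<in>{s<..t}. w x) / mean\<bar> \<le> K * sqrt (real (t - s))"
proof (cases "s = t")
  case False
  have "\<bar>(\<Sum>x\<in>{s<..t}. w x) / mean\<bar> \<le> \<bar>\<Sum>x\<in>{s<..t}. w x\<bar>"
    using mean_ge_1 by (simp add: divide_le_eq mult_le_cancel_left1)
  then show ?thesis using partial_sums[of s t] assms False by simp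
qed simp

lemma sqrt_ge_1: "k \<ge> 1 \<Longrightarrow> sqrt (real k) \<ge> 1"
  by simp

lemma abs_future_le: "\<bar>future s\<bar> \<le> C0 * K * sqrt (real (N - s))"
proof (cases "s < N")
  case True
  have "\<bar>future s\<bar> \<le> K * sqrt (real (N - s)) + K * dev_sum"
    unfolding future_eq using mean_partial_sums[of s N] dev_scenery_le[of s "Suc s"] True by linarith
  also have "\<dots> \<le> K * sqrt (real (N - s)) + K * dev_sum * sqrt (real (N - s))"
    using True K_nonneg dev_sum_nonneg mult_left_mono[OF sqrt_ge_1[of "N - s"], of "K * dev_sum"] by simp
  also have "\<dots> \<le> C0 * K * sqrt (real (N - s))"
    using K_nonneg dev_sum_nonneg by (simp add: C0_def algebra_simps)
  finally show ?thesis .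
qed (simp add: future_def)

text \<open>The parts with weight \<open>1 / mean\<close> agree from \<open>s + k\<close> on, so
  their difference is a partial sum over the \<open>k - 1\<close> sites jumped over, of order
  \<open>sqrt k\<close>; the two \<open>dev\<close> parts are bounded.\<close>

lemma increment_le:
  assumes k: "k \<ge> 1"
  shows "\<bar>potential N w (s + k) - future s\<bar> \<le> C0 * K * sqrt (real k)"
proof (cases "s + k \<le> N")
  case True
  have "{s<..N} = {s<..s + k - 1} \<union> {s + k..N}" using True k by auto
  then have split: "(\<Sum>x\<in>{s<..N}. w x) = (\<Sum>x\<in>{s<..s + k - 1}. w x) + (\<Sum>x\<in>{s + k..N}. w x)"
    using k by (simp only:) (rule sum.union_disjoint, auto)
  have "potential N w (s + k) = (\<Sum>x\<in>{s + k..N}. w x) / mean + (\<Sum>x\<in>{s + k..N}. dev (x - (s + k)) * w x)"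
    by (simp add: potential_def renewal_dev distrib_right sum.distrib sum_divide_distrib)
  then have "potential N w (s + k) - future s = (\<Sum>x\<in>{s + k..N}. dev (x - (s + k)) * w x)
     - (\<Sum>x\<in>{Suc s..N}. dev (x - s) * w x) - (\<Sum>x\<in>{s<..s + k - 1}. w x) / mean"
    unfolding future_eq split by (simp only: add_divide_distrib)
  then have "\<bar>potential N w (s + k) - future s\<bar> \<le> K * dev_sum + K * dev_sum + K * sqrt (real (s + k - 1 - s))"
    using dev_scenery_le[of "s + k" "s + k"] dev_scenery_le[of s "Suc s"]
      mean_partial_sums[of s "s + k - 1"] True k by linarith
  also have "\<dots> \<le> K * dev_sum * sqrt (real k) + K * dev_sum * sqrt (real k) + K * sqrt (real k)"
    using K_nonneg dev_sum_nonneg mult_left_mono[OF sqrt_ge_1[OF k], of "K * dev_sum"]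
    by (intro add_mono mult_left_mono) auto
  also have "\<dots> = C0 * K * sqrt (real k)" by (simp add: C0_def algebra_simps)
  finally show ?thesis .
next
  \<comment> \<open>The step leaves the window: the potential vanishes, and \<open>future s\<close>
    is small because \<open>N - s < k\<close>.\<close>
  case False
  have "\<bar>future s\<bar> \<le> C0 * K * sqrt (real (N - s))" by (rule abs_future_le)
  also have "\<dots> \<le> C0 * K * sqrt (real k)"
    using False K_nonneg C0_ge_1 by (intro mult_left_mono) auto
  finally show ?thesis using False by simp
qed

lemma integrable_potential_pow [simp]: "integrable p (\<lambda>k. (potential N f (s + k)) ^ Suc j)"
  by (rule integrable_cutoff[where h = "\<lambda>t. potential N f t ^ Suc j" and N = N]) simp

lemma integrable_potential [simp]: "integrable p (\<lambda>k. potential N f (s + k))"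
  using integrable_potential_pow[of f s 0] by simp

lemma integrable_potential_sq [simp]: "integrable p (\<lambda>k. (potential N f (s + k))\<^sup>2)"
  using integrable_potential_pow[of f s 1] by (simp add: numeral_2_eq_2)

lemma step_var_eq: "step_var s = expect p (\<lambda>k. (potential N w (s + k) - future s)\<^sup>2)"
proof -
  have "expect p (\<lambda>k. (potential N w (s + k) - future s)\<^sup>2)
     = expect p (\<lambda>k. (potential N w (s + k))\<^sup>2 + (future s)\<^sup>2 - 2 * future s * potential N w (s + k))"
    by (simp add: power2_diff mult_ac)
  also have "\<dots> = expect p (\<lambda>k. (potential N w (s + k))\<^sup>2) + (future s)\<^sup>2 - 2 * future s * future s"
    by (subst Bochner_Integration.integral_diff) (auto simp: expectation_step)
  finally show ?thesis by (simp add: step_var_def power2_eq_square)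
qed

lemma step_var_nonneg: "step_var s \<ge> 0"
  unfolding step_var_eq by simp

definition var_bound :: real where "var_bound = (C0 * K)\<^sup>2 * mean"

lemma step_var_le: "step_var s \<le> var_bound"
proof -
  have "step_var s \<le> expect p (\<lambda>k. (C0 * K)\<^sup>2 * real k)"
    unfolding step_var_eq
  proof (rule integral_mono_AE)
    show "AE k in p. (potential N w (s + k) - future s)\<^sup>2 \<le> (C0 * K)\<^sup>2 * real k"
      using AE_step
    proof eventually_elim
      case (elim k)
      have "\<bar>potential N w (s + k) - future s\<bar>\<^sup>2 \<le> (C0 * K * sqrt (real k))\<^sup>2"
        using increment_le[OF elim] by (intro power_mono) auto
      then show ?case by (simp add: power_mult_distrib)
    qed
    show "integrable p (\<lambda>k. (potential N w (s + k) - future s)\<^sup>2)"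
      by (simp add: power2_diff)
  qed simp
  then show ?thesis by (simp add: var_bound_def mean_def)
qed

lemma var_bound_nonneg: "var_bound \<ge> 0"
  using step_var_le[of 0] step_var_nonneg[of 0] by simp

lemma step_var_beyond: "s \<ge> N \<Longrightarrow> step_var s = 0"
  unfolding step_var_def
  by (subst expectation_cutoff[where h = "\<lambda>t. (potential N w t)\<^sup>2" and N = N]) (auto simp: future_def)

lemma variance_left_nonneg: "variance_left s \<ge> 0"
  unfolding variance_left_def potential_def by (intro sum_nonneg mult_nonneg_nonneg renewal_bounds step_var_nonneg)

lemma sum_step_var_le:
  "(\<Sum>x\<in>{s..<t}. renewal p (x - s) * step_var x) \<le> var_bound * real (t - s)"
proof -
  have "(\<Sum>x\<in>{s..<t}. renewal p (x - s) * step_var x) \<le> (\<Sum>x\<in>{s..<t}. 1 * var_bound)"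
    by (intro sum_mono mult_mono renewal_bounds step_var_le step_var_nonneg) auto
  then show ?thesis by (simp add: mult.commute)
qed

lemma variance_left_le: "variance_left s \<le> var_bound * real (N - s)"
proof (cases "s \<le> N")
  case True
  then have "{s..N} = insert N {s..<N}" by auto
  then have "variance_left s = (\<Sum>x\<in>{s..<N}. renewal p (x - s) * step_var x)"
    by (simp add: variance_left_def potential_def step_var_beyond)
  then show ?thesis using sum_step_var_le[of s N] by simp
qed (simp add: variance_left_def)

text \<open>Each of the two variances can be of order \<open>N\<close>, so the difference is
  estimated through the kernel: from \<open>s + k\<close> on the \<open>1 / mean\<close> parts
  cancel and the \<open>dev\<close> parts are summable, while each of the first \<open>k\<close>
  sites contributes at most \<open>var_bound\<close>.\<close>

lemma variance_left_diff:
  assumes k: "k \<ge> 1"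
  shows "\<bar>variance_left s - variance_left (s + k)\<bar> \<le> var_bound * C0 * real k"
proof (cases "s + k \<le> N")
  case True
  have "{s..N} = {s..<s + k} \<union> {s + k..N}" using True by auto
  then have "variance_left s = (\<Sum>x\<in>{s..<s + k}. renewal p (x - s) * step_var x)
      + (\<Sum>x\<in>{s + k..N}. renewal p (x - s) * step_var x)"
    unfolding variance_left_def potential_def by (simp only:) (rule sum.union_disjoint, auto)
  then have eq: "variance_left s - variance_left (s + k) = (\<Sum>x\<in>{s..<s + k}. renewal p (x - s) * step_var x)
     + (\<Sum>x\<in>{s + k..N}. (dev (x - s) - dev (x - (s + k))) * step_var x)"
    by (simp add: variance_left_def potential_def renewal_dev left_diff_distrib sum_subtractf distrib_right sum.distrib)
  have "\<bar>\<Sum>x\<in>{s + k..N}. (dev (x - s) - dev (x - (s + k))) * step_var x\<bar>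
     \<le> (\<Sum>x\<in>{s + k..N}. \<bar>(dev (x - s) - dev (x - (s + k))) * step_var x\<bar>)" by (rule sum_abs)
  also have "\<dots> \<le> (\<Sum>x\<in>{s + k..N}. (\<bar>dev (x - s)\<bar> + \<bar>dev (x - (s + k))\<bar>) * var_bound)"
    unfolding abs_mult using step_var_nonneg step_var_le by (intro sum_mono mult_mono) auto
  also have "\<dots> \<le> (dev_sum + dev_sum) * var_bound"
    unfolding sum_distrib_right[symmetric] sum.distrib
    by (intro mult_right_mono add_mono sum_dev_le var_bound_nonneg) auto
  finally have "\<bar>variance_left s - variance_left (s + k)\<bar> \<le> var_bound * real k + (dev_sum + dev_sum) * var_bound"
    using sum_step_var_le[of s "s + k"] renewal_bounds step_var_nonneg unfolding eq
    by (smt (verit, best) add_diff_cancel_left' mult_nonneg_nonneg sum_nonneg)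
  also have "\<dots> \<le> var_bound * real k + (dev_sum + dev_sum) * var_bound * real k"
    using var_bound_nonneg dev_sum_nonneg k mult_left_mono[of 1 "real k" "(dev_sum + dev_sum) * var_bound"] by simp
  also have "\<dots> = var_bound * C0 * real k" by (simp add: C0_def algebra_simps)
  finally show ?thesis .
next
  case False
  have "variance_left s \<le> var_bound * real (N - s)" by (rule variance_left_le)
  also have "\<dots> \<le> var_bound * real k" using False var_bound_nonneg by (intro mult_left_mono) auto
  also have "\<dots> \<le> var_bound * C0 * real k"
    using var_bound_nonneg C0_ge_1 mult_right_mono[of 1 C0 "var_bound * real k"] by (simp add: mult_ac)
  finally show ?thesis using False variance_left_nonneg[of s] by (simp add: variance_left_def)
qed

lemma variance_left_rec:
  "variance_left s = step_var s + expect p (\<lambda>k. variance_left (s + k))"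
proof (cases "s \<le> N")
  case True
  then show ?thesis unfolding variance_left_def by (rule potential_rec)
next
  case False
  then show ?thesis by (simp add: variance_left_def step_var_beyond)
qed

text \<open>The coefficients are the covariances of the visit indicators:
  \<open>u_x (1 - u_x)\<close> on the diagonal and \<open>u_x (u_(y-x) - u_y)\<close> for
  \<open>x < y\<close>. The second moment minus the squared mean satisfies the recursion of
  \<open>variance_left\<close>, and \<open>potential_unique\<close> identifies the two.\<close>

lemma variance_left_quadratic:
  "variance_left 0 = (\<Sum>x\<in>{1..N}. (w x)\<^sup>2 * (renewal p x * (1 - renewal p x)))
     + 2 * (\<Sum>y\<in>{1..N}. w y * (\<Sum>x\<in>{1..<y}. w x * (renewal p x * (renewal p (y - x) - renewal p y))))"
proof -
  \<comment> \<open>Expansion of the squared sum along the walk: a visited site contributes its own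
    square and twice its product with the scenery collected afterwards.\<close>
  define f where "f x = w x * (w x + 2 * future x)" for x
  define h where "h s = (\<Sum>x\<in>{s<..N}. renewal p (x - s) * f x) - (future s)\<^sup>2" for s
  have "h s = potential N step_var s" for s
  proof (rule potential_unique)
    fix s assume s: "s \<le> N"
    \<comment> \<open>Splitting off the term of \<open>t\<close> completes a square:
      \<open>site^2 + 2 site future + future^2\<close> is the squared potential, so
      \<open>h t\<close> is also second moment minus squared mean with the site \<open>t\<close>
      included.\<close>
    define b where "b t = potential N f t - (site t * (site t + 2 * future t))" for t
    have hb: "h t = b t - (future t)\<^sup>2" for t
    proof (cases "t \<le> N")
      case True
      then have "{t..N} = insert t {t<..N}" by auto
      then show ?thesis using True by (simp add: h_def b_def potential_def site_def f_def)
    next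
      case False
      then show ?thesis by (simp add: h_def b_def site_def)
    qed
    have "h t = potential N f t - (potential N w t)\<^sup>2" for t
      unfolding hb b_def potential_eq_site_future by (simp add: power2_eq_square algebra_simps)
    then have "expect p (\<lambda>k. h (s + k))
      = (\<Sum>x\<in>{s<..N}. renewal p (x - s) * f x) - expect p (\<lambda>k. (potential N w (s + k))\<^sup>2)"
      by (simp add: expectation_potential)
    then show "h s = step_var s + expect p (\<lambda>k. h (s + k))"
      by (simp add: h_def step_var_def)
  qed (simp add: h_def future_def)
  then have "variance_left 0 = h 0" by (simp add: variance_left_def)
  also have "h 0 = (\<Sum>x\<in>{1..N}. renewal p x * f x) - (\<Sum>x\<in>{1..N}. renewal p x * w x)\<^sup>2"
    by (simp add: h_def future_def atLeastSucAtMost)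
  also have "(\<Sum>x\<in>{1..N}. renewal p x * f x) = (\<Sum>x\<in>{1..N}. renewal p x * (w x)\<^sup>2)
      + 2 * (\<Sum>x\<in>{1..N}. \<Sum>y | y \<in> {1..N} \<and> x < y. w y * w x * renewal p x * renewal p (y - x))"
  proof -
    have "future x = (\<Sum>y | y \<in> {1..N} \<and> x < y. renewal p (y - x) * w y)" if "x \<in> {1..N}" for x
      unfolding future_def using that by (intro sum.cong) auto
    then have "(\<Sum>x\<in>{1..N}. renewal p x * f x) = (\<Sum>x\<in>{1..N}. renewal p x * (w x)\<^sup>2
      + 2 * (\<Sum>y | y \<in> {1..N} \<and> x < y. w y * w x * renewal p x * renewal p (y - x)))"
      by (intro sum.cong refl) (simp add: f_def power2_eq_square distrib_left sum_distrib_left mult_ac)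
    then show ?thesis by (simp add: sum.distrib sum_distrib_left)
  qed
  also have "(\<Sum>x\<in>{1..N}. \<Sum>y | y \<in> {1..N} \<and> x < y. w y * w x * renewal p x * renewal p (y - x))
     = (\<Sum>y\<in>{1..N}. \<Sum>x | x \<in> {1..N} \<and> x < y. w y * w x * renewal p x * renewal p (y - x))"
    by (rule sum.swap_restrict) auto
  also have "\<dots> = (\<Sum>y\<in>{1..N}. \<Sum>x\<in>{1..<y}. w y * w x * renewal p x * renewal p (y - x))"
    by (intro sum.cong) auto
  also have "(\<Sum>x\<in>{1..N}. renewal p x * w x)\<^sup>2 = (\<Sum>x\<in>{1..N}. (renewal p x * w x)\<^sup>2)
     + 2 * (\<Sum>y\<in>{1..N}. \<Sum>x\<in>{1..<y}. w y * w x * renewal p x * renewal p y)"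
  proof (induction N)
    case (Suc n)
    have "{1..<Suc n} = {1..n}" by auto
    then show ?case using Suc
      by (simp add: power2_sum sum_distrib_left sum_distrib_right algebra_simps)
  qed simp
  finally show ?thesis
    by (simp add: sum_subtractf sum_distrib_left right_diff_distrib power2_eq_square sum.distrib mult_ac)
qed

end

section \<open>Characteristic function and mean along the walk\<close>

lemma iexp_add: "iexp (x + y) = iexp x * iexp y"
  by (simp add: distrib_left exp_add)

text \<open>A sum along a list is bounded only once the length is fixed; \<open>f\<close> is
  replaced by 0 on lists of other lengths, which have probability zero.\<close>

lemma expectation_replicate_pmf_Suc_length:
  fixes f :: "nat list \<Rightarrow> real"
  assumes B: "\<And>xs. length xs = Suc n \<Longrightarrow> \<bar>f xs\<bar> \<le> B"
  shows "expect (replicate_pmf (Suc n) p) f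
    = expect p (\<lambda>x. expect (replicate_pmf n p) (\<lambda>xs. f (x # xs)))"
proof -
  define f' where "f' xs = (if length xs = Suc n then f xs else 0)" for xs
  have cong: "expect (replicate_pmf k p) g = expect (replicate_pmf k p) h"
    if "\<And>xs. length xs = k \<Longrightarrow> g xs = h xs" for k and g h :: "nat list \<Rightarrow> real"
    by (rule integral_cong_AE) (auto simp: AE_measure_pmf_iff set_replicate_pmf intro: that)
  have "B \<ge> 0" using B[of "replicate (Suc n) 0"] by (simp del: replicate_Suc)
  then have "\<bar>f' xs\<bar> \<le> B" for xs using B by (simp add: f'_def)
  from expectation_replicate_pmf_Suc[of f', OF this, of n p]
  have "expect (replicate_pmf (Suc n) p) f'
    = expect p (\<lambda>x. expect (replicate_pmf n p) (\<lambda>xs. f' (x # xs)))" .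
  moreover have "expect (replicate_pmf (Suc n) p) f' = expect (replicate_pmf (Suc n) p) f"
    by (rule cong) (simp add: f'_def)
  moreover have "expect (replicate_pmf n p) (\<lambda>xs. f' (x # xs))
     = expect (replicate_pmf n p) (\<lambda>xs. f (x # xs))" for x
    by (rule cong) (simp add: f'_def)
  ultimately show ?thesis by simp
qed

context renewal_scenery
begin

text \<open>The characteristic function of a normal variable with the mean and the variance of what
  remains strictly after \<open>s\<close>.\<close>

definition psi :: "real \<Rightarrow> nat \<Rightarrow> complex" where
  "psi t s = iexp (t * future s) * exp (- (t\<^sup>2 * variance_left s / 2))"

definition step_error :: "real \<Rightarrow> real" where
  "step_error t = (\<bar>t\<bar> ^ 3 * (C0 * K) ^ 3 + t ^ 4 * (var_bound * C0)\<^sup>2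
     + \<bar>t\<bar> ^ 3 * (C0 * K * (var_bound * C0))) * second_moment"

lemma norm_psi_le: "norm (psi t s) \<le> 1"
  using variance_left_nonneg[of s] by (simp add: psi_def norm_mult)

text \<open>The three terms are of order \<open>k^(3/2)\<close>, \<open>k^2\<close> and
  \<open>k^(3/2)\<close>; as \<open>k \<ge> 1\<close>, all are below a multiple of
  \<open>k^2\<close>, whose expectation is finite.\<close>

lemma expansion_error_le:
  assumes k: "k \<ge> 1"
  shows "\<bar>t\<bar> ^ 3 * \<bar>potential N w (s + k) - future s\<bar> ^ 3
      + t ^ 4 * (variance_left s - variance_left (s + k))\<^sup>2
      + \<bar>t\<bar> ^ 3 * (\<bar>potential N w (s + k) - future s\<bar> * \<bar>variance_left s - variance_left (s + k)\<bar>)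
    \<le> (\<bar>t\<bar> ^ 3 * (C0 * K) ^ 3 + t ^ 4 * (var_bound * C0)\<^sup>2
     + \<bar>t\<bar> ^ 3 * (C0 * K * (var_bound * C0))) * (real k)\<^sup>2"
proof -
  let ?d = "\<bar>potential N w (s + k) - future s\<bar>" and ?v = "\<bar>variance_left s - variance_left (s + k)\<bar>"
  have a: "C0 * K \<ge> 0" and b: "var_bound * C0 \<ge> 0"
    using C0_ge_1 K_nonneg var_bound_nonneg by auto
  have d: "?d \<le> C0 * K * sqrt (real k)" by (rule increment_le[OF k])
  have v: "?v \<le> var_bound * C0 * real k" by (rule variance_left_diff[OF k])
  have sk: "sqrt (real k) \<le> real k"
    using k by (intro real_le_lsqrt) (auto simp: power2_eq_square)
  have "?d ^ 3 \<le> (C0 * K * sqrt (real k)) ^ 3" by (rule power_mono[OF d]) simp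
  also have "\<dots> = (C0 * K) ^ 3 * (real k * sqrt (real k))"
    by (simp add: power_mult_distrib power3_eq_cube)
  also have "\<dots> \<le> (C0 * K) ^ 3 * (real k * real k)"
    using sk a by (intro mult_left_mono) auto
  finally have 1: "?d ^ 3 \<le> (C0 * K) ^ 3 * (real k)\<^sup>2" by (simp add: power2_eq_square)
  have "?v\<^sup>2 \<le> (var_bound * C0 * real k)\<^sup>2" by (rule power_mono[OF v]) simp
  then have 2: "(variance_left s - variance_left (s + k))\<^sup>2 \<le> (var_bound * C0)\<^sup>2 * (real k)\<^sup>2"
    by (simp add: power_mult_distrib)
  have "?d * ?v \<le> (C0 * K * sqrt (real k)) * (var_bound * C0 * real k)"
    using a by (intro mult_mono d v) auto
  also have "\<dots> = C0 * K * (var_bound * C0) * (real k * sqrt (real k))" by (simp add: mult_ac)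
  also have "\<dots> \<le> C0 * K * (var_bound * C0) * (real k * real k)"
    using sk a b by (intro mult_left_mono) auto
  finally have 3: "?d * ?v \<le> C0 * K * (var_bound * C0) * (real k)\<^sup>2" by (simp add: power2_eq_square)
  have "\<bar>t\<bar> ^ 3 * ?d ^ 3 \<le> \<bar>t\<bar> ^ 3 * ((C0 * K) ^ 3 * (real k)\<^sup>2)"
    "t ^ 4 * (variance_left s - variance_left (s + k))\<^sup>2 \<le> t ^ 4 * ((var_bound * C0)\<^sup>2 * (real k)\<^sup>2)"
    "\<bar>t\<bar> ^ 3 * (?d * ?v) \<le> \<bar>t\<bar> ^ 3 * (C0 * K * (var_bound * C0) * (real k)\<^sup>2)"
    using 1 2 3 by (auto intro!: mult_left_mono)
  then show ?thesis by (simp only: distrib_right mult.assoc)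
qed

text \<open>The second-order terms cancel because \<open>variance_left\<close> solves the recursion \<open>variance_left_rec\<close> exactly.\<close>

lemma one_step:
  "norm (expect p (\<lambda>k. iexp (t * site (s + k)) * psi t (s + k)) - psi t s) \<le> step_error t"
proof -
  define d where "d k = potential N w (s + k) - future s" for k
  define W where "W k = variance_left (s + k)" for k
  define V where "V = variance_left s"
  define b where "b = exp (- (t\<^sup>2 * V / 2))"
  define q where "q k = - (t * d k)\<^sup>2 / 2 + t\<^sup>2 * (V - W k) / 2" for k
  define F where "F k = iexp (t * d k) * exp (- (t\<^sup>2 * W k / 2))" for k
  define m where "m k = complex_of_real b * (\<i> * (t * d k) + q k)" for k
  have W0: "W k \<ge> 0" "V \<ge> 0" for k by (simp_all add: W_def V_def variance_left_nonneg)
  \<comment> \<open>Since \<open>site + future\<close> is the potential, the phase after the step is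
    the old phase of \<open>future s\<close> times that of the centred increment.\<close>
  have step: "iexp (t * site (s + k)) * psi t (s + k) = iexp (t * future s) * F k" for k
  proof -
    have "t * site (s + k) + t * future (s + k) = t * future s + t * d k"
      by (simp add: d_def potential_eq_site_future algebra_simps)
    then have "iexp (t * site (s + k)) * iexp (t * future (s + k)) = iexp (t * future s) * iexp (t * d k)"
      using iexp_add by metis
    then show ?thesis by (simp add: psi_def F_def W_def mult.assoc[symmetric])
  qed
  have intF: "complex_integrable p F"
    by (rule measure_pmf.integrable_const_bound[where B = 1]) (auto simp: F_def norm_mult W0)
  have intd: "integrable p d" and intd2: "integrable p (\<lambda>k. (d k)\<^sup>2)" and intW: "integrable p W"
    by (auto simp: d_def[abs_def] W_def[abs_def] variance_left_def power2_diff)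
  have intq: "integrable p q" unfolding q_def using intd2 intW by (auto simp: power_mult_distrib)
  have Ed: "expect p d = 0"
    unfolding d_def by (simp add: expectation_step)
  have Ed2: "expect p (\<lambda>k. (d k)\<^sup>2) = step_var s"
    by (simp add: d_def step_var_eq)
  have EW: "expect p W = V - step_var s"
    using variance_left_rec[of s] by (simp add: W_def[abs_def] V_def)
  have Eq: "expect p q = 0"
  proof -
    have "q = (\<lambda>k. (- t\<^sup>2 / 2) * (d k)\<^sup>2 + (t\<^sup>2 / 2 * V - t\<^sup>2 / 2 * W k))"
      by (simp add: fun_eq_iff q_def power_mult_distrib right_diff_distrib diff_divide_distrib)
    then have "expect p q = (- t\<^sup>2 / 2) * step_var s + (t\<^sup>2 / 2 * V - t\<^sup>2 / 2 * (V - step_var s))"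
      using intd2 intW Ed2 EW by simp
    then show ?thesis by (simp add: right_diff_distrib)
  qed
  have intm: "complex_integrable p m" unfolding m_def using intd intq by simp
  have Em: "expect p m = 0"
    unfolding m_def using intd intq by (simp add: Ed Eq)
  have "expect p (\<lambda>k. F k - b - m k) = expect p F - b"
    using intF intm Em by simp
  moreover have "norm (expect p (\<lambda>k. F k - b - m k)) \<le> step_error t"
  proof -
    let ?c = "\<bar>t\<bar> ^ 3 * (C0 * K) ^ 3 + t ^ 4 * (var_bound * C0)\<^sup>2 + \<bar>t\<bar> ^ 3 * (C0 * K * (var_bound * C0))"
    have "norm (expect p (\<lambda>k. F k - b - m k)) \<le> expect p (\<lambda>k. norm (F k - b - m k))"
      by (rule integral_norm_bound)
    also have "\<dots> \<le> expect p (\<lambda>k. ?c * (real k)\<^sup>2)"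
    proof (rule integral_mono_AE)
      show "AE k in p. norm (F k - b - m k) \<le> ?c * (real k)\<^sup>2"
        using AE_step
      proof eventually_elim
        case (elim k)
        have "F k - b - m k = iexp (t * d k) * exp (- (t\<^sup>2 * W k / 2)) - exp (- (t\<^sup>2 * V / 2))
             - exp (- (t\<^sup>2 * V / 2)) * (\<i> * (t * d k) - (t * d k)\<^sup>2 / 2 + t\<^sup>2 * (V - W k) / 2)"
          by (simp add: F_def m_def b_def q_def add_diff_eq)
        then have "norm (F k - b - m k) \<le> \<bar>t\<bar> ^ 3 * \<bar>d k\<bar> ^ 3 + t ^ 4 * (V - W k)\<^sup>2 + \<bar>t\<bar> ^ 3 * (\<bar>d k\<bar> * \<bar>V - W k\<bar>)"
          using iexp_gauss_expansion[of V "W k" t "d k"] W0 by simp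
        also have "\<dots> \<le> ?c * (real k)\<^sup>2"
          using expansion_error_le[OF elim] by (simp add: d_def V_def W_def)
        finally show ?case .
      qed
    qed (use intF intm square_integrable in auto)
    also have "\<dots> = step_error t" by (simp add: step_error_def second_moment_def)
    finally show ?thesis .
  qed
  moreover have "expect p (\<lambda>k. iexp (t * site (s + k)) * psi t (s + k)) - psi t s
      = iexp (t * future s) * (expect p F - b)"
    unfolding step using intF by (simp add: psi_def b_def V_def algebra_simps)
  ultimately show ?thesis by (simp add: norm_mult)
qed

text \<open>Induction over the first step with the start site free: the phase of the first site has
  modulus one, so the errors of the single steps add up.\<close>

lemma multi_step:
  "norm (expect (replicate_pmf n p)
       (\<lambda>xs. iexp (t * scenery_sum site s xs) * psi t (s + sum_list xs)) - psi t s) \<le> real n * step_error t"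
proof (induction n arbitrary: s)
  case (Suc n)
  let ?I = "\<lambda>x. expect (replicate_pmf n p)
       (\<lambda>xs. iexp (t * scenery_sum site (s + x) xs) * psi t (s + x + sum_list xs))"
  let ?e = "\<lambda>x. iexp (t * site (s + x))"
  have nf: "norm (iexp (t * scenery_sum site s xs) * psi t (s + sum_list xs)) \<le> 1" for s xs
    using norm_psi_le by (simp add: norm_mult)
  have "expect (replicate_pmf (Suc n) p)
       (\<lambda>xs. iexp (t * scenery_sum site s xs) * psi t (s + sum_list xs))
     = expect p (\<lambda>x. expect (replicate_pmf n p)
         (\<lambda>xs. iexp (t * scenery_sum site s (x # xs)) * psi t (s + sum_list (x # xs))))"
    by (rule complex_expectation_replicate_pmf_Suc[OF nf])
  also have "\<dots> = expect p (\<lambda>x. ?e x * ?I x)"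
  proof (rule Bochner_Integration.integral_cong[OF refl])
    fix x
    have "iexp (t * scenery_sum site s (x # xs)) * psi t (s + sum_list (x # xs))
       = ?e x * (iexp (t * scenery_sum site (s + x) xs) * psi t (s + x + sum_list xs))" for xs
      by (simp add: distrib_left exp_add mult.assoc add.assoc)
    then show "expect (replicate_pmf n p)
         (\<lambda>xs. iexp (t * scenery_sum site s (x # xs)) * psi t (s + sum_list (x # xs))) = ?e x * ?I x"
      by simp
  qed
  finally have eq: "expect (replicate_pmf (Suc n) p)
       (\<lambda>xs. iexp (t * scenery_sum site s xs) * psi t (s + sum_list xs))
     = expect p (\<lambda>x. ?e x * ?I x)" .
  have nI: "norm (?I x) \<le> 1" for x
  proof -
    have "norm (?I x) \<le> expect (replicate_pmf n p)
       (\<lambda>xs. norm (iexp (t * scenery_sum site (s + x) xs) * psi t (s + x + sum_list xs)))"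
      by (rule integral_norm_bound)
    also have "\<dots> \<le> expect (replicate_pmf n p) (\<lambda>_. 1)"
    proof (rule integral_mono)
      show "integrable (replicate_pmf n p) (\<lambda>xs. norm (iexp (t * scenery_sum site (s + x) xs) * psi t (s + x + sum_list xs)))"
        by (rule measure_pmf.integrable_const_bound[where B = 1]) (use nf in auto)
    qed (use nf in auto)
    finally show ?thesis by simp
  qed
  have int1: "complex_integrable p (\<lambda>x. ?e x * ?I x)"
    by (rule measure_pmf.integrable_const_bound[where B = 1], rule AE_I2) (use nI in \<open>simp_all add: norm_mult\<close>)
  have int2: "complex_integrable p (\<lambda>x. ?e x * psi t (s + x))"
    by (rule measure_pmf.integrable_const_bound[where B = 1]) (auto simp: norm_mult norm_psi_le)
  have "norm (expect p (\<lambda>x. ?e x * ?I x) - expect p (\<lambda>x. ?e x * psi t (s + x)))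
    = norm (expect p (\<lambda>x. ?e x * (?I x - psi t (s + x))))"
    using int1 int2 by (simp add: right_diff_distrib)
  also have "\<dots> \<le> expect p (\<lambda>x. norm (?e x * (?I x - psi t (s + x))))"
    by (rule integral_norm_bound)
  also have "\<dots> \<le> expect p (\<lambda>x. real n * step_error t)"
  proof (rule integral_mono)
    show "integrable p (\<lambda>x. norm (?e x * (?I x - psi t (s + x))))"
      unfolding right_diff_distrib by (intro integrable_norm Bochner_Integration.integrable_diff int1 int2)
    show "norm (?e x * (?I x - psi t (s + x))) \<le> real n * step_error t" for x
      unfolding norm_mult norm_exp_i_times mult_1 by (rule Suc)
  qed simp
  finally have "norm (expect p (\<lambda>x. ?e x * ?I x) - expect p (\<lambda>x. ?e x * psi t (s + x)))
     \<le> real n * step_error t" by simp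
  then have "norm (expect p (\<lambda>x. ?e x * ?I x) - psi t s) \<le> real n * step_error t + step_error t"
    using one_step[of t s] by (rule norm_diff_triangle_le)
  then show ?case unfolding eq by (simp add: algebra_simps)
qed simp

lemma finite_site_bound: "\<exists>B. \<forall>x. \<bar>site x\<bar> \<le> B"
proof (intro exI allI)
  fix x
  show "\<bar>site x\<bar> \<le> (\<Sum>x\<le>N. \<bar>w x\<bar>)"
    by (cases "x \<le> N") (auto simp: site_def sum_nonneg intro: member_le_sum[of x "{..N}" "\<lambda>x. \<bar>w x\<bar>"])
qed

lemma abs_scenery_sum_le: "\<forall>x. \<bar>f x\<bar> \<le> B \<Longrightarrow> \<bar>scenery_sum f s xs\<bar> \<le> B * real (length xs)"
proof (induction xs arbitrary: s)
  case (Cons x xs)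
  have "\<bar>f (s + x) + scenery_sum f (s + x) xs\<bar> \<le> B + B * real (length xs)"
    using Cons by (intro order_trans[OF abs_triangle_ineq] add_mono) auto
  then show ?case by (simp add: algebra_simps)
qed simp

lemma future_bounded: "\<bar>future s\<bar> \<le> C0 * K * sqrt (real N)"
proof -
  have "C0 * K * sqrt (real (N - s)) \<le> C0 * K * sqrt (real N)"
    using C0_ge_1 K_nonneg by (intro mult_left_mono) auto
  then show ?thesis using abs_future_le[of s] by linarith
qed

lemma integrable_replicate_length:
  fixes f :: "nat list \<Rightarrow> real"
  assumes "\<And>xs. length xs = n \<Longrightarrow> \<bar>f xs\<bar> \<le> B"
  shows "integrable (replicate_pmf n p) f"
  by (rule measure_pmf.integrable_const_bound[where B = B])
    (auto simp: AE_measure_pmf_iff set_replicate_pmf assms)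

lemma integrable_scenery_sum [simp]: "integrable (replicate_pmf n p) (scenery_sum site s)"
proof -
  obtain B where "\<forall>x. \<bar>site x\<bar> \<le> B" using finite_site_bound by blast
  then show ?thesis
    by (intro integrable_replicate_length[where B = "B * real n"]) (auto dest: abs_scenery_sum_le)
qed

lemma integrable_future_end [simp]: "integrable (replicate_pmf n p) (\<lambda>xs. future (s + sum_list xs))"
  by (rule integrable_replicate_length[OF future_bounded])

text \<open>A martingale identity without error term: scenery collected plus expected future keeps
  its mean. It links the centring by \<open>E[Z_n]\<close> to \<open>future 0\<close>.\<close>

lemma mean_multi_step:
  "expect (replicate_pmf n p) (\<lambda>xs. scenery_sum site s xs + future (s + sum_list xs)) = future s"
proof (induction n arbitrary: s)
  case (Suc n)
  obtain B where B: "\<forall>x. \<bar>site x\<bar> \<le> B" using finite_site_bound by blast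
  have bd: "\<bar>scenery_sum site s xs + future (s + sum_list xs)\<bar> \<le> B * real (Suc n) + C0 * K * sqrt (real N)"
    if "length xs = Suc n" for xs
    using abs_scenery_sum_le[OF B, of s xs] future_bounded[of "s + sum_list xs"] that
    by (intro order_trans[OF abs_triangle_ineq] add_mono) auto
  have "expect (replicate_pmf (Suc n) p) (\<lambda>xs. scenery_sum site s xs + future (s + sum_list xs))
    = expect p (\<lambda>x. expect (replicate_pmf n p)
       (\<lambda>xs. scenery_sum site s (x # xs) + future (s + sum_list (x # xs))))"
    by (rule expectation_replicate_pmf_Suc_length[OF bd])
  also have "\<dots> = expect p (\<lambda>x. site (s + x) + future (s + x))"
  proof (rule Bochner_Integration.integral_cong[OF refl])
    fix x
    have "expect (replicate_pmf n p) (\<lambda>xs. scenery_sum site s (x # xs) + future (s + sum_list (x # xs)))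
      = expect (replicate_pmf n p) (\<lambda>xs. site (s + x) + (scenery_sum site (s + x) xs + future (s + x + sum_list xs)))"
      by (simp add: add.assoc)
    also have "\<dots> = site (s + x) + future (s + x)"
      by (subst Bochner_Integration.integral_add) (auto simp only: Suc integrable_scenery_sum integrable_future_end
        Bochner_Integration.integrable_add measure_pmf.integrable_const measure_pmf.prob_space lebesgue_integral_const scaleR_one)
    finally show "expect (replicate_pmf n p) (\<lambda>xs. scenery_sum site s (x # xs) + future (s + sum_list (x # xs)))
      = site (s + x) + future (s + x)" .
  qed
  also have "\<dots> = future s" by (simp flip: potential_eq_site_future add: expectation_step)
  finally show ?case .
qed simp

text \<open>Subtraction on \<open>nat\<close> is truncated, so a walk that has passed
  \<open>N\<close> contributes 0.\<close>

definition gap :: "nat \<Rightarrow> real" where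
  "gap n = expect (replicate_pmf n p) (\<lambda>xs. real (N - sum_list xs))"
definition sqrt_gap :: "nat \<Rightarrow> real" where
  "sqrt_gap n = expect (replicate_pmf n p) (\<lambda>xs. sqrt (real (N - sum_list xs)))"

lemma integrable_gap [simp]: "integrable (replicate_pmf n p) (\<lambda>xs. real (N - sum_list xs))"
  "integrable (replicate_pmf n p) (\<lambda>xs. sqrt (real (N - sum_list xs)))"
  by (rule integrable_replicate_length[where B = "real N"], simp)
    (rule integrable_replicate_length[where B = "sqrt (real N)"], simp)

lemma mean_estimate:
  "\<bar>expect (replicate_pmf n p) (scenery_sum site 0) - future 0\<bar> \<le> C0 * K * sqrt_gap n"
proof -
  have "expect (replicate_pmf n p) (scenery_sum site 0) - future 0
     = - expect (replicate_pmf n p) (\<lambda>xs. future (sum_list xs))"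
    using mean_multi_step[of n 0] integrable_future_end[of n 0] by simp
  also have "\<bar>\<dots>\<bar> \<le> expect (replicate_pmf n p) (\<lambda>xs. \<bar>future (sum_list xs)\<bar>)"
    using integral_abs_bound by simp
  also have "\<dots> \<le> expect (replicate_pmf n p) (\<lambda>xs. C0 * K * sqrt (real (N - sum_list xs)))"
    using integrable_future_end[of n 0] by (intro integral_mono abs_future_le integrable_mult_right) auto
  finally show ?thesis by (simp add: sqrt_gap_def)
qed

lemma norm_one_minus_psi: "norm (1 - psi t s) \<le> \<bar>t\<bar> * \<bar>future s\<bar> + t\<^sup>2 * variance_left s / 2"
proof -
  define c where "c = t\<^sup>2 * variance_left s / 2"
  have c: "c \<ge> 0" using variance_left_nonneg by (simp add: c_def)
  have "1 - psi t s = - (iexp (t * future s) - 1) + iexp (t * future s) * of_real (1 - exp (- c))"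
    by (simp add: psi_def c_def algebra_simps)
  also have "norm \<dots> \<le> norm (iexp (t * future s) - 1) + \<bar>1 - exp (- c)\<bar>"
    by (rule order_trans[OF norm_triangle_ineq]) (simp only: norm_mult norm_of_real norm_minus_cancel norm_exp_i_times mult_1 order_refl)
  also have "\<dots> \<le> \<bar>t * future s\<bar> + c"
    using iexp_approx1[of "t * future s" 0] exp_minus_bounds(1)[of 0 c] c by (intro add_mono) auto
  finally show ?thesis by (simp add: c_def abs_mult)
qed

text \<open>After \<open>n\<close> steps the factor \<open>psi\<close> at the final site is replaced
  by 1. The cost is the mean and variance still left there, bounded by multiples of
  \<open>sqrt (N - S_n)\<close> and \<open>N - S_n\<close>.\<close>

lemma char_estimate:
  "norm (expect (replicate_pmf n p) (\<lambda>xs. iexp (t * scenery_sum site 0 xs)) - psi t 0)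
    \<le> real n * step_error t + \<bar>t\<bar> * (C0 * K) * sqrt_gap n + t\<^sup>2 * var_bound * gap n"
proof -
  let ?e = "\<lambda>xs. iexp (t * scenery_sum site 0 xs)"
  let ?q = "replicate_pmf n p"
  have int1: "complex_integrable ?q ?e"
    by (rule measure_pmf.integrable_const_bound[where B = 1]) auto
  have int2: "complex_integrable ?q (\<lambda>xs. ?e xs * psi t (sum_list xs))"
    by (rule measure_pmf.integrable_const_bound[where B = 1]) (auto simp: norm_mult norm_psi_le)
  have "norm (expect ?q ?e - expect ?q (\<lambda>xs. ?e xs * psi t (sum_list xs)))
    = norm (expect ?q (\<lambda>xs. ?e xs * (1 - psi t (sum_list xs))))"
    using int1 int2 by (simp add: right_diff_distrib)
  also have "\<dots> \<le> expect ?q (\<lambda>xs. norm (?e xs * (1 - psi t (sum_list xs))))"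
    by (rule integral_norm_bound)
  also have "\<dots> \<le> expect ?q (\<lambda>xs. \<bar>t\<bar> * (C0 * K) * sqrt (real (N - sum_list xs)) + t\<^sup>2 * var_bound * real (N - sum_list xs))"
  proof (rule integral_mono)
    show "integrable ?q (\<lambda>xs. norm (?e xs * (1 - psi t (sum_list xs))))"
      using int1 int2 by (intro integrable_norm) (simp add: right_diff_distrib)
    fix xs
    have "norm (?e xs * (1 - psi t (sum_list xs))) \<le> \<bar>t\<bar> * \<bar>future (sum_list xs)\<bar> + t\<^sup>2 * variance_left (sum_list xs) / 2"
      using norm_one_minus_psi[of t "sum_list xs"] by (simp add: norm_mult)
    also have "\<dots> \<le> \<bar>t\<bar> * (C0 * K * sqrt (real (N - sum_list xs))) + t\<^sup>2 * (var_bound * real (N - sum_list xs))"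
    proof (intro add_mono mult_left_mono abs_future_le)
      have "t\<^sup>2 * variance_left (sum_list xs) / 2 \<le> t\<^sup>2 * variance_left (sum_list xs)"
        using variance_left_nonneg[of "sum_list xs"] by simp
      also have "\<dots> \<le> t\<^sup>2 * (var_bound * real (N - sum_list xs))"
        by (intro mult_left_mono variance_left_le) simp
      finally show "t\<^sup>2 * variance_left (sum_list xs) / 2 \<le> t\<^sup>2 * (var_bound * real (N - sum_list xs))" .
    qed simp
    finally show "norm (?e xs * (1 - psi t (sum_list xs)))
       \<le> \<bar>t\<bar> * (C0 * K) * sqrt (real (N - sum_list xs)) + t\<^sup>2 * var_bound * real (N - sum_list xs)"
      by (simp only: mult.assoc)
  qed simp
  also have "\<dots> = \<bar>t\<bar> * (C0 * K) * sqrt_gap n + t\<^sup>2 * var_bound * gap n"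
    by (simp add: sqrt_gap_def gap_def)
  finally have "norm (expect ?q ?e - expect ?q (\<lambda>xs. ?e xs * psi t (sum_list xs)))
    \<le> \<bar>t\<bar> * (C0 * K) * sqrt_gap n + t\<^sup>2 * var_bound * gap n" .
  from norm_diff_triangle_le[OF this, of "psi t 0" "real n * step_error t"] multi_step[of n t 0]
  show ?thesis by simp
qed

end

section \<open>Quenched characteristic functions\<close>

lemma norm_iexp_diff_le: "norm (iexp x - iexp y) \<le> \<bar>x - y\<bar>"
proof -
  have "iexp x - iexp y = iexp y * (iexp (x - y) - 1)"
    using iexp_add[of y "x - y"] by (simp add: right_diff_distrib)
  also have "norm \<dots> = norm (iexp (x - y) - 1)"
    by (simp only: norm_mult norm_exp_i_times mult_1)
  also have "\<dots> \<le> \<bar>x - y\<bar>" using iexp_approx1[of "x - y" 0] by simp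
  finally show ?thesis .
qed

lemma nn_integral_replicate_pmf_Suc:
  "(\<integral>\<^sup>+xs. f xs \<partial>replicate_pmf (Suc n) p) = (\<integral>\<^sup>+x. \<integral>\<^sup>+xs. f (x # xs) \<partial>replicate_pmf n p \<partial>p)"
  by simp

section \<open>Fluctuations of the walk and coefficients of the quadratic form\<close>

context renewal_law
begin

definition step_variance :: real where
  "step_variance = expect p (\<lambda>k. (real k - mean)\<^sup>2)"

lemma integrable_step_sq [simp]: "integrable p (\<lambda>k. (c + real k)\<^sup>2)"
  using square_integrable by (simp add: power2_sum)

lemma expectation_step_sq:
  "expect p (\<lambda>k. (c + (real k - mean))\<^sup>2) = c\<^sup>2 + step_variance"
proof -
  have int: "integrable p (\<lambda>k. (real k - mean)\<^sup>2)"
    using square_integrable by (simp add: power2_diff)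
  have "expect p (\<lambda>k. (c + (real k - mean))\<^sup>2)
    = expect p (\<lambda>k. c\<^sup>2 + (real k - mean)\<^sup>2 + 2 * c * (real k - mean))"
    by (simp only: power2_sum)
  also have "\<dots> = c\<^sup>2 + step_variance"
    using int by (simp add: step_variance_def) (simp add: mean_def)
  finally show ?thesis .
qed

lemma step_variance_nonneg: "step_variance \<ge> 0"
  unfolding step_variance_def by simp

text \<open>The shift \<open>c\<close> absorbs the centred first step, which makes the induction
  close. With nonnegative integrals, integrability is a consequence and not a side
  condition.\<close>

lemma sum_variance_nn:
  "(\<integral>\<^sup>+xs. ennreal ((c + (real (sum_list xs) - real n * mean))\<^sup>2) \<partial>replicate_pmf n p)
    = ennreal (c\<^sup>2 + real n * step_variance)"
proof (induction n arbitrary: c)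
  case (Suc n)
  have "(\<integral>\<^sup>+xs. ennreal ((c + (real (sum_list xs) - real (Suc n) * mean))\<^sup>2) \<partial>replicate_pmf (Suc n) p)
    = (\<integral>\<^sup>+x. \<integral>\<^sup>+xs. ennreal ((c + (real (sum_list (x # xs)) - real (Suc n) * mean))\<^sup>2) \<partial>replicate_pmf n p \<partial>p)"
    by (rule nn_integral_replicate_pmf_Suc)
  also have "\<dots> = (\<integral>\<^sup>+x. \<integral>\<^sup>+xs. ennreal (((c + (real x - mean)) + (real (sum_list xs) - real n * mean))\<^sup>2) \<partial>replicate_pmf n p \<partial>p)"
    by (simp add: algebra_simps)
  also have "\<dots> = (\<integral>\<^sup>+x. ennreal ((c + (real x - mean))\<^sup>2 + real n * step_variance) \<partial>p)"
    by (simp only: Suc)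
  also have "\<dots> = ennreal (expect p (\<lambda>x. (c + (real x - mean))\<^sup>2 + real n * step_variance))"
    using integrable_step_sq[of "c - mean"] step_variance_nonneg
    by (intro nn_integral_eq_integral) (auto simp: algebra_simps)
  also have "\<dots> = ennreal (c\<^sup>2 + real (Suc n) * step_variance)"
    using integrable_step_sq[of "c - mean"] expectation_step_sq[of c]
    by (subst Bochner_Integration.integral_add) (auto simp: algebra_simps)
  finally show ?case .
qed simp

lemma
  shows integrable_sum_variance: "integrable (replicate_pmf n p) (\<lambda>xs. (real (sum_list xs) - real n * mean)\<^sup>2)"
    and sum_variance: "expect (replicate_pmf n p) (\<lambda>xs. (real (sum_list xs) - real n * mean)\<^sup>2)
      = real n * step_variance"
proof -
  have nn: "(\<integral>\<^sup>+xs. ennreal ((real (sum_list xs) - real n * mean)\<^sup>2) \<partial>replicate_pmf n p) = ennreal (real n * step_variance)"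
    using sum_variance_nn[where c = 0 and n = n] by (simp only: add_0 power_zero_numeral)
  show "integrable (replicate_pmf n p) (\<lambda>xs. (real (sum_list xs) - real n * mean)\<^sup>2)"
    by (rule integrableI_nonneg) (auto simp: nn)
  show "expect (replicate_pmf n p) (\<lambda>xs. (real (sum_list xs) - real n * mean)\<^sup>2)
      = real n * step_variance"
    by (rule integral_eq_nn_integral[THEN trans]) (auto simp: nn step_variance_nonneg)
qed

text \<open>Powers of \<open>n\<close> with exponents in \<open>\<int>/32\<close> are written as integer powers of \<open>scale n\<close>. The cutoff exceeds
  the typical position \<open>n \<cdot> mean\<close> of the \<open>n\<close>-th renewal by \<open>n powr (3/4)\<close>, more than its fluctuations.\<close>

definition scale :: "nat \<Rightarrow> real" where "scale n = real n powr (1/32)"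
definition cutoff :: "nat \<Rightarrow> nat" where
  "cutoff n = nat \<lceil>real n * mean\<rceil> + nat \<lceil>scale n ^ 24\<rceil>"

lemma scale_ge_1: "n \<ge> 1 \<Longrightarrow> scale n \<ge> 1"
  by (simp add: scale_def ge_one_powr_ge_zero)

lemma scale_power: "n \<ge> 1 \<Longrightarrow> scale n ^ 32 = real n"
  unfolding scale_def by (subst powr_power) (auto simp: powr_one)

lemma sqrt_scale: "n \<ge> 1 \<Longrightarrow> sqrt (real n) = scale n ^ 16"
  using scale_power[of n] scale_ge_1[of n]
  by (intro real_sqrt_unique) (auto simp: power_mult[symmetric])

lemma scale_at_top: "filterlim scale at_top sequentially"
proof -
  have "filterlim (\<lambda>n. exp (1/32 * ln (real n))) at_top sequentially"
    by (intro filterlim_compose[OF exp_at_top] filterlim_tendsto_pos_mult_at_top[OF tendsto_const]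
        filterlim_compose[OF ln_at_top] filterlim_real_sequentially) simp
  moreover have "\<forall>\<^sub>F n in sequentially. exp (1/32 * ln (real n)) = scale n"
    by (rule eventually_sequentiallyI[of 1]) (simp add: scale_def powr_def)
  ultimately show ?thesis by (rule filterlim_mono_eventually[OF _ order_refl order_refl])
qed

lemma cutoff_bounds:
  assumes n: "n \<ge> 1"
  shows "real n * mean + scale n ^ 24 \<le> real (cutoff n)"
    and "real (cutoff n) \<le> real n * mean + 3 * scale n ^ 24"
    and "real (cutoff n) \<le> (mean + 3) * real n"
proof -
  have 1: "1 \<le> scale n ^ 24" using scale_ge_1[OF n] by simp
  have m: "0 \<le> real n * mean" using mean_ge_1 by simp
  show "real n * mean + scale n ^ 24 \<le> real (cutoff n)"
    unfolding cutoff_def by (simp only: of_nat_add) (intro add_mono real_nat_ceiling_ge)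
  \<comment> \<open>Each of the two ceilings adds at most 1, and
    \<open>1 \<le> scale n ^ 24\<close>; hence the factor 3.\<close>
  have "real (nat \<lceil>x\<rceil>) \<le> x + 1" if "0 \<le> x" for x :: real using that by linarith
  from this[of "real n * mean"] this[of "scale n ^ 24"] m 1
  show *: "real (cutoff n) \<le> real n * mean + 3 * scale n ^ 24"
    unfolding cutoff_def by (simp only: of_nat_add) linarith
  have "scale n ^ 24 \<le> scale n ^ 32" using scale_ge_1[OF n] by (intro power_increasing) auto
  with * show "real (cutoff n) \<le> (mean + 3) * real n" using scale_power[OF n] by (simp add: algebra_simps)
qed

lemma inverse_mean: "0 \<le> 1 / mean" "1 / mean \<le> 1"
  using mean_ge_1 by auto

text \<open>\<open>u (1 - u)\<close> is Lipschitz on the unit interval and \<open>dev\<close> is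
  summable, so the diagonal coefficients have density \<open>1 / mean * (1 - 1 / mean)\<close> up to
  a bounded total error.\<close>

lemma sum_renewal_var:
  "\<bar>(\<Sum>x\<in>{1..l}. renewal p x * (1 - renewal p x)) - real l * (1 / mean * (1 - 1 / mean))\<bar> \<le> dev_sum"
proof -
  have "\<bar>renewal p x * (1 - renewal p x) - 1 / mean * (1 - 1 / mean)\<bar> \<le> \<bar>dev x\<bar>" for x
  proof -
    have "renewal p x * (1 - renewal p x) - 1 / mean * (1 - 1 / mean) = dev x * (1 - renewal p x - 1 / mean)"
      by (simp add: dev_def algebra_simps)
    moreover have "\<bar>1 - renewal p x - 1 / mean\<bar> \<le> 1"
      using renewal_bounds[of p x] inverse_mean unfolding abs_le_iff by linarith
    ultimately show ?thesis by (simp add: abs_mult mult_left_le)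
  qed
  then have "(\<Sum>x\<in>{1..l}. \<bar>renewal p x * (1 - renewal p x) - 1 / mean * (1 - 1 / mean)\<bar>) \<le> (\<Sum>x\<in>{1..l}. \<bar>dev x\<bar>)"
    by (rule sum_mono)
  also have "\<dots> \<le> dev_sum" unfolding dev_sum_def by (rule sum_le_suminf[OF summable_dev]) auto
  finally have "\<bar>\<Sum>x\<in>{1..l}. (renewal p x * (1 - renewal p x) - 1 / mean * (1 - 1 / mean))\<bar> \<le> dev_sum"
    by (rule order_trans[OF sum_abs])
  then show ?thesis by (simp add: sum_subtractf)
qed

text \<open>The bracket is \<open>dev (y - x) - dev y\<close>. The squares of the first part are
  summable in \<open>x\<close>; the second part is constant in \<open>x\<close> and is controlled by
  \<open>dev_decay\<close>.\<close>

lemma quadratic_coefficients: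
  "\<exists>B. \<forall>y. (\<Sum>x\<in>{1..<y}. (renewal p x * (renewal p (y - x) - renewal p y))\<^sup>2) \<le> B"
proof -
  obtain D where D: "\<And>n. real n * (dev n)\<^sup>2 \<le> D" using dev_decay by blast
  have abs_dev: "\<bar>dev x\<bar> \<le> 1" for x
    using renewal_bounds[of p x] inverse_mean unfolding dev_def abs_le_iff by linarith
  have "(\<Sum>x\<in>{1..<y}. (renewal p x * (renewal p (y - x) - renewal p y))\<^sup>2) \<le> 2 * dev_sum + 2 * D" for y
  proof -
    have "(renewal p x * (renewal p (y - x) - renewal p y))\<^sup>2 \<le> 2 * \<bar>dev (y - x)\<bar> + 2 * (dev y)\<^sup>2" for x
    proof -
      have "(renewal p x * (renewal p (y - x) - renewal p y))\<^sup>2 = (renewal p x)\<^sup>2 * (dev (y - x) - dev y)\<^sup>2"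
        by (simp add: dev_def power_mult_distrib)
      also have "\<dots> \<le> 1 * (dev (y - x) - dev y)\<^sup>2"
        using renewal_bounds[of p x] by (intro mult_right_mono) (auto simp: power_le_one)
      also have "\<dots> \<le> 2 * (dev (y - x))\<^sup>2 + 2 * (dev y)\<^sup>2"
        using sum_squares_bound[of "- dev (y - x)" "dev y"] by (simp add: power2_diff)
      also have "(dev (y - x))\<^sup>2 \<le> \<bar>dev (y - x)\<bar>"
        using mult_left_mono[OF abs_dev[of "y - x"], of "\<bar>dev (y - x)\<bar>"] by (simp add: power2_eq_square)
      finally show ?thesis by simp
    qed
    then have "(\<Sum>x\<in>{1..<y}. (renewal p x * (renewal p (y - x) - renewal p y))\<^sup>2)
       \<le> (\<Sum>x\<in>{1..<y}. 2 * \<bar>dev (y - x)\<bar> + 2 * (dev y)\<^sup>2)" by (rule sum_mono)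
    also have "\<dots> = 2 * (\<Sum>x\<in>{1..<y}. \<bar>dev (y - x)\<bar>) + 2 * (real (y - 1) * (dev y)\<^sup>2)"
      by (simp add: sum.distrib sum_distrib_left)
    also have "(\<Sum>x\<in>{1..<y}. \<bar>dev (y - x)\<bar>) = (\<Sum>x\<in>{1..<y}. \<bar>dev x\<bar>)"
      by (rule sum.reindex_bij_witness[where i = "\<lambda>x. y - x" and j = "\<lambda>x. y - x"]) auto
    also have "\<dots> \<le> dev_sum" unfolding dev_sum_def by (rule sum_le_suminf[OF summable_dev]) auto
    also have "real (y - 1) * (dev y)\<^sup>2 \<le> real y * (dev y)\<^sup>2" by (intro mult_right_mono) auto
    also have "\<dots> \<le> D" by (rule D)
    finally show ?thesis by simp
  qed
  then show ?thesis by blast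
qed

end

section \<open>Estimates for one fixed scenery\<close>

locale quenched_scenery = renewal_law +
  fixes w :: "nat \<Rightarrow> real" and C :: real
  assumes regular: "\<And>x y. x < y \<Longrightarrow> \<bar>\<Sum>i\<in>{x<..y}. w i\<bar> \<le> C * real y powr (1/16) * sqrt (real (y - x))"
    and C_nonneg: "C \<ge> 0"
begin

text \<open>The constant \<open>K\<close> of the window up to
  \<open>cutoff n \<le> (mean + 3) * n\<close>: \<open>n powr (1/16)\<close> is
  \<open>(scale n)^2\<close>, and the 16th root of \<open>mean + 3\<close> is bounded by
  \<open>mean + 3\<close> itself.\<close>

definition level :: "nat \<Rightarrow> real" where "level n = C * (mean + 3) * (scale n)\<^sup>2"

lemma powr_sixteenth_le:
  assumes "n \<ge> 1" "0 \<le> x" "x \<le> (mean + 3) * real n"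
  shows "x powr (1/16) \<le> (mean + 3) * (scale n)\<^sup>2"
proof -
  have "x powr (1/16) \<le> ((mean + 3) * real n) powr (1/16)"
    using assms by (intro powr_mono2) auto
  also have "\<dots> = (mean + 3) powr (1/16) * real n powr (1/16)" using mean_ge_1 by (simp add: powr_mult)
  also have "real n powr (1/16) = (scale n)\<^sup>2" using assms by (simp add: scale_def powr_power)
  also have "(mean + 3) powr (1/16) * (scale n)\<^sup>2 \<le> (mean + 3) powr 1 * (scale n)\<^sup>2"
    using mean_ge_1 by (intro mult_right_mono powr_mono) auto
  also have "(mean + 3) powr 1 = mean + 3" using mean_ge_1 by (intro powr_one) simp
  finally show ?thesis .
qed

lemma renewal_scenery_cutoff: "n \<ge> 1 \<Longrightarrow> renewal_scenery p w (cutoff n) (level n)"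
proof
  assume n: "n \<ge> 1"
  show "level n \<ge> 0" using C_nonneg mean_ge_1 by (simp add: level_def)
  fix s t assume st: "s < t" "t \<le> cutoff n"
  have "real t powr (1/16) \<le> (mean + 3) * (scale n)\<^sup>2"
    using st cutoff_bounds(3)[OF n] by (intro powr_sixteenth_le n) auto
  then have "C * real t powr (1/16) * sqrt (real (t - s)) \<le> C * ((mean + 3) * (scale n)\<^sup>2) * sqrt (real (t - s))"
    using C_nonneg by (intro mult_right_mono mult_left_mono) auto
  with regular[OF st(1)] show "\<bar>\<Sum>x\<in>{s<..t}. w x\<bar> \<le> level n * sqrt (real (t - s))"
    by (simp add: level_def mult.assoc)
qed

definition cut :: "nat \<Rightarrow> nat \<Rightarrow> real" where "cut l x = (if x \<le> l then w x else 0)"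

lemma abs_w_le: "x \<ge> 1 \<Longrightarrow> \<bar>w x\<bar> \<le> C * real x powr (1/16)"
proof -
  assume x: "x \<ge> 1"
  then have "{x - 1<..x} = {x}" by auto
  then show ?thesis using regular[of "x - 1" x] x by simp
qed

text \<open>Steps are at least 1, so visits beyond \<open>l\<close> are to distinct sites; with
  \<open>T\<close> the final position there are at most \<open>T - max s l\<close> of them, each
  with scenery at most \<open>C * T powr (1/16)\<close>.\<close>

lemma far_visits:
  assumes "\<forall>x\<in>set xs. x \<ge> 1"
  shows "\<bar>scenery_sum w s xs - scenery_sum (cut l) s xs\<bar>
     \<le> C * real (s + sum_list xs) powr (1/16) * real (s + sum_list xs - max s l)"
  using assms
proof (induction xs arbitrary: s)
  case Nil
  then show ?case using C_nonneg by simp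
next
  case (Cons x xs)
  let ?T = "s + sum_list (x # xs)"
  have x: "x \<ge> 1" using Cons by simp
  have IH: "\<bar>scenery_sum w (s + x) xs - scenery_sum (cut l) (s + x) xs\<bar>
     \<le> C * real ?T powr (1/16) * real (?T - max (s + x) l)"
  proof -
    have "\<forall>a\<in>set xs. a \<ge> 1" using Cons.prems by simp
    from Cons.IH[OF this, of "s + x"] show ?thesis by (simp only: sum_list.Cons add.assoc)
  qed
  have c0: "0 \<le> C * real ?T powr (1/16)" using C_nonneg by simp
  have "\<bar>w (s + x) - cut l (s + x)\<bar> + \<bar>scenery_sum w (s + x) xs - scenery_sum (cut l) (s + x) xs\<bar>
     \<le> C * real ?T powr (1/16) * real (?T - max s l)"
  proof (cases "s + x \<le> l")
    case True
    then have "max (s + x) l = max s l" using x by auto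
    then show ?thesis using IH True by (simp add: cut_def)
  next
    case False
    have "\<bar>w (s + x) - cut l (s + x)\<bar> \<le> C * real (s + x) powr (1/16)"
      using False abs_w_le[of "s + x"] x by (simp add: cut_def)
    also have "\<dots> \<le> C * real ?T powr (1/16)"
      using C_nonneg by (intro mult_left_mono powr_mono2) auto
    finally have 1: "\<bar>w (s + x) - cut l (s + x)\<bar> \<le> C * real ?T powr (1/16) * 1" by simp
    have "1 + real (?T - max (s + x) l) \<le> real (?T - max s l)" using False x by (simp add: max_def)
    then have "C * real ?T powr (1/16) * (1 + real (?T - max (s + x) l)) \<le> C * real ?T powr (1/16) * real (?T - max s l)"
      using c0 by (intro mult_left_mono) auto
    then show ?thesis using IH 1 by (simp only: distrib_left)
  qed
  moreover have "\<bar>scenery_sum w s (x # xs) - scenery_sum (cut l) s (x # xs)\<bar>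
     \<le> \<bar>w (s + x) - cut l (s + x)\<bar> + \<bar>scenery_sum w (s + x) xs - scenery_sum (cut l) (s + x) xs\<bar>"
    unfolding scenery_sum.simps by linarith
  ultimately show ?case by (rule order_trans[rotated])
qed

text \<open>A walk past the cutoff has deviation \<open>D \<ge> r ^ 24\<close>, and the scenery
  found there is of order \<open>D powr (9/8)\<close>. The lower bound on \<open>D\<close> turns
  this into \<open>D^2 / r ^ 21\<close>, which is integrated by the variance of
  \<open>S_n\<close>.\<close>

lemma far_visits_le:
  assumes n: "n \<ge> 1" and xs: "\<forall>x\<in>set xs. x \<ge> 1"
  shows "\<bar>scenery_sum w 0 xs - scenery_sum (cut (cutoff n)) 0 xs\<bar>
     \<le> C * (mean + 3) * (real (sum_list xs) - real n * mean)\<^sup>2 / scale n ^ 21"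
proof (cases "sum_list xs \<le> cutoff n")
  case True
  then have "\<bar>scenery_sum w 0 xs - scenery_sum (cut (cutoff n)) 0 xs\<bar> \<le> 0"
    using far_visits[OF xs, of 0 "cutoff n"] by simp
  also have "0 \<le> C * (mean + 3) * (real (sum_list xs) - real n * mean)\<^sup>2 / scale n ^ 21"
    using C_nonneg mean_ge_1 scale_ge_1[OF n] by simp
  finally show ?thesis .
next
  case False
  define S where "S = real (sum_list xs)"
  define D where "D = S - real n * mean"
  define r where "r = scale n"
  \<comment> \<open>The eighth root makes all exponents integers: \<open>D = q ^ 8\<close>,
    \<open>q \<ge> r ^ 3\<close>, and so \<open>q ^ 9 * r ^ 21 \<le> q ^ 16 = D^2\<close>.\<close>
  define q where "q = D powr (1/8)"
  have r: "r \<ge> 1" using scale_ge_1[OF n] by (simp add: r_def)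
  have m0: "real n * mean \<ge> 0" using mean_ge_1 by simp
  have Dr: "D \<ge> r ^ 24"
    using False cutoff_bounds(1)[OF n] by (simp add: D_def S_def r_def)
  then have D1: "D \<ge> 1" using r one_le_power[of r 24] by linarith
  have q8: "q ^ 8 = D" unfolding q_def using D1 by (subst powr_power) (auto simp: powr_one)
  have q0: "q > 0" using D1 by (simp add: q_def)
  have qr: "q \<ge> r ^ 3"
  proof (rule ccontr)
    assume "\<not> q \<ge> r ^ 3"
    then have "q ^ 8 < (r ^ 3) ^ 8" using q0 by (intro power_strict_mono) auto
    then show False using q8 Dr by (simp add: power_mult[symmetric])
  qed
  have DD: "D \<le> D\<^sup>2" using D1 by (simp add: power2_eq_square)
  \<comment> \<open>Past the cutoff \<open>D^2\<close> dominates \<open>n\<close>; hence the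
    position is at most a multiple of \<open>D^2\<close>, and its 16th root at most a multiple of
    \<open>q\<close>.\<close>
  have "real n \<le> D\<^sup>2"
  proof -
    have "real n = r ^ 32" using scale_power[OF n] by (simp add: r_def)
    also have "\<dots> \<le> (r ^ 24)\<^sup>2" using r by (simp add: power_mult[symmetric] power_increasing)
    also have "\<dots> \<le> D\<^sup>2" using Dr r by (intro power_mono) auto
    finally show ?thesis .
  qed
  then have "mean * real n \<le> mean * D\<^sup>2" using mean_ge_1 by (intro mult_left_mono) auto
  moreover have "S = mean * real n + D" by (simp add: D_def)
  ultimately have "S \<le> mean * D\<^sup>2 + D\<^sup>2" using DD by linarith
  also have "\<dots> \<le> (mean + 3) * D\<^sup>2" by (simp add: distrib_right)
  finally have "S powr (1/16) \<le> ((mean + 3) * D\<^sup>2) powr (1/16)"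
    by (intro powr_mono2) (auto simp: S_def)
  also have "\<dots> = (mean + 3) powr (1/16) * q"
    using mean_ge_1 D1 by (simp add: powr_mult q_def powr_powr flip: powr_numeral)
  also have "\<dots> \<le> (mean + 3) powr 1 * q"
    using mean_ge_1 q0 by (intro mult_right_mono powr_mono) auto
  finally have S16: "S powr (1/16) \<le> (mean + 3) * q" using mean_ge_1 by simp
  have over: "real (sum_list xs - cutoff n) \<le> D"
  proof -
    have "real (sum_list xs - cutoff n) = S - real (cutoff n)"
      using False by (simp add: S_def of_nat_diff)
    then show ?thesis using cutoff_bounds(1)[OF n] one_le_power[OF r, of 24] unfolding D_def r_def by linarith
  qed
  have "\<bar>scenery_sum w 0 xs - scenery_sum (cut (cutoff n)) 0 xs\<bar> \<le> C * (S powr (1/16)) * real (sum_list xs - cutoff n)"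
    using far_visits[OF xs, of 0 "cutoff n"] by (simp add: S_def)
  also have "\<dots> \<le> C * ((mean + 3) * q) * D"
    using C_nonneg mean_ge_1 q0 by (intro mult_mono S16 over mult_left_mono) auto
  also have "\<dots> = C * (mean + 3) * (q ^ 9)" using q8 by (simp add: mult.assoc power_Suc[symmetric] flip: q8)
  also have "\<dots> \<le> C * (mean + 3) * (D\<^sup>2 / r ^ 21)"
  proof (rule mult_left_mono)
    have "q ^ 9 * r ^ 21 = q ^ 9 * (r ^ 3) ^ 7" by (simp add: power_mult[symmetric])
    also have "\<dots> \<le> q ^ 9 * q ^ 7" using qr q0 r by (intro mult_left_mono power_mono) auto
    also have "\<dots> = D\<^sup>2" by (simp add: q8[symmetric] power_mult[symmetric] power_add[symmetric])
    finally show "q ^ 9 \<le> D\<^sup>2 / r ^ 21" using r by (simp add: pos_le_divide_eq)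
  qed (use C_nonneg mean_ge_1 in simp)
  finally show ?thesis by (simp add: D_def S_def r_def)
qed

text \<open>From \<open>n * step_variance / scale n ^ 21\<close> with
  \<open>n = scale n ^ 32\<close>: of order \<open>n powr (11/32)\<close>, below
  \<open>sqrt n\<close>.\<close>

definition far_error :: "nat \<Rightarrow> real" where
  "far_error n = C * (mean + 3) * step_variance * scale n ^ 11"

lemma far_expectation:
  assumes n: "n \<ge> 1"
  shows "integrable (replicate_pmf n p) (\<lambda>xs. scenery_sum w 0 xs - scenery_sum (cut (cutoff n)) 0 xs)"
    and "expect (replicate_pmf n p) (\<lambda>xs. \<bar>scenery_sum w 0 xs - scenery_sum (cut (cutoff n)) 0 xs\<bar>) \<le> far_error n"
proof -
  let ?f = "\<lambda>xs. scenery_sum w 0 xs - scenery_sum (cut (cutoff n)) 0 xs"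
  let ?g = "\<lambda>xs. C * (mean + 3) * (real (sum_list xs) - real n * mean)\<^sup>2 / scale n ^ 21"
  have int: "integrable (replicate_pmf n p) ?g"
    using integrable_sum_variance[of n] by simp
  have AE: "AE xs in replicate_pmf n p. \<bar>?f xs\<bar> \<le> ?g xs"
    unfolding AE_measure_pmf_iff
  proof
    fix xs assume "xs \<in> set_pmf (replicate_pmf n p)"
    then have "set xs \<subseteq> set_pmf p" by (auto simp: set_replicate_pmf lists_eq_set)
    then have "\<forall>x\<in>set xs. x \<ge> 1" using step_pos by (metis One_nat_def Suc_leI gr0I subsetD)
    then show "\<bar>?f xs\<bar> \<le> ?g xs" by (rule far_visits_le[OF n])
  qed
  show int': "integrable (replicate_pmf n p) ?f"
  proof (rule Bochner_Integration.integrable_bound[OF int])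
    show "AE xs in replicate_pmf n p. norm (?f xs) \<le> norm (?g xs)"
      using AE unfolding real_norm_def by eventually_elim (rule order_trans[OF _ abs_ge_self])
  qed simp
  have "expect (replicate_pmf n p) (\<lambda>xs. \<bar>?f xs\<bar>) \<le> expect (replicate_pmf n p) ?g"
    using int int' AE by (intro integral_mono_AE) auto
  also have "\<dots> = C * (mean + 3) * (real n * step_variance) / scale n ^ 21"
    by (simp add: sum_variance)
  also have "\<dots> = far_error n"
    using scale_ge_1[OF n] by (simp add: far_error_def scale_power[OF n, symmetric] field_simps flip: power_add)
  finally show "expect (replicate_pmf n p) (\<lambda>xs. \<bar>?f xs\<bar>) \<le> far_error n" .
qed

lemma site_eq_cut: "n \<ge> 1 \<Longrightarrow> renewal_scenery.site w (cutoff n) = cut (cutoff n)"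
  by (simp add: fun_eq_iff cut_def renewal_scenery.site_def[OF renewal_scenery_cutoff])

lemma gap_bound:
  assumes n: "n \<ge> 1"
  shows "renewal_scenery.gap p (cutoff n) n \<le> (4 + step_variance) * scale n ^ 24"
    and "renewal_scenery.sqrt_gap p (cutoff n) n \<le> (5 + step_variance) * scale n ^ 12"
proof -
  interpret S: renewal_scenery p w "cutoff n" "level n" by (rule renewal_scenery_cutoff[OF n])
  define r where "r = scale n"
  have r: "r \<ge> 1" using scale_ge_1[OF n] by (simp add: r_def)
  \<comment> \<open>Used in place of Jensen's inequality, with \<open>a\<close> of the expected size
    of \<open>x\<close>: \<open>r ^ 16\<close>, that is \<open>sqrt n\<close>, for the fluctuation,
    and \<open>r ^ 12\<close> for the square root of the gap.\<close>
  have am: "x \<le> a + x\<^sup>2 / a" if "a > 0" for x a :: real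
  proof -
    have "2 * (x * a) \<le> x\<^sup>2 + a\<^sup>2" using sum_squares_bound[of x a] by (simp add: mult.assoc)
    then have "x * a \<le> a * a + x * x"
      using zero_le_power2[of x] zero_le_power2[of a] unfolding power2_eq_square by linarith
    then show ?thesis using that by (simp add: field_simps power2_eq_square)
  qed
  let ?q = "replicate_pmf n p"
  let ?D = "\<lambda>xs. real (sum_list xs) - real n * mean"
  have "S.gap n \<le> expect ?q (\<lambda>xs. 4 * r ^ 24 + (?D xs)\<^sup>2 / r ^ 16)"
    unfolding S.gap_def
  proof (rule integral_mono)
    fix xs
    have 1: "real (cutoff n - sum_list xs) \<le> 3 * r ^ 24 + \<bar>?D xs\<bar>"
    proof (cases "sum_list xs \<le> cutoff n")
      case True
      then have "real (cutoff n - sum_list xs) = real (cutoff n) - real (sum_list xs)" by simp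
      then show ?thesis using cutoff_bounds(2)[OF n] unfolding r_def by linarith
    qed (use r in simp)
    moreover have "\<bar>?D xs\<bar> \<le> r ^ 16 + (?D xs)\<^sup>2 / r ^ 16" using am[of "r ^ 16" "\<bar>?D xs\<bar>"] r by simp
    moreover have "r ^ 16 \<le> r ^ 24" using r by (intro power_increasing) auto
    ultimately show "real (cutoff n - sum_list xs) \<le> 4 * r ^ 24 + (?D xs)\<^sup>2 / r ^ 16" by linarith
  qed (use integrable_sum_variance[of n] in auto)
  also have "\<dots> = 4 * r ^ 24 + real n * step_variance / r ^ 16"
    using integrable_sum_variance[of n] by (simp add: sum_variance)
  also have "real n * step_variance / r ^ 16 = step_variance * r ^ 16"
    using r by (simp add: scale_power[OF n, symmetric] r_def[symmetric] field_simps flip: power_add)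
  also have "\<dots> \<le> step_variance * r ^ 24"
    using r by (intro mult_left_mono power_increasing step_variance_nonneg) auto
  finally show gap: "S.gap n \<le> (4 + step_variance) * scale n ^ 24" by (simp add: r_def algebra_simps)
  have "S.sqrt_gap n \<le> expect ?q (\<lambda>xs. r ^ 12 + real (cutoff n - sum_list xs) / r ^ 12)"
    unfolding S.sqrt_gap_def
  proof (rule integral_mono)
    fix xs
    show "sqrt (real (cutoff n - sum_list xs)) \<le> r ^ 12 + real (cutoff n - sum_list xs) / r ^ 12"
      using am[of "r ^ 12" "sqrt (real (cutoff n - sum_list xs))"] r by simp
  qed auto
  also have "\<dots> = r ^ 12 + S.gap n / r ^ 12" by (simp add: S.gap_def)
  also have "\<dots> \<le> r ^ 12 + (4 + step_variance) * r ^ 24 / r ^ 12"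
    using gap r by (intro add_left_mono divide_right_mono) (auto simp: r_def)
  also have "\<dots> = (5 + step_variance) * scale n ^ 12"
    using r by (simp add: r_def[symmetric] field_simps flip: power_add)
  finally show "S.sqrt_gap n \<le> (5 + step_variance) * scale n ^ 12" .
qed

lemma tendsto_const_over_scale: "k > 0 \<Longrightarrow> (\<lambda>n. c / scale n ^ k) \<longlonglongrightarrow> 0"
  by (intro tendsto_divide_0[OF tendsto_const] filterlim_at_top_imp_at_infinity filterlim_pow_at_top scale_at_top)

text \<open>All errors as negative powers of \<open>r = scale n\<close>: \<open>sqrt n\<close> is
  \<open>r ^ 16\<close>, and \<open>C0 * level n\<close> is \<open>L * r^2\<close>. The factor 2 in
  the first two terms arises because they enter once through the characteristic function and once
  through the centring.\<close>

definition gauss_error :: "real \<Rightarrow> real \<Rightarrow> real" where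
  "gauss_error t r = (let L = renewal_scenery.C0 p * (C * (mean + 3)) in
     2 * \<bar>t\<bar> * (C * (mean + 3) * step_variance) / r ^ 5
     + 2 * \<bar>t\<bar> * L * (5 + step_variance) / r ^ 2
     + \<bar>t\<bar> ^ 3 * L ^ 3 * second_moment / r ^ 10
     + t ^ 4 * (L\<^sup>2 * mean * renewal_scenery.C0 p)\<^sup>2 * second_moment / r ^ 24
     + \<bar>t\<bar> ^ 3 * (L * (L\<^sup>2 * mean * renewal_scenery.C0 p)) * second_moment / r ^ 10
     + t\<^sup>2 * (L\<^sup>2 * mean) * (4 + step_variance) / r ^ 4)"

lemma gauss_error_tendsto: "(\<lambda>n. gauss_error t (scale n)) \<longlonglongrightarrow> 0"
  unfolding gauss_error_def Let_def
  by (intro tendsto_add_zero tendsto_const_over_scale) auto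

text \<open>Three comparisons at \<open>\<theta> = t / sqrt n\<close>: the scenery against the
  cut-off one, the cut-off walk against \<open>psi \<theta> 0\<close>, and \<open>\<mu>\<close>
  against \<open>future 0\<close>. The phase of the centring cancels that of \<open>psi\<close>,
  which leaves the Gaussian factor.\<close>

lemma char_quenched_estimate:
  assumes n: "n \<ge> 1"
  defines "\<mu> \<equiv> expect (replicate_pmf n p) (scenery_sum w 0)"
  shows "norm (expect (replicate_pmf n p) (\<lambda>xs. iexp (t * ((scenery_sum w 0 xs - \<mu>) / sqrt (real n))))
     - exp (- (t\<^sup>2 * (renewal_scenery.variance_left p w (cutoff n) 0 / real n) / 2)))
    \<le> gauss_error t (scale n)"
proof -
  interpret S: renewal_scenery p w "cutoff n" "level n" by (rule renewal_scenery_cutoff[OF n])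
  let ?q = "replicate_pmf n p"
  let ?Z = "scenery_sum w 0" and ?Y = "scenery_sum S.site 0"
  define r where "r = scale n"
  have r: "r \<ge> 1" using scale_ge_1[OF n] by (simp add: r_def)
  have rn: "real n = r ^ 32" using scale_power[OF n] by (simp add: r_def)
  have r2: "(r ^ 16)\<^sup>2 = r ^ 32" by (simp add: power_mult[symmetric])
  define \<theta> where "\<theta> = t / r ^ 16"
  have site: "S.site = cut (cutoff n)" by (rule site_eq_cut[OF n])
  define E where "E = exp (- (\<theta>\<^sup>2 * S.variance_left 0 / 2))"
  have intY: "integrable ?q ?Y" by simp
  have intd: "integrable ?q (\<lambda>xs. ?Z xs - ?Y xs)" unfolding site by (rule far_expectation[OF n])
  have intZ: "integrable ?q ?Z" using Bochner_Integration.integrable_add[OF intd intY] by simp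
  have far: "expect ?q (\<lambda>xs. \<bar>?Z xs - ?Y xs\<bar>) \<le> far_error n"
    unfolding site by (rule far_expectation[OF n])
  have inte: "complex_integrable ?q (\<lambda>xs. iexp (\<theta> * f xs))" for f
    by (rule measure_pmf.integrable_const_bound[where B = 1]) auto
  have 1: "norm (expect ?q (\<lambda>xs. iexp (\<theta> * ?Z xs)) - expect ?q (\<lambda>xs. iexp (\<theta> * ?Y xs)))
     \<le> \<bar>\<theta>\<bar> * far_error n"
  proof -
    have "norm (expect ?q (\<lambda>xs. iexp (\<theta> * ?Z xs)) - expect ?q (\<lambda>xs. iexp (\<theta> * ?Y xs)))
      = norm (expect ?q (\<lambda>xs. iexp (\<theta> * ?Z xs) - iexp (\<theta> * ?Y xs)))"
      by (simp only: Bochner_Integration.integral_diff[OF inte inte])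
    also have "\<dots> \<le> expect ?q (\<lambda>xs. norm (iexp (\<theta> * ?Z xs) - iexp (\<theta> * ?Y xs)))"
      by (rule integral_norm_bound)
    also have "\<dots> \<le> expect ?q (\<lambda>xs. \<bar>\<theta>\<bar> * \<bar>?Z xs - ?Y xs\<bar>)"
    proof (rule integral_mono)
      show "integrable ?q (\<lambda>xs. norm (iexp (\<theta> * ?Z xs) - iexp (\<theta> * ?Y xs)))"
        by (intro integrable_norm Bochner_Integration.integrable_diff inte)
      show "integrable ?q (\<lambda>xs. \<bar>\<theta>\<bar> * \<bar>?Z xs - ?Y xs\<bar>)"
        by (intro integrable_mult_right integrable_abs intd)
      show "norm (iexp (\<theta> * ?Z xs) - iexp (\<theta> * ?Y xs)) \<le> \<bar>\<theta>\<bar> * \<bar>?Z xs - ?Y xs\<bar>" for xs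
        using norm_iexp_diff_le[of "\<theta> * ?Z xs" "\<theta> * ?Y xs"] by (simp only: right_diff_distrib[symmetric] abs_mult)
    qed
    also have "\<dots> = \<bar>\<theta>\<bar> * expect ?q (\<lambda>xs. \<bar>?Z xs - ?Y xs\<bar>)"
      by (rule integral_mult_right_zero)
    also have "\<dots> \<le> \<bar>\<theta>\<bar> * far_error n" by (intro mult_left_mono far) simp
    finally show ?thesis .
  qed
  have 2: "norm (expect ?q (\<lambda>xs. iexp (\<theta> * ?Y xs)) - S.psi \<theta> 0)
    \<le> real n * S.step_error \<theta> + \<bar>\<theta>\<bar> * (S.C0 * level n) * S.sqrt_gap n + \<theta>\<^sup>2 * S.var_bound * S.gap n"
    by (rule S.char_estimate)
  have mu: "\<bar>\<mu> - S.future 0\<bar> \<le> far_error n + S.C0 * level n * S.sqrt_gap n"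
  proof -
    have "\<mu> - expect ?q ?Y = expect ?q (\<lambda>xs. ?Z xs - ?Y xs)"
      unfolding \<mu>_def by (rule Bochner_Integration.integral_diff[OF intZ intY, symmetric])
    then have "\<bar>\<mu> - expect ?q ?Y\<bar> \<le> expect ?q (\<lambda>xs. \<bar>?Z xs - ?Y xs\<bar>)"
      using integral_abs_bound[of ?q "\<lambda>xs. ?Z xs - ?Y xs"] by simp
    then show ?thesis using far S.mean_estimate[of n] by linarith
  qed
  have 3: "norm (iexp (- (\<theta> * \<mu>)) * S.psi \<theta> 0 - E) \<le> \<bar>\<theta>\<bar> * (far_error n + S.C0 * level n * S.sqrt_gap n)"
  proof -
    have "iexp (- (\<theta> * \<mu>)) * S.psi \<theta> 0 - E = (iexp (\<theta> * S.future 0 - \<theta> * \<mu>) - 1) * E"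
      using iexp_add[of "- (\<theta> * \<mu>)" "\<theta> * S.future 0"]
      by (simp add: S.psi_def E_def left_diff_distrib algebra_simps)
    also have "norm \<dots> \<le> \<bar>\<theta> * S.future 0 - \<theta> * \<mu>\<bar> * 1"
      unfolding norm_mult
    proof (rule mult_mono)
      show "norm (iexp (\<theta> * S.future 0 - \<theta> * \<mu>) - 1) \<le> \<bar>\<theta> * S.future 0 - \<theta> * \<mu>\<bar>"
        using norm_iexp_diff_le[of "\<theta> * S.future 0 - \<theta> * \<mu>" 0] by simp
      show "norm (complex_of_real E) \<le> 1" using S.variance_left_nonneg[of 0] by (simp add: E_def)
    qed auto
    also have "\<dots> = \<bar>\<theta>\<bar> * \<bar>\<mu> - S.future 0\<bar>"
      by (simp only: right_diff_distrib[symmetric] abs_mult mult_1_right abs_minus_commute)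
    also have "\<dots> \<le> \<bar>\<theta>\<bar> * (far_error n + S.C0 * level n * S.sqrt_gap n)"
      by (intro mult_left_mono mu) simp
    finally show ?thesis .
  qed
  have lhs: "expect ?q (\<lambda>xs. iexp (t * ((?Z xs - \<mu>) / sqrt (real n))))
     = iexp (- (\<theta> * \<mu>)) * expect ?q (\<lambda>xs. iexp (\<theta> * ?Z xs))"
  proof -
    have "iexp (t * ((?Z xs - \<mu>) / sqrt (real n))) = iexp (- (\<theta> * \<mu>)) * iexp (\<theta> * ?Z xs)" for xs
    proof -
      have "t * ((?Z xs - \<mu>) / sqrt (real n)) = - (\<theta> * \<mu>) + \<theta> * ?Z xs"
        using sqrt_scale[OF n] r by (simp add: \<theta>_def r_def[symmetric] field_simps)
      then show ?thesis by (simp only: iexp_add)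
    qed
    then show ?thesis by (simp only: integral_mult_right_zero)
  qed
  have E: "exp (- (t\<^sup>2 * (S.variance_left 0 / real n) / 2)) = E"
    by (simp add: E_def \<theta>_def power_divide rn r2)
  let ?u = "iexp (- (\<theta> * \<mu>))"
  let ?EZ = "expect ?q (\<lambda>xs. iexp (\<theta> * ?Z xs))"
    and ?EY = "expect ?q (\<lambda>xs. iexp (\<theta> * ?Y xs))"
  have "norm (?u * ?EZ - E) \<le> norm (?u * (?EZ - ?EY)) + norm (?u * (?EY - S.psi \<theta> 0)) + norm (?u * S.psi \<theta> 0 - E)"
  proof -
    have eq: "?u * ?EZ - E = ?u * (?EZ - ?EY) + ?u * (?EY - S.psi \<theta> 0) + (?u * S.psi \<theta> 0 - E)"
      by (simp only: right_diff_distrib) simp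
    show ?thesis unfolding eq by (rule order_trans[OF norm_triangle_ineq add_right_mono[OF norm_triangle_ineq]])
  qed
  also have "\<dots> = norm (?EZ - ?EY) + norm (?EY - S.psi \<theta> 0) + norm (?u * S.psi \<theta> 0 - E)"
    by (simp only: norm_mult norm_exp_i_times mult_1)
  also have "\<dots> \<le> 2 * (\<bar>\<theta>\<bar> * far_error n) + 2 * (\<bar>\<theta>\<bar> * (S.C0 * level n) * S.sqrt_gap n)
      + real n * S.step_error \<theta> + \<theta>\<^sup>2 * S.var_bound * S.gap n"
    using 1 2 3 by (simp only: distrib_left mult.assoc)
  also have "\<dots> \<le> 2 * (\<bar>\<theta>\<bar> * far_error n) + 2 * (\<bar>\<theta>\<bar> * (S.C0 * level n) * ((5 + step_variance) * r ^ 12))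
      + real n * S.step_error \<theta> + \<theta>\<^sup>2 * S.var_bound * ((4 + step_variance) * r ^ 24)"
    using gap_bound[OF n] S.C0_ge_1 S.K_nonneg S.var_bound_nonneg
    by (intro add_mono mult_left_mono order_refl) (auto simp: r_def)
  also have "\<dots> = gauss_error t r"
  proof -
    define L where "L = S.C0 * (C * (mean + 3))"
    have lev: "S.C0 * level n = L * r\<^sup>2" by (simp add: L_def level_def r_def)
    have vb: "S.var_bound = L\<^sup>2 * mean * r ^ 4"
      unfolding S.var_bound_def lev by (simp add: power_mult_distrib power_mult[symmetric])
    have th: "\<bar>\<theta>\<bar> = \<bar>t\<bar> / r ^ 16" "\<theta>\<^sup>2 = t\<^sup>2 / r ^ 32" "\<theta> ^ 4 = t ^ 4 / r ^ 64" "\<bar>\<theta>\<bar> ^ 3 = \<bar>t\<bar> ^ 3 / r ^ 48"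
      using r by (simp_all add: \<theta>_def power_divide power_mult[symmetric])
    have c1: "(a / r ^ 16) * (b * r ^ 11) = a * b / r ^ 5" for a b
      using r by (simp add: field_simps flip: power_add)
    have c2: "(a / r ^ 16) * (b * r\<^sup>2) * (c * r ^ 12) = a * b * c / r ^ 2" for a b c
      using r by (simp add: field_simps flip: power_add)
    have c3: "r ^ 32 * (a / r ^ 48 * (b * r\<^sup>2) ^ 3) = a * b ^ 3 / r ^ 10" for a b
      using r by (simp add: power_mult_distrib power_mult[symmetric] field_simps flip: power_add)
    have c4: "r ^ 32 * (a / r ^ 64 * (b * r ^ 4 * c)\<^sup>2) = a * (b * c)\<^sup>2 / r ^ 24" for a b c
      using r by (simp add: power_mult_distrib power_mult[symmetric] field_simps flip: power_add)
    have c5: "r ^ 32 * (a / r ^ 48 * (b * r\<^sup>2 * (c * r ^ 4 * d))) = a * (b * (c * d)) / r ^ 10" for a b c d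
      using r by (simp add: field_simps flip: power_add)
    have c6: "(a / r ^ 32) * (b * r ^ 4) * (c * r ^ 24) = a * b * c / r ^ 4" for a b c
      using r by (simp add: field_simps flip: power_add)
    have dist: "x * ((a + b + c) * y) = (x * a + x * b + x * c) * y" for a b c x y :: real
      by (simp add: algebra_simps)
    have se: "real n * S.step_error \<theta> = (r ^ 32 * (\<bar>\<theta>\<bar> ^ 3 * (L * r\<^sup>2) ^ 3)
       + r ^ 32 * (\<theta> ^ 4 * (L\<^sup>2 * mean * r ^ 4 * S.C0)\<^sup>2)
       + r ^ 32 * (\<bar>\<theta>\<bar> ^ 3 * (L * r\<^sup>2 * (L\<^sup>2 * mean * r ^ 4 * S.C0)))) * second_moment"
      unfolding S.step_error_def lev vb rn by (rule dist)
    show ?thesis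
      unfolding se unfolding th(4) unfolding lev vb th far_error_def r_def[symmetric] c1 c2 c3 c4 c5 c6 gauss_error_def Let_def L_def[symmetric]
      by (simp add: add_divide_distrib distrib_left distrib_right mult_ac)
  qed
  finally have "norm (?u * ?EZ - E) \<le> gauss_error t r" .
  then show ?thesis unfolding lhs E r_def .
qed

lemma char_quenched_limit:
  assumes V: "(\<lambda>n. renewal_scenery.variance_left p w (cutoff n) 0 / real n) \<longlonglongrightarrow> v"
  shows "(\<lambda>n. expect (replicate_pmf n p)
      (\<lambda>xs. iexp (t * ((scenery_sum w 0 xs - expect (replicate_pmf n p) (scenery_sum w 0)) / sqrt (real n)))))
    \<longlonglongrightarrow> exp (- (t\<^sup>2 * v / 2))" (is "?f \<longlonglongrightarrow> _")
proof -
  let ?g = "\<lambda>n. complex_of_real (exp (- (t\<^sup>2 * (renewal_scenery.variance_left p w (cutoff n) 0 / real n) / 2)))"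
  have "(\<lambda>n. ?f n - ?g n) \<longlonglongrightarrow> 0"
    by (rule Lim_null_comparison[OF _ gauss_error_tendsto[of t]])
      (rule eventually_sequentiallyI[of 1], rule char_quenched_estimate)
  moreover have "?g \<longlonglongrightarrow> complex_of_real (exp (- (t\<^sup>2 * v / 2)))"
    by (intro tendsto_of_real tendsto_exp tendsto_intros V) auto
  ultimately have "(\<lambda>n. (?f n - ?g n) + ?g n) \<longlonglongrightarrow> 0 + complex_of_real (exp (- (t\<^sup>2 * v / 2)))"
    by (rule tendsto_add)
  then show ?thesis by simp
qed

text \<open>The variance is the centred form plus its mean \<open>U\<close>, both taken at
  \<open>cutoff n\<close>, which is asymptotic to \<open>n * mean\<close>. This factor
  \<open>mean\<close> turns the density \<open>1 / mean * (1 - 1 / mean)\<close> per site into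
  \<open>1 - 1 / mean\<close> per step.\<close>

lemma variance_limit:
  assumes Q: "(\<lambda>n. (\<Sum>y\<in>{1..n}. ((w y)\<^sup>2 - 1) * (renewal p y * (1 - renewal p y))
      + 2 * (w y * (\<Sum>x\<in>{1..<y}. renewal p x * (renewal p (y - x) - renewal p y) * w x))) / real n) \<longlonglongrightarrow> 0"
    (is "(\<lambda>n. ?Q n / real n) \<longlonglongrightarrow> 0")
  shows "(\<lambda>n. renewal_scenery.variance_left p w (cutoff n) 0 / real n) \<longlonglongrightarrow> 1 - 1 / mean"
proof -
  define U where "U l = (\<Sum>x\<in>{1..l}. renewal p x * (1 - renewal p x))" for l
  have split: "renewal_scenery.variance_left p w (cutoff n) 0 = ?Q (cutoff n) + U (cutoff n)" if n: "n \<ge> 1" for n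
  proof -
    interpret S: renewal_scenery p w "cutoff n" "level n" by (rule renewal_scenery_cutoff[OF n])
    have 1: "(\<Sum>x\<in>{1..l}. (w x)\<^sup>2 * (renewal p x * (1 - renewal p x)))
      = (\<Sum>x\<in>{1..l}. ((w x)\<^sup>2 - 1) * (renewal p x * (1 - renewal p x))) + U l" for l
      unfolding U_def sum.distrib[symmetric] by (simp only: left_diff_distrib mult_1 diff_add_cancel)
    have 2: "(\<Sum>x\<in>{1..<y}. w x * (renewal p x * (renewal p (y - x) - renewal p y)))
       = (\<Sum>x\<in>{1..<y}. renewal p x * (renewal p (y - x) - renewal p y) * w x)" for y
      by (simp only: mult.commute)
    show ?thesis unfolding S.variance_left_quadratic 1 2 sum.distrib sum_distrib_left by simp
  qed
  have ratio: "(\<lambda>n. real (cutoff n) / real n) \<longlonglongrightarrow> mean"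
  proof (rule tendsto_sandwich)
    show "\<forall>\<^sub>F n in sequentially. mean \<le> real (cutoff n) / real n"
    proof (rule eventually_sequentiallyI)
      fix n :: nat assume n: "1 \<le> n"
      have "real n * mean \<le> real (cutoff n)"
        using cutoff_bounds(1)[OF n] one_le_power[OF scale_ge_1[OF n], of 24] by linarith
      then show "mean \<le> real (cutoff n) / real n" using n by (simp add: field_simps)
    qed
    show "\<forall>\<^sub>F n in sequentially. real (cutoff n) / real n \<le> mean + 3 / scale n ^ 8"
    proof (rule eventually_sequentiallyI)
      fix n :: nat assume n: "1 \<le> n"
      have "real (cutoff n) / real n \<le> (real n * mean + 3 * scale n ^ 24) / real n"
        by (intro divide_right_mono cutoff_bounds(2)[OF n]) simp
      also have "\<dots> = mean + 3 * scale n ^ 24 / scale n ^ 32"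
        using n by (simp add: add_divide_distrib scale_power[OF n])
      also have "3 * scale n ^ 24 / scale n ^ 32 = 3 / scale n ^ 8"
        using scale_ge_1[OF n] by (simp add: field_simps flip: power_add)
      finally show "real (cutoff n) / real n \<le> mean + 3 / scale n ^ 8" .
    qed
    have "(\<lambda>n. mean + 3 / scale n ^ 8) \<longlonglongrightarrow> mean + 0"
      by (intro tendsto_add tendsto_const tendsto_const_over_scale) simp
    then show "(\<lambda>n. mean + 3 / scale n ^ 8) \<longlonglongrightarrow> mean" by simp
  qed simp
  have cutoff_lim: "filterlim cutoff at_top sequentially"
  proof (rule filterlim_at_top_mono[OF filterlim_ident])
    show "\<forall>\<^sub>F n in sequentially. n \<le> cutoff n"
    proof (rule eventually_sequentiallyI)
      fix n :: nat assume n: "1 \<le> n"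
      have "real n \<le> real n * mean" using mult_left_mono[OF mean_ge_1, of "real n"] by simp
      also have "\<dots> \<le> real (cutoff n)"
        using cutoff_bounds(1)[OF n] one_le_power[OF scale_ge_1[OF n], of 24] by linarith
      finally show "n \<le> cutoff n" by simp
    qed
  qed
  have cpos: "real (cutoff n) > 0" if n: "n \<ge> 1" for n
  proof -
    have "0 \<le> real n * mean" using mean_ge_1 by simp
    then show ?thesis using cutoff_bounds(1)[OF n] one_le_power[OF scale_ge_1[OF n], of 24] by linarith
  qed
  have A: "(\<lambda>n. ?Q (cutoff n) / real (cutoff n) * (real (cutoff n) / real n)) \<longlonglongrightarrow> 0 * mean"
    by (intro tendsto_mult ratio filterlim_compose[OF Q cutoff_lim])
  have Ulim: "(\<lambda>l. U l / real l) \<longlonglongrightarrow> 1 / mean * (1 - 1 / mean)"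
  proof -
    have "(\<lambda>l. U l / real l - 1 / mean * (1 - 1 / mean)) \<longlonglongrightarrow> 0"
    proof (rule Lim_null_comparison)
      show "\<forall>\<^sub>F l in sequentially. norm (U l / real l - 1 / mean * (1 - 1 / mean)) \<le> dev_sum / real l"
      proof (rule eventually_sequentiallyI)
        fix l :: nat assume l: "1 \<le> l"
        have "U l / real l - 1 / mean * (1 - 1 / mean) = (U l - real l * (1 / mean * (1 - 1 / mean))) / real l"
          using l by (simp add: diff_divide_distrib)
        also have "norm \<dots> = \<bar>U l - real l * (1 / mean * (1 - 1 / mean))\<bar> / real l" by (simp add: abs_divide)
        also have "\<dots> \<le> dev_sum / real l"
          unfolding U_def by (intro divide_right_mono sum_renewal_var) simp
        finally show "norm (U l / real l - 1 / mean * (1 - 1 / mean)) \<le> dev_sum / real l" .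
      qed
      show "(\<lambda>l. dev_sum / real l) \<longlonglongrightarrow> 0" by (rule lim_const_over_n)
    qed
    then show ?thesis by (simp only: LIM_zero_iff)
  qed
  have B: "(\<lambda>n. U (cutoff n) / real (cutoff n) * (real (cutoff n) / real n)) \<longlonglongrightarrow> 1 / mean * (1 - 1 / mean) * mean"
    by (intro tendsto_mult ratio filterlim_compose[OF Ulim cutoff_lim])
  have "(\<lambda>n. ?Q (cutoff n) / real (cutoff n) * (real (cutoff n) / real n)
       + U (cutoff n) / real (cutoff n) * (real (cutoff n) / real n)) \<longlonglongrightarrow> 1 - 1 / mean"
    using tendsto_add[OF A B] mean_ge_1 by simp
  then show ?thesis
  proof (rule Lim_transform_eventually)
    show "\<forall>\<^sub>F n in sequentially. ?Q (cutoff n) / real (cutoff n) * (real (cutoff n) / real n)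
       + U (cutoff n) / real (cutoff n) * (real (cutoff n) / real n)
       = renewal_scenery.variance_left p w (cutoff n) 0 / real n"
    proof (rule eventually_sequentiallyI)
      fix n :: nat assume n: "1 \<le> n"
      have "a / real (cutoff n) * (real (cutoff n) / real n) = a / real n" for a
        using cpos[OF n] by simp
      then show "?Q (cutoff n) / real (cutoff n) * (real (cutoff n) / real n)
         + U (cutoff n) / real (cutoff n) * (real (cutoff n) / real n)
         = renewal_scenery.variance_left p w (cutoff n) 0 / real n"
        unfolding split[OF n] by (simp only: add_divide_distrib)
    qed
  qed
qed

end

section \<open>Moments of a random scenery\<close>

lemma sum_even_indices:
  fixes f :: "nat \<Rightarrow> real"
  assumes "\<And>k. odd k \<Longrightarrow> f k = 0"
  shows "(\<Sum>k\<le>2 * n. f k) = (\<Sum>j\<le>n. f (2 * j))"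
  by (induction n) (use assms in auto)

text \<open>Two terms of the binomial expansion are kept. In \<open>linear_form_moment\<close> this
  makes the mixed terms telescope when a variable is added.\<close>

lemma power_add_minus_ge:
  fixes a v :: real
  assumes "a \<ge> 0" "v \<ge> 0" "1 \<le> j" "j \<le> n"
  shows "a ^ j * v ^ (n - j) \<le> (a + v) ^ n - v ^ n"
proof -
  have "(a + v) ^ n = (\<Sum>k\<le>n. real (n choose k) * a ^ k * v ^ (n - k))" by (rule binomial_ring)
  also have "\<dots> \<ge> (\<Sum>k\<in>{0, j}. real (n choose k) * a ^ k * v ^ (n - k))"
    using assms by (intro sum_mono2) auto
  also have "(\<Sum>k\<in>{0, j}. real (n choose k) * a ^ k * v ^ (n - k)) = v ^ n + real (n choose j) * (a ^ j * v ^ (n - j))"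
    using assms by simp
  finally have "v ^ n + real (n choose j) * (a ^ j * v ^ (n - j)) \<le> (a + v) ^ n" .
  moreover have "1 * (a ^ j * v ^ (n - j)) \<le> real (n choose j) * (a ^ j * v ^ (n - j))"
    using assms by (intro mult_right_mono) (auto simp: Suc_le_eq zero_less_binomial_iff)
  ultimately show ?thesis by simp
qed

lemma power_add_le:
  fixes x y :: real
  assumes "x \<ge> 0" "y \<ge> 0"
  shows "(x + y) ^ k \<le> 2 ^ k * (x ^ k + y ^ k)"
proof -
  have "(x + y) ^ k \<le> (2 * max x y) ^ k" using assms by (intro power_mono) auto
  also have "\<dots> = 2 ^ k * (max x y) ^ k" by (simp add: power_mult_distrib)
  also have "\<dots> \<le> 2 ^ k * (x ^ k + y ^ k)"
    using assms by (intro mult_left_mono) (auto simp: max_def)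
  finally show ?thesis .
qed

lemma summable_comparison_test_of_le:
  fixes f g :: "nat \<Rightarrow> real"
  assumes "summable g" "\<And>n. 0 \<le> f n" "\<And>n. f n \<le> g n"
  shows "summable f"
  by (rule summable_comparison_test'[OF assms(1)]) (use assms in auto)

text \<open>By Tonelli the sum has finite expectation. Used instead of the Borel-Cantelli lemma: the
  sum itself supplies a random constant valid for all indices.\<close>

lemma (in prob_space) AE_summable_of_summable_expectation:
  fixes f :: "nat \<Rightarrow> 'a \<Rightarrow> real"
  assumes f: "\<And>n. integrable M (f n)" "\<And>n x. f n x \<ge> 0" and s: "summable (\<lambda>n. expectation (f n))"
  shows "AE x in M. summable (\<lambda>n. f n x)"
proof -
  have [measurable]: "f n \<in> borel_measurable M" for n using f by auto
  have "(\<integral>\<^sup>+x. (\<Sum>n. ennreal (f n x)) \<partial>M) = (\<Sum>n. \<integral>\<^sup>+x. ennreal (f n x) \<partial>M)"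
    by (rule nn_integral_suminf) simp
  also have "\<dots> = (\<Sum>n. ennreal (expectation (f n)))"
    using f by (simp add: nn_integral_eq_integral)
  also have "\<dots> = ennreal (\<Sum>n. expectation (f n))"
    using s f by (intro suminf_ennreal2) (auto intro: integral_nonneg)
  finally have "(\<integral>\<^sup>+x. (\<Sum>n. ennreal (f n x)) \<partial>M) \<noteq> \<infinity>" by simp
  then have "AE x in M. (\<Sum>n. ennreal (f n x)) \<noteq> \<infinity>" by (intro nn_integral_PInf_AE) auto
  then show ?thesis
  proof eventually_elim
    case (elim x)
    then show ?case by (intro summable_suminf_not_top) (auto simp: f)
  qed
qed

text \<open>A class closed under sums and products, so that integrability of every polynomial in the
  scenery follows from closure rules.\<close>

definition (in prob_space) all_moments :: "('a \<Rightarrow> real) \<Rightarrow> bool" where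
  "all_moments f \<longleftrightarrow> f \<in> borel_measurable M \<and> (\<forall>k::nat. integrable M (\<lambda>s. \<bar>f s\<bar> ^ k))"

context prob_space
begin

lemma all_moments_bound:
  assumes "f \<in> borel_measurable M" "\<And>k::nat. integrable M (g k)" "\<And>k s. \<bar>f s\<bar> ^ k \<le> g k s"
  shows "all_moments f"
  unfolding all_moments_def
proof (intro conjI allI)
  fix k :: nat
  show "integrable M (\<lambda>s. \<bar>f s\<bar> ^ k)"
  proof (rule Bochner_Integration.integrable_bound[OF assms(2)[of k]])
    have "norm (\<bar>f s\<bar> ^ k) \<le> norm (g k s)" for s using assms(3)[of s k] by simp
    then show "AE s in M. norm (\<bar>f s\<bar> ^ k) \<le> norm (g k s)" by simp
  qed (use assms(1) in measurable)
qed (rule assms)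

lemma all_moments_const [simp]: "all_moments (\<lambda>_. c)"
  by (simp add: all_moments_def)

lemma all_moments_add:
  assumes "all_moments f" "all_moments g"
  shows "all_moments (\<lambda>s. f s + g s)"
proof (rule all_moments_bound[where g = "\<lambda>k s. 2 ^ k * (\<bar>f s\<bar> ^ k + \<bar>g s\<bar> ^ k)"])
  fix k s
  have "\<bar>f s + g s\<bar> ^ k \<le> (\<bar>f s\<bar> + \<bar>g s\<bar>) ^ k" by (intro power_mono) auto
  then show "\<bar>f s + g s\<bar> ^ k \<le> 2 ^ k * (\<bar>f s\<bar> ^ k + \<bar>g s\<bar> ^ k)"
    using power_add_le[of "\<bar>f s\<bar>" "\<bar>g s\<bar>" k] by simp
qed (use assms in \<open>auto simp: all_moments_def\<close>)

lemma all_moments_mult: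
  assumes "all_moments f" "all_moments g"
  shows "all_moments (\<lambda>s. f s * g s)"
proof (rule all_moments_bound[where g = "\<lambda>k s. \<bar>f s\<bar> ^ (2 * k) + \<bar>g s\<bar> ^ (2 * k)"])
  fix k s
  have "2 * (\<bar>f s\<bar> ^ k * \<bar>g s\<bar> ^ k) \<le> (\<bar>f s\<bar> ^ k)\<^sup>2 + (\<bar>g s\<bar> ^ k)\<^sup>2"
    using sum_squares_bound[of "\<bar>f s\<bar> ^ k" "\<bar>g s\<bar> ^ k"] by (simp add: mult.assoc)
  moreover have "\<bar>f s\<bar> ^ k * \<bar>g s\<bar> ^ k \<ge> 0" by simp
  ultimately show "\<bar>f s * g s\<bar> ^ k \<le> \<bar>f s\<bar> ^ (2 * k) + \<bar>g s\<bar> ^ (2 * k)"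
    by (simp only: abs_mult power_mult_distrib power_even_eq)
qed (use assms in \<open>auto simp: all_moments_def\<close>)

lemma all_moments_sum:
  "(\<And>i. i \<in> I \<Longrightarrow> all_moments (f i)) \<Longrightarrow> all_moments (\<lambda>s. \<Sum>i\<in>I. f i s)"
  by (induction I rule: infinite_finite_induct) (auto intro: all_moments_add)

lemma all_moments_power: "all_moments f \<Longrightarrow> all_moments (\<lambda>s. f s ^ k)"
  by (induction k) (auto intro: all_moments_mult)

lemma all_moments_diff: "all_moments f \<Longrightarrow> all_moments g \<Longrightarrow> all_moments (\<lambda>s. f s - g s)"
  using all_moments_add[of f "\<lambda>s. - 1 * g s"] all_moments_mult[of "\<lambda>_. - 1" g] by simp

lemma all_moments_integrable: "all_moments f \<Longrightarrow> integrable M f"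
  unfolding all_moments_def by (elim conjE allE[of _ 1]) (simp add: integrable_abs_iff)

lemmas all_moments_intros = all_moments_const all_moments_add all_moments_mult all_moments_sum
  all_moments_power all_moments_diff

text \<open>A bound of martingale type: orthogonality of \<open>W^3\<close> and the next increment
  removes the term linear in the increment, and what is left gives growth \<open>n^2\<close> instead
  of \<open>n^4\<close>.\<close>

lemma fourth_moment_growth:
  fixes D W :: "nat \<Rightarrow> 'a \<Rightarrow> real"
  assumes D: "\<And>n. all_moments (D n)" and W0: "\<And>s. W 0 s = 0"
    and WS: "\<And>n s. W (Suc n) s = W n s + D (Suc n) s"
    and orth: "\<And>n. expectation (\<lambda>s. W n s ^ 3 * D (Suc n) s) = 0"
    and D4: "\<And>n. expectation (\<lambda>s. D n s ^ 4) \<le> B"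
  shows "expectation (\<lambda>s. W n s ^ 4) \<le> 20 * B * (real n)\<^sup>2"
proof (induction n)
  case 0
  then show ?case by (simp add: W0)
next
  case (Suc n)
  have W: "all_moments (W n)" for n
    by (induction n) (auto simp: W0[abs_def] WS[abs_def] intro!: all_moments_add D)
  have B0: "B \<ge> 0" using D4[of 0] by (rule order_trans[rotated]) simp
  \<comment> \<open>The weight in Young's inequality: with \<open>y = n + 1\<close> one has
    \<open>n^2 (1 + 1 / y) + y \<le> (n + 1)^2\<close>, so the quadratic bound reproduces
    itself.\<close>
  define y where "y = real (Suc n)"
  have y: "y \<ge> 1" by (simp add: y_def)
  have int: "integrable M (\<lambda>s. W n s ^ 4)" "integrable M (\<lambda>s. D (Suc n) s ^ 4)"
    "integrable M (\<lambda>s. W n s ^ 3 * D (Suc n) s)" "integrable M (\<lambda>s. W (Suc n) s ^ 4)"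
    by (intro all_moments_integrable all_moments_intros W D)+
  \<comment> \<open>The term \<open>4 a d^3\<close> is split between \<open>a^2 d^2\<close> and
    \<open>d^4\<close>; the resulting \<open>8 a^2 d^2\<close> is absorbed by \<open>a^4 / y\<close>
    and \<open>16 y d^4\<close>, and the remaining \<open>3 d^4\<close> by \<open>4 y d^4\<close>,
    which gives 20.\<close>
  have pw: "(a + d) ^ 4 \<le> a ^ 4 * (1 + 1 / y) + 4 * (a ^ 3 * d) + 20 * y * d ^ 4" for a d :: real
  proof -
    have "(a + d) ^ 4 = a ^ 4 + 4 * (a ^ 3 * d) + 6 * (a\<^sup>2 * d\<^sup>2) + 4 * (a * d ^ 3) + d ^ 4"
      by (simp add: power4_eq_xxxx power3_eq_cube power2_eq_square algebra_simps)
    moreover have "4 * (a * d ^ 3) \<le> 2 * (a\<^sup>2 * d\<^sup>2) + 2 * d ^ 4"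
    proof -
      have "0 \<le> 2 * d\<^sup>2 * (a - d)\<^sup>2" by simp
      also have "\<dots> = 2 * (a\<^sup>2 * d\<^sup>2) + 2 * d ^ 4 - 4 * (a * d ^ 3)"
        by (simp add: power4_eq_xxxx power3_eq_cube power2_eq_square algebra_simps)
      finally show ?thesis by simp
    qed
    moreover have "8 * (a\<^sup>2 * d\<^sup>2) \<le> a ^ 4 * (1 / y) + 16 * y * d ^ 4"
    proof -
      have "0 \<le> (1 / y) * (a\<^sup>2 - 4 * y * d\<^sup>2)\<^sup>2" using y by simp
      also have "\<dots> = a ^ 4 * (1 / y) + 16 * y * d ^ 4 - 8 * (a\<^sup>2 * d\<^sup>2)"
        using y by (simp add: power2_diff power_mult_distrib) (simp add: field_simps power2_eq_square power4_eq_xxxx)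
      finally show ?thesis by simp
    qed
    moreover have "3 * d ^ 4 \<le> 4 * y * d ^ 4" using y by (intro mult_right_mono) auto
    ultimately show ?thesis by (simp add: distrib_left)
  qed
  have "expectation (\<lambda>s. W (Suc n) s ^ 4)
     \<le> expectation (\<lambda>s. W n s ^ 4 * (1 + 1 / y) + 4 * (W n s ^ 3 * D (Suc n) s) + 20 * y * D (Suc n) s ^ 4)"
    using int by (intro integral_mono) (auto simp only: WS pw intro!: Bochner_Integration.integrable_add integrable_mult_left integrable_mult_right)
  also have "\<dots> = expectation (\<lambda>s. W n s ^ 4) * (1 + 1 / y) + 20 * y * expectation (\<lambda>s. D (Suc n) s ^ 4)"
    using int by (simp add: orth)
  also have "\<dots> \<le> 20 * B * (real n)\<^sup>2 * (1 + 1 / y) + 20 * y * B"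
    using y Suc D4 by (intro add_mono mult_right_mono mult_left_mono) auto
  also have "\<dots> = 20 * B * ((real n)\<^sup>2 * (1 + 1 / y) + y)" by (simp add: algebra_simps)
  also have "\<dots> \<le> 20 * B * y\<^sup>2"
  proof (rule mult_left_mono)
    have "(real n)\<^sup>2 * (1 / y) \<le> real n"
    proof -
      have "(real n)\<^sup>2 \<le> real n * y" by (simp add: y_def power2_eq_square distrib_left)
      then show ?thesis using y by (simp add: divide_le_eq)
    qed
    then show "(real n)\<^sup>2 * (1 + 1 / y) + y \<le> y\<^sup>2"
      by (simp add: y_def power2_eq_square algebra_simps)
  qed (use B0 in simp)
  finally show ?case by (simp add: y_def)
qed

end

section \<open>Symmetric i.i.d. sceneries and moments of linear forms\<close>

locale symmetric_iid = prob_space M for M :: "'a measure" +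
  fixes w :: "nat \<Rightarrow> 'a \<Rightarrow> real"
  assumes w_indep: "indep_vars (\<lambda>_. borel) w UNIV"
    and w_ident: "\<And>x. distr M borel (w x) = distr M borel (w 0)"
    and w_symm: "distr M borel (w 0) = distr M borel (\<lambda>s. - w 0 s)"
    and w_moments: "\<And>k::nat. k \<ge> 1 \<Longrightarrow> integrable M (\<lambda>s. \<bar>w 0 s\<bar> ^ k)"
    and w_var: "expectation (\<lambda>s. (w 0 s)\<^sup>2) = 1"
begin

lemma w_measurable [measurable]: "w x \<in> borel_measurable M"
  using w_indep by (simp add: indep_vars_def)

lemma w_expectation_eq:
  fixes h :: "real \<Rightarrow> real"
  assumes [measurable]: "h \<in> borel_measurable borel"
  shows "expectation (\<lambda>s. h (w x s)) = expectation (\<lambda>s. h (w 0 s))"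
    "integrable M (\<lambda>s. h (w x s)) \<longleftrightarrow> integrable M (\<lambda>s. h (w 0 s))"
proof -
  have "expectation (\<lambda>s. h (w y s)) = integral\<^sup>L (distr M borel (w y)) h" for y
    by (simp add: integral_distr)
  then show "expectation (\<lambda>s. h (w x s)) = expectation (\<lambda>s. h (w 0 s))" using w_ident by metis
  have "integrable M (\<lambda>s. h (w y s)) \<longleftrightarrow> integrable (distr M borel (w y)) h" for y
    by (simp add: integrable_distr_eq)
  then show "integrable M (\<lambda>s. h (w x s)) \<longleftrightarrow> integrable M (\<lambda>s. h (w 0 s))" using w_ident by metis
qed

lemma all_moments_w: "all_moments (w x)"
proof -
  have "integrable M (\<lambda>s. \<bar>w x s\<bar> ^ k)" for k
    using w_expectation_eq(2)[of "\<lambda>t. \<bar>t\<bar> ^ k" x] w_moments[of k] by (cases "k = 0") auto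
  then show ?thesis by (simp add: all_moments_def)
qed

definition moment :: "nat \<Rightarrow> real" where "moment k = expectation (\<lambda>s. w 0 s ^ k)"

lemma moment_eq: "expectation (\<lambda>s. w x s ^ k) = moment k"
  unfolding moment_def by (rule w_expectation_eq(1)) simp

lemma odd_moment: "odd k \<Longrightarrow> moment k = 0"
proof -
  assume "odd k"
  have "moment k = integral\<^sup>L (distr M borel (w 0)) (\<lambda>t. t ^ k)"
    unfolding moment_def by (simp add: integral_distr)
  also have "\<dots> = integral\<^sup>L (distr M borel (\<lambda>s. - w 0 s)) (\<lambda>t. t ^ k)" by (simp only: w_symm)
  also have "\<dots> = expectation (\<lambda>s. (- w 0 s) ^ k)" by (rule integral_distr) auto
  also have "\<dots> = - moment k" using \<open>odd k\<close> by (simp add: moment_def)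
  finally show ?thesis by simp
qed

lemma moment_2: "moment 2 = 1"
  using w_var by (simp add: moment_def)

lemma even_moment_nonneg: "moment (2 * j) \<ge> 0"
  unfolding moment_def by (simp add: power_mult)

lemma expectation_indep_past:
  fixes F :: "(nat \<Rightarrow> real) \<Rightarrow> real" and h :: "real \<Rightarrow> real"
  assumes x: "x \<notin> I" and F: "F \<in> borel_measurable (PiM I (\<lambda>_. borel))"
    and h: "h \<in> borel_measurable borel"
    and int: "integrable M (\<lambda>s. F (\<lambda>i\<in>I. w i s))" "integrable M (\<lambda>s. h (w x s))"
  shows "expectation (\<lambda>s. F (\<lambda>i\<in>I. w i s) * h (w x s)) = expectation (\<lambda>s. F (\<lambda>i\<in>I. w i s)) * expectation (\<lambda>s. h (w x s))"
proof -
  have "indep_var borel (F \<circ> (\<lambda>s. \<lambda>i\<in>I. w i s)) borel ((\<lambda>f. h (f x)) \<circ> (\<lambda>s. \<lambda>i\<in>{x}. w i s))"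
  proof (intro indep_var_compose[OF indep_var_restrict[OF w_indep]] F)
    have "(\<lambda>f. f x) \<in> PiM {x} (\<lambda>_. borel) \<rightarrow>\<^sub>M borel" by (rule measurable_component_singleton) simp
    then show "(\<lambda>f. h (f x)) \<in> borel_measurable (PiM {x} (\<lambda>_. borel))" by (rule measurable_compose[OF _ h])
  qed (use x in auto)
  then show ?thesis
    using indep_var_lebesgue_integral[of "\<lambda>s. F (\<lambda>i\<in>I. w i s)" "\<lambda>s. h (w x s)"] int by (simp add: comp_def)
qed

text \<open>A Khintchine-type inequality: the constant depends on the order only. Within the
  induction over \<open>n\<close>, variables are added one at a time; odd powers of the new one
  vanish by symmetry, and its positive even powers come with lower moments of the old sum.\<close>

lemma linear_form_moment:
  "\<exists>C\<ge>0. \<forall>I a. finite I \<longrightarrow> expectation (\<lambda>s. (\<Sum>i\<in>I. a i * w i s) ^ (2 * n)) \<le> C * (\<Sum>i\<in>I. (a i)\<^sup>2) ^ n"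
proof (induction n rule: less_induct)
  case (less n)
  define P where "P q C \<longleftrightarrow> C \<ge> 0 \<and> (\<forall>I a. finite I \<longrightarrow>
    expectation (\<lambda>s. (\<Sum>i\<in>I. a i * w i s) ^ (2 * q)) \<le> C * (\<Sum>i\<in>I. (a i)\<^sup>2) ^ q)" for q :: nat and C :: real
  have "\<forall>q. q < n \<longrightarrow> (\<exists>C. P q C)" using less unfolding P_def by blast
  then obtain c where c: "\<And>q. q < n \<Longrightarrow> P q (c q)" by metis
  \<comment> \<open>The sum collects the coefficients of the mixed terms, so a new variable costs
    \<open>C - 1\<close> times the growth of the right-hand power; the 1 covers \<open>n = 0\<close>
    on the empty set.\<close>
  define C where "C = 1 + (\<Sum>j\<in>{1..n}. real (2 * n choose (2 * j)) * moment (2 * j) * c (n - j))"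
  have t0: "real (2 * n choose (2 * j)) * moment (2 * j) * c (n - j) \<ge> 0" if "j \<in> {1..n}" for j
    using c[of "n - j"] even_moment_nonneg[of j] that by (simp add: P_def)
  then have C1: "C \<ge> 1" 
  proof -
    have "(\<Sum>j\<in>{1..n}. real (2 * n choose (2 * j)) * moment (2 * j) * c (n - j)) \<ge> 0"
      by (intro sum_nonneg t0)
    then show ?thesis unfolding C_def by linarith
  qed
  have "expectation (\<lambda>s. (\<Sum>i\<in>I. a i * w i s) ^ (2 * n)) \<le> C * (\<Sum>i\<in>I. (a i)\<^sup>2) ^ n" if "finite I" for I a
    using that
  proof (induction I rule: finite_induct)
    case empty
    then show ?case using C1 by (cases n) (auto simp: prob_space)
  next
    case (insert x I)
    define S where "S s = (\<Sum>i\<in>I. a i * w i s)" for s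
    define V where "V = (\<Sum>i\<in>I. (a i)\<^sup>2)"
    have V0: "V \<ge> 0" by (simp add: V_def sum_nonneg)
    have S: "all_moments S" unfolding S_def by (intro all_moments_intros all_moments_w)
    have prod: "expectation (\<lambda>s. S s ^ l * w x s ^ k) = expectation (\<lambda>s. S s ^ l) * moment k" for k l
    proof -
      let ?F = "\<lambda>f. (\<Sum>i\<in>I. a i * f i) ^ l"
      have "?F \<in> borel_measurable (PiM I (\<lambda>_. borel))"
        by (intro borel_measurable_power borel_measurable_sum borel_measurable_times borel_measurable_const measurable_component_singleton)
      moreover have "?F (\<lambda>i\<in>I. w i s) = S s ^ l" for s by (simp add: S_def)
      moreover have "integrable M (\<lambda>s. S s ^ l)" "integrable M (\<lambda>s. w x s ^ k)"
        by (intro all_moments_integrable all_moments_intros S all_moments_w)+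
      ultimately show ?thesis
        using expectation_indep_past[of x I ?F "\<lambda>t. t ^ k"] insert by (simp add: moment_eq)
    qed
    have "expectation (\<lambda>s. (\<Sum>i\<in>insert x I. a i * w i s) ^ (2 * n))
      = expectation (\<lambda>s. \<Sum>k\<le>2 * n. (real (2 * n choose k) * a x ^ k) * (S s ^ (2 * n - k) * w x s ^ k))"
      using insert by (simp add: S_def[symmetric] binomial_ring power_mult_distrib mult_ac)
    also have "\<dots> = (\<Sum>k\<le>2 * n. (real (2 * n choose k) * a x ^ k) * (expectation (\<lambda>s. S s ^ (2 * n - k)) * moment k))"
      by (subst Bochner_Integration.integral_sum)
        (auto intro!: all_moments_integrable all_moments_intros S all_moments_w simp: prod)
    also have "\<dots> = (\<Sum>j\<le>n. (real (2 * n choose (2 * j)) * a x ^ (2 * j)) * (expectation (\<lambda>s. S s ^ (2 * n - 2 * j)) * moment (2 * j)))"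
      by (rule sum_even_indices) (simp add: odd_moment)
    also have "\<dots> = expectation (\<lambda>s. S s ^ (2 * n))
       + (\<Sum>j\<in>{1..n}. (real (2 * n choose (2 * j)) * a x ^ (2 * j)) * (expectation (\<lambda>s. S s ^ (2 * n - 2 * j)) * moment (2 * j)))"
    proof -
      have "{..n} = insert 0 {1..n}" by auto
      then show ?thesis by (simp add: moment_def prob_space)
    qed
    also have "\<dots> \<le> C * V ^ n + (\<Sum>j\<in>{1..n}. (real (2 * n choose (2 * j)) * moment (2 * j) * c (n - j)) * (((a x)\<^sup>2 + V) ^ n - V ^ n))"
    proof (intro add_mono sum_mono)
      show "expectation (\<lambda>s. S s ^ (2 * n)) \<le> C * V ^ n" using insert by (simp add: S_def V_def)
      fix j assume j: "j \<in> {1..n}"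
      have "P (n - j) (c (n - j))" using j by (intro c) auto
      then have "expectation (\<lambda>s. S s ^ (2 * (n - j))) \<le> c (n - j) * V ^ (n - j)"
        using insert by (simp add: P_def S_def V_def)
      then have "(real (2 * n choose (2 * j)) * moment (2 * j) * a x ^ (2 * j)) * expectation (\<lambda>s. S s ^ (2 * (n - j)))
        \<le> (real (2 * n choose (2 * j)) * moment (2 * j) * a x ^ (2 * j)) * (c (n - j) * V ^ (n - j))"
        using even_moment_nonneg[of j] by (intro mult_left_mono) (auto simp: power_mult)
      also have "\<dots> = (real (2 * n choose (2 * j)) * moment (2 * j) * c (n - j)) * (((a x)\<^sup>2) ^ j * V ^ (n - j))"
        unfolding power_mult[of "a x"] by (simp only: mult_ac)
      also have "\<dots> \<le> (real (2 * n choose (2 * j)) * moment (2 * j) * c (n - j)) * (((a x)\<^sup>2 + V) ^ n - V ^ n)"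
        using j V0 by (intro mult_left_mono power_add_minus_ge t0) auto
      finally show "(real (2 * n choose (2 * j)) * a x ^ (2 * j)) * (expectation (\<lambda>s. S s ^ (2 * n - 2 * j)) * moment (2 * j))
         \<le> (real (2 * n choose (2 * j)) * moment (2 * j) * c (n - j)) * (((a x)\<^sup>2 + V) ^ n - V ^ n)"
        unfolding diff_mult_distrib2[symmetric] by (simp only: mult_ac)
    qed
    also have "\<dots> = C * V ^ n + (C - 1) * (((a x)\<^sup>2 + V) ^ n - V ^ n)"
      by (simp add: C_def sum_distrib_right)
    also have "\<dots> \<le> C * V ^ n + C * (((a x)\<^sup>2 + V) ^ n - V ^ n)"
    proof -
      have "V ^ n \<le> ((a x)\<^sup>2 + V) ^ n" using V0 by (intro power_mono) auto
      then show ?thesis by (intro add_left_mono mult_right_mono) auto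
    qed
    also have "\<dots> = C * (\<Sum>i\<in>insert x I. (a i)\<^sup>2) ^ n"
      using insert by (simp add: V_def algebra_simps)
    finally show ?case .
  qed
  then show ?case using C1 by (intro exI[of _ C]) auto
qed

text \<open>The exponent \<open>1/16\<close> is any positive number below \<open>1/8\<close>; it is obtained from the moment of order 48.\<close>

lemma partial_sums_AE_bound:
  "AE s in M. \<exists>C\<ge>0. \<forall>x y. x < y \<longrightarrow> \<bar>\<Sum>i\<in>{x<..y}. w i s\<bar> \<le> C * real y powr (1/16) * sqrt (real (y - x))"
proof -
  obtain C where C: "C \<ge> 0" "\<And>I a. finite I \<Longrightarrow>
    expectation (\<lambda>s. (\<Sum>i\<in>I. a i * w i s) ^ (2 * 24)) \<le> C * (\<Sum>i\<in>I. (a i)\<^sup>2) ^ 24"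
    using linear_form_moment[of 24] by blast
  \<comment> \<open>Each of the \<open>y\<close> terms has expectation at most
    \<open>C / y ^ 3\<close>, so the sum over \<open>x\<close> is at most \<open>C / y ^ 2\<close>,
    which is summable; the 48th root of \<open>y ^ 3\<close> is
    \<open>y powr (1/16)\<close>.\<close>
  define f where "f y s = (\<Sum>x<y. (\<Sum>i\<in>{x<..y}. w i s) ^ 48 / (real (y - x) ^ 24 * real y ^ 3))" for y s
  have pos: "f y s \<ge> 0" for y s
    unfolding f_def by (intro sum_nonneg divide_nonneg_nonneg mult_nonneg_nonneg) (auto simp: zero_le_even_power)
  have int: "integrable M (f y)" for y
    unfolding f_def divide_inverse by (intro all_moments_integrable all_moments_intros all_moments_w)
  have "expectation (f y) \<le> C * (1 / real y ^ 2)" for y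
  proof (cases "y = 0")
    case False
    have "expectation (f y) = (\<Sum>x<y. expectation (\<lambda>s. (\<Sum>i\<in>{x<..y}. w i s) ^ 48) / (real (y - x) ^ 24 * real y ^ 3))"
      unfolding f_def divide_inverse
      by (subst Bochner_Integration.integral_sum) (auto intro!: all_moments_integrable all_moments_intros all_moments_w)
    also have "\<dots> \<le> (\<Sum>x<y. C * real (y - x) ^ 24 / (real (y - x) ^ 24 * real y ^ 3))"
    proof (intro sum_mono divide_right_mono)
      fix x show "expectation (\<lambda>s. (\<Sum>i\<in>{x<..y}. w i s) ^ 48) \<le> C * real (y - x) ^ 24"
        using C(2)[of "{x<..y}" "\<lambda>_. 1"] by (simp del: of_nat_diff)
    qed simp
    also have "\<dots> = (\<Sum>x<y. C / real y ^ 3)" by (intro sum.cong) auto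
    also have "\<dots> = C * (1 / real y ^ 2)" using False by (simp add: power3_eq_cube power2_eq_square)
    finally show ?thesis .
  next
    case True
    have "f 0 = (\<lambda>s. 0)" by (simp add: f_def fun_eq_iff)
    then show ?thesis using True by simp
  qed
  moreover have "summable (\<lambda>y. C * (1 / real y ^ 2))"
    using inverse_power_summable[of 2, where 'a = real] by (intro summable_mult) (simp add: field_simps)
  moreover have "expectation (f y) \<ge> 0" for y by (rule Bochner_Integration.integral_nonneg[OF pos])
  ultimately have "summable (\<lambda>y. expectation (f y))"
    by (rule summable_comparison_test_of_le[rotated 2])
  then have "AE s in M. summable (\<lambda>y. f y s)" by (intro AE_summable_of_summable_expectation int pos)
  then show ?thesis
  proof eventually_elim
    case (elim s)
    define B where "B = (\<Sum>y. f y s)"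
    have B0: "B \<ge> 0" unfolding B_def by (rule suminf_nonneg[OF elim pos])
    have "\<bar>\<Sum>i\<in>{x<..y}. w i s\<bar> \<le> root 48 B * real y powr (1/16) * sqrt (real (y - x))" if xy: "x < y" for x y
    proof -
      have y: "real y > 0" "real (y - x) > 0" using xy by auto
      have "(\<Sum>i\<in>{x<..y}. w i s) ^ 48 / (real (y - x) ^ 24 * real y ^ 3) \<le> f y s"
        unfolding f_def using xy by (intro member_le_sum) (auto simp: zero_le_even_power)
      also have "\<dots> \<le> B" unfolding B_def using sum_le_suminf[OF elim, of "{y}"] pos by simp
      finally have "\<bar>\<Sum>i\<in>{x<..y}. w i s\<bar> ^ 48 \<le> B * (real (y - x) ^ 24 * real y ^ 3)"
        using y by (simp add: divide_le_eq power_even_abs)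
      also have "\<dots> = (root 48 B * real y powr (1/16) * sqrt (real (y - x))) ^ 48"
      proof -
        have "sqrt (real (y - x)) ^ 48 = real (y - x) ^ 24"
          using power_mult[of "sqrt (real (y - x))" 2 24] by simp
        moreover have "(real y powr (1/16)) ^ 48 = real y ^ 3"
          using y by (subst powr_power) (simp_all add: powr_numeral)
        ultimately show ?thesis using B0 by (simp add: power_mult_distrib mult_ac)
      qed
      finally show ?thesis
        using B0 by (subst (asm) power_mono_iff) auto
    qed
    then show ?case using B0 by (intro exI[of _ "root 48 B"]) auto
  qed
qed

end

section \<open>Strong law for a centred quadratic form\<close>

locale quadratic_scenery = symmetric_iid +
  fixes c :: "nat \<Rightarrow> real" and b :: "nat \<Rightarrow> nat \<Rightarrow> real" and B :: real
  assumes c_bound: "\<And>y. \<bar>c y\<bar> \<le> 1" and b_bound: "\<And>y. (\<Sum>x\<in>{1..<y}. (b y x)\<^sup>2) \<le> B"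
begin

definition lin :: "nat \<Rightarrow> (nat \<Rightarrow> real) \<Rightarrow> real" where
  "lin y v = (\<Sum>x\<in>{1..<y}. b y x * v x)"
text \<open>All terms whose largest site is \<open>y\<close>. Given the earlier sites its mean is 0,
  because \<open>w y\<close> has mean 0 and variance 1; the form is thus a martingale in
  \<open>n\<close>.\<close>

definition incr :: "nat \<Rightarrow> (nat \<Rightarrow> real) \<Rightarrow> real" where
  "incr y v = ((v y)\<^sup>2 - 1) * c y + 2 * (v y * lin y v)"
definition form :: "nat \<Rightarrow> (nat \<Rightarrow> real) \<Rightarrow> real" where
  "form n v = (\<Sum>y\<in>{1..n}. incr y v)"

lemma all_moments_lin: "all_moments (\<lambda>s. lin y (\<lambda>x. w x s))"
  unfolding lin_def by (intro all_moments_intros all_moments_w)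

lemma all_moments_incr: "all_moments (\<lambda>s. incr y (\<lambda>x. w x s))"
  unfolding incr_def by (intro all_moments_intros all_moments_w all_moments_lin)

lemma all_moments_form: "all_moments (\<lambda>s. form n (\<lambda>x. w x s))"
  unfolding form_def by (intro all_moments_intros all_moments_incr)

text \<open>Restriction to \<open>{1..n}\<close> makes the dependence on the past explicit, as
  independence is applied to functions on the product space. The bound is \<open>Suc n\<close>
  because \<open>lin y\<close> reads only sites before \<open>y\<close>.\<close>

lemma lin_restrict: "y \<le> Suc n \<Longrightarrow> lin y (\<lambda>i\<in>{1..n}. v i) = lin y v"
  unfolding lin_def by (intro sum.cong) auto

lemma form_restrict: "form n (\<lambda>i\<in>{1..n}. v i) = form n v"
  unfolding form_def incr_def
proof (intro sum.cong refl)
  fix y assume "y \<in> {1..n}"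
  then show "(((\<lambda>i\<in>{1..n}. v i) y)\<^sup>2 - 1) * c y + 2 * ((\<lambda>i\<in>{1..n}. v i) y * lin y (\<lambda>i\<in>{1..n}. v i))
    = ((v y)\<^sup>2 - 1) * c y + 2 * (v y * lin y v)"
    by (simp only: lin_restrict[of y n] restrict_apply' atLeastAtMost_iff le_SucI)
qed

lemma lin_measurable: "y \<le> Suc n \<Longrightarrow> lin y \<in> borel_measurable (PiM {1..n} (\<lambda>_. borel))"
  unfolding lin_def
  by (intro borel_measurable_sum borel_measurable_times borel_measurable_const measurable_component_singleton) auto

lemma form_measurable: "form n \<in> borel_measurable (PiM {1..n} (\<lambda>_. borel))"
  unfolding form_def incr_def
  by (intro borel_measurable_sum borel_measurable_times borel_measurable_const borel_measurable_add
      borel_measurable_diff borel_measurable_power measurable_component_singleton lin_measurable) auto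

lemma expectation_past_product:
  fixes F :: "(nat \<Rightarrow> real) \<Rightarrow> real" and h :: "real \<Rightarrow> real"
  assumes "F \<in> borel_measurable (PiM {1..n} (\<lambda>_. borel))" "\<And>v. F (\<lambda>i\<in>{1..n}. v i) = F v"
    "all_moments (\<lambda>s. F (\<lambda>x. w x s))" "h \<in> borel_measurable borel" "integrable M (\<lambda>s. h (w (Suc n) s))"
  shows "expectation (\<lambda>s. F (\<lambda>x. w x s) * h (w (Suc n) s)) = expectation (\<lambda>s. F (\<lambda>x. w x s)) * expectation (\<lambda>s. h (w (Suc n) s))"
  using expectation_indep_past[of "Suc n" "{1..n}" F h] assms by (simp add: all_moments_integrable)

text \<open>The increment splits into \<open>w^2 - 1\<close> and \<open>w\<close> at the new site,
  both centred, each multiplied by a function of the earlier sites.\<close>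

lemma form_orthogonal: "expectation (\<lambda>s. form n (\<lambda>x. w x s) ^ 3 * incr (Suc n) (\<lambda>x. w x s)) = 0"
proof -
  let ?W = "\<lambda>s. form n (\<lambda>x. w x s)" and ?L = "\<lambda>s. lin (Suc n) (\<lambda>x. w x s)"
  have 1: "expectation (\<lambda>s. ?W s ^ 3 * ((w (Suc n) s)\<^sup>2 - 1)) = 0"
  proof -
    have "expectation (\<lambda>s. (w (Suc n) s)\<^sup>2 - 1) = 0"
      using moment_eq[of "Suc n" 2] moment_2 all_moments_integrable[OF all_moments_power[OF all_moments_w]]
      by (simp add: prob_space)
    moreover have "expectation (\<lambda>s. (\<lambda>v. form n v ^ 3) (\<lambda>x. w x s) * (\<lambda>t. t\<^sup>2 - 1) (w (Suc n) s))
       = expectation (\<lambda>s. (\<lambda>v. form n v ^ 3) (\<lambda>x. w x s)) * expectation (\<lambda>s. (\<lambda>t. t\<^sup>2 - 1) (w (Suc n) s))"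
      by (rule expectation_past_product[where F = "\<lambda>v. form n v ^ 3" and h = "\<lambda>t. t\<^sup>2 - 1"],
          intro borel_measurable_power form_measurable, simp only: form_restrict,
          intro all_moments_intros all_moments_form, measurable,
          intro all_moments_integrable all_moments_intros all_moments_w)
    ultimately show ?thesis by simp
  qed
  have 2: "expectation (\<lambda>s. (?W s ^ 3 * ?L s) * w (Suc n) s) = 0"
  proof -
    have "expectation (\<lambda>s. (\<lambda>v. form n v ^ 3 * lin (Suc n) v) (\<lambda>x. w x s) * (\<lambda>t. t) (w (Suc n) s))
       = expectation (\<lambda>s. (\<lambda>v. form n v ^ 3 * lin (Suc n) v) (\<lambda>x. w x s)) * expectation (\<lambda>s. (\<lambda>t. t) (w (Suc n) s))"
      by (rule expectation_past_product[where F = "\<lambda>v. form n v ^ 3 * lin (Suc n) v" and h = "\<lambda>t. t"],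
          intro borel_measurable_power borel_measurable_times form_measurable lin_measurable order_refl,
          simp only: form_restrict lin_restrict[OF order_refl],
          intro all_moments_intros all_moments_form all_moments_lin, measurable,
          intro all_moments_integrable all_moments_intros all_moments_w)
    then show ?thesis using moment_eq[of "Suc n" 1] odd_moment[of 1] by simp
  qed
  have "(\<lambda>s. ?W s ^ 3 * incr (Suc n) (\<lambda>x. w x s))
     = (\<lambda>s. (?W s ^ 3 * ((w (Suc n) s)\<^sup>2 - 1)) * c (Suc n) + 2 * ((?W s ^ 3 * ?L s) * w (Suc n) s))"
    by (simp add: fun_eq_iff incr_def algebra_simps)
  moreover have "integrable M (\<lambda>s. ?W s ^ 3 * ((w (Suc n) s)\<^sup>2 - 1))" "integrable M (\<lambda>s. (?W s ^ 3 * ?L s) * w (Suc n) s)"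
    by (intro all_moments_integrable all_moments_intros all_moments_form all_moments_lin all_moments_w)+
  ultimately show ?thesis using 1 2 by simp
qed

text \<open>Uniform in \<open>y\<close> because the rows of \<open>b\<close> are bounded in
  \<open>l^2\<close>: the linear form bound of order four applies to \<open>lin y\<close>, which is
  independent of \<open>w y\<close>.\<close>

lemma incr_fourth_moment: "\<exists>A. \<forall>y. expectation (\<lambda>s. incr y (\<lambda>x. w x s) ^ 4) \<le> A"
proof -
  obtain C where C: "C \<ge> 0" "\<And>I a. finite I \<Longrightarrow>
    expectation (\<lambda>s. (\<Sum>i\<in>I. a i * w i s) ^ (2 * 2)) \<le> C * (\<Sum>i\<in>I. (a i)\<^sup>2) ^ 2"
    using linear_form_moment[of 2] by blast
  have B0: "B \<ge> 0" using b_bound[of 0] by simp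
  have L4: "expectation (\<lambda>s. lin y (\<lambda>x. w x s) ^ 4) \<le> C * B\<^sup>2" for y
  proof -
    have "expectation (\<lambda>s. lin y (\<lambda>x. w x s) ^ 4) \<le> C * (\<Sum>x\<in>{1..<y}. (b y x)\<^sup>2)\<^sup>2"
      using C(2)[of "{1..<y}" "b y"] by (simp add: lin_def)
    also have "\<dots> \<le> C * B\<^sup>2" using C b_bound by (intro mult_left_mono power_mono) (auto simp: sum_nonneg)
    finally show ?thesis .
  qed
  define Q where "Q = expectation (\<lambda>s. ((w 0 s)\<^sup>2 - 1) ^ 4)"
  have "expectation (\<lambda>s. incr y (\<lambda>x. w x s) ^ 4) \<le> 16 * (Q + 16 * (moment 4 * (C * B\<^sup>2)))" for y
  proof -
    let ?u = "\<lambda>s. ((w y s)\<^sup>2 - 1) ^ 4" and ?v = "\<lambda>s. lin y (\<lambda>x. w x s) ^ 4 * w y s ^ 4"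
    have int: "integrable M ?u" "integrable M ?v" "integrable M (\<lambda>s. incr y (\<lambda>x. w x s) ^ 4)"
      by (intro all_moments_integrable all_moments_intros all_moments_incr all_moments_lin all_moments_w)+
    have "expectation (\<lambda>s. incr y (\<lambda>x. w x s) ^ 4) \<le> expectation (\<lambda>s. 16 * (?u s + 16 * ?v s))"
    proof (rule integral_mono)
      fix s
      let ?p = "((w y s)\<^sup>2 - 1) * c y" and ?q = "2 * (w y s * lin y (\<lambda>x. w x s))"
      have "incr y (\<lambda>x. w x s) ^ 4 = \<bar>?p + ?q\<bar> ^ 4" by (simp add: incr_def power_even_abs)
      also have "\<dots> \<le> (\<bar>?p\<bar> + \<bar>?q\<bar>) ^ 4" by (intro power_mono) auto
      also have "\<dots> \<le> 16 * (\<bar>?p\<bar> ^ 4 + \<bar>?q\<bar> ^ 4)" using power_add_le[of "\<bar>?p\<bar>" "\<bar>?q\<bar>" 4] by simp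
      also have "\<bar>?p\<bar> ^ 4 \<le> ?u s"
      proof -
        have "\<bar>?p\<bar> ^ 4 = ?u s * \<bar>c y\<bar> ^ 4" by (simp add: power_mult_distrib power_even_abs abs_mult)
        also have "\<dots> \<le> ?u s * 1" using c_bound[of y] by (intro mult_left_mono power_le_one) (auto simp: zero_le_even_power)
        finally show ?thesis by simp
      qed
      also have "\<bar>?q\<bar> ^ 4 = 16 * ?v s" by (simp add: power_mult_distrib power_even_abs abs_mult)
      finally show "incr y (\<lambda>x. w x s) ^ 4 \<le> 16 * (?u s + 16 * ?v s)" by simp
    qed (use int in auto)
    also have "\<dots> = 16 * (expectation ?u + 16 * expectation ?v)" using int by simp
    also have "expectation ?u = Q"
      unfolding Q_def using w_expectation_eq(1)[of "\<lambda>t. (t\<^sup>2 - 1) ^ 4" y] by simp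
    also have "expectation ?v \<le> moment 4 * (C * B\<^sup>2)"
    proof (cases y)
      case 0
      then show ?thesis using even_moment_nonneg[of 2] C(1) B0 by (simp add: lin_def)
    next
      case (Suc n)
      have "expectation (\<lambda>s. (\<lambda>v. lin y v ^ 4) (\<lambda>x. w x s) * (\<lambda>t. t ^ 4) (w (Suc n) s))
        = expectation (\<lambda>s. (\<lambda>v. lin y v ^ 4) (\<lambda>x. w x s)) * expectation (\<lambda>s. (\<lambda>t. t ^ 4) (w (Suc n) s))"
        unfolding Suc
        by (rule expectation_past_product[where F = "\<lambda>v. lin (Suc n) v ^ 4" and h = "\<lambda>t. t ^ 4"],
          intro borel_measurable_power lin_measurable order_refl,
          simp only: lin_restrict[OF order_refl],
          intro all_moments_intros all_moments_lin, measurable,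
          intro all_moments_integrable all_moments_intros all_moments_w)
      then have "expectation ?v = moment 4 * expectation (\<lambda>s. lin y (\<lambda>x. w x s) ^ 4)"
        using Suc by (simp add: moment_eq)
      also have "\<dots> \<le> moment 4 * (C * B\<^sup>2)" using even_moment_nonneg[of 2] L4 by (intro mult_left_mono) auto
      finally show ?thesis .
    qed
    finally show ?thesis by simp
  qed
  then show ?thesis by blast
qed

text \<open>Fourth moments of order \<open>n^2\<close> make the expectation of
  \<open>(form / n)^4\<close> of order \<open>1 / n^2\<close>; being summable, it gives convergence
  along all \<open>n\<close> without passing to a subsequence.\<close>

lemma form_strong_law: "AE s in M. (\<lambda>n. form n (\<lambda>x. w x s) / real n) \<longlonglongrightarrow> 0"
proof -
  obtain A where A: "\<And>y. expectation (\<lambda>s. incr y (\<lambda>x. w x s) ^ 4) \<le> A" using incr_fourth_moment by blast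
  have W4: "expectation (\<lambda>s. form n (\<lambda>x. w x s) ^ 4) \<le> 20 * A * (real n)\<^sup>2" for n
    by (rule fourth_moment_growth[where D = "\<lambda>y s. incr y (\<lambda>x. w x s)"])
      (auto simp: all_moments_incr form_orthogonal A, simp_all add: form_def)
  define f where "f n s = (form n (\<lambda>x. w x s) / real n) ^ 4" for n s
  have int: "integrable M (f n)" for n
    unfolding f_def divide_inverse by (intro all_moments_integrable all_moments_intros all_moments_form)
  have pos: "f n s \<ge> 0" for n s by (simp add: f_def zero_le_even_power)
  have "expectation (f n) \<le> 20 * A * (1 / real n ^ 2)" for n
  proof (cases "n = 0")
    case False
    have "expectation (f n) = expectation (\<lambda>s. form n (\<lambda>x. w x s) ^ 4) / real n ^ 4"
      unfolding f_def by (simp add: power_divide)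
    also have "\<dots> \<le> 20 * A * (real n)\<^sup>2 / real n ^ 4" by (intro divide_right_mono W4) simp
    also have "\<dots> = 20 * A * (1 / real n ^ 2)" using False by (simp add: power2_eq_square power4_eq_xxxx)
    finally show ?thesis .
  next
    case True
    have "f 0 = (\<lambda>s. 0)" by (simp add: f_def fun_eq_iff)
    then show ?thesis using True by simp
  qed
  moreover have "summable (\<lambda>n. 20 * A * (1 / real n ^ 2))"
    using inverse_power_summable[of 2, where 'a = real] by (intro summable_mult) (simp add: field_simps)
  moreover have "expectation (f n) \<ge> 0" for n by (rule Bochner_Integration.integral_nonneg[OF pos])
  ultimately have "summable (\<lambda>n. expectation (f n))"
    by (rule summable_comparison_test_of_le[rotated 2])
  then have "AE s in M. summable (\<lambda>n. f n s)" by (intro AE_summable_of_summable_expectation int pos)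
  then show ?thesis
  proof eventually_elim
    case (elim s)
    have "(\<lambda>n. root 4 (f n s)) \<longlonglongrightarrow> root 4 0" by (intro tendsto_intros summable_LIMSEQ_zero elim)
    moreover have "root 4 (f n s) = \<bar>form n (\<lambda>x. w x s) / real n\<bar>" for n
    proof -
      have "\<bar>form n (\<lambda>x. w x s) / real n\<bar> ^ 4 = f n s" unfolding f_def by (rule power_even_abs) simp
      then show ?thesis using real_root_power_cancel[of 4 "\<bar>form n (\<lambda>x. w x s) / real n\<bar>"] by simp
    qed
    ultimately have "(\<lambda>n. \<bar>form n (\<lambda>x. w x s) / real n\<bar>) \<longlonglongrightarrow> 0" by simp
    then show ?case by (simp only: tendsto_rabs_zero_iff)
  qed
qed

end

section \<open>The quenched central limit theorem\<close>

lemma pmf_replicate_pmf: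
  "pmf (replicate_pmf n p) xs = (if length xs = n then \<Prod>i<n. pmf p (xs ! i) else 0)"
proof (induction n arbitrary: xs)
  case 0
  then show ?case by (simp add: indicator_def)
next
  case (Suc n)
  have eq: "replicate_pmf (Suc n) p = map_pmf (\<lambda>(x, xs). x # xs) (pair_pmf p (replicate_pmf n p))"
    by (simp add: pair_pmf_def map_bind_pmf)
  show ?case
  proof (cases xs)
    case Nil
    then have "xs \<notin> set_pmf (replicate_pmf (Suc n) p)" unfolding set_replicate_pmf by simp
    then show ?thesis using Nil by (simp add: set_pmf_iff del: replicate_pmf.simps)
  next
    case (Cons y ys)
    have "inj (\<lambda>(x::'a, xs). x # xs)" by (auto simp: inj_def)
    from pmf_map_inj'[OF this, of "pair_pmf p (replicate_pmf n p)" "(y, ys)"]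
    have "pmf (replicate_pmf (Suc n) p) xs = pmf p y * pmf (replicate_pmf n p) ys"
      unfolding eq Cons by (simp add: pmf_pair)
    then show ?thesis
      by (simp add: Suc Cons prod.lessThan_Suc_shift del: prod.lessThan_Suc replicate_pmf.simps)
  qed
qed

lemma scenery_sum_append:
  "scenery_sum f s (xs @ ys) = scenery_sum f s xs + scenery_sum f (s + sum_list xs) ys"
  by (induction xs arbitrary: s) (auto simp: add.assoc)

lemma sum_list_steps: "sum_list (map g [1..<Suc n]) = (\<Sum>j\<in>{1..n}. g j)" for g :: "nat \<Rightarrow> nat"
  by (induction n) auto

lemma scenery_sum_steps:
  "scenery_sum f 0 (map g [1..<Suc n]) = (\<Sum>k\<in>{1..n}. f (\<Sum>j\<in>{1..k}. g j))"
proof (induction n)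
  case (Suc n)
  have "[1..<Suc (Suc n)] = [1..<Suc n] @ [Suc n]" by simp
  then show ?case
    using Suc sum_list_steps[of g n] by (simp only: map_append scenery_sum_append list.map scenery_sum.simps) simp
qed simp

lemma (in prob_space) pmf_of_random_variable:
  fixes X :: "'a \<Rightarrow> 'c::countable"
  assumes "X \<in> measurable M (count_space UNIV)"
  obtains p where "measure_pmf p = distr M (count_space UNIV) X"
proof
  interpret D: prob_space "distr M (count_space UNIV) X" by (rule prob_space_distr[OF assms])
  have "AE x in distr M (count_space UNIV) X. measure (distr M (count_space UNIV) X) {x} \<noteq> 0"
    by (subst D.AE_support_countable) (auto intro!: exI[of _ UNIV])
  then show "measure_pmf (Abs_pmf (distr M (count_space UNIV) X)) = distr M (count_space UNIV) X"
    by (intro Abs_pmf_inverse) (auto intro: D.prob_space_axioms)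
qed

text \<open>The walk enters the argument only through the list of its first \<open>n\<close> steps;
  this identifies the law of that list with \<open>replicate_pmf\<close>.\<close>

lemma (in prob_space) distr_iid_list:
  fixes X :: "nat \<Rightarrow> 'a \<Rightarrow> nat"
  assumes meas: "\<And>n. X n \<in> measurable M (count_space UNIV)"
    and indep: "indep_vars (\<lambda>_. count_space UNIV) X {1..}"
    and law: "\<And>n. n \<ge> 1 \<Longrightarrow> distr M (count_space UNIV) (X n) = measure_pmf p"
  shows "(\<lambda>y. map (\<lambda>i. X i y) [1..<Suc n]) \<in> measurable M (count_space UNIV)"
    and "distr M (count_space UNIV) (\<lambda>y. map (\<lambda>i. X i y) [1..<Suc n]) = measure_pmf (replicate_pmf n p)"
proof -
  let ?L = "\<lambda>y. map (\<lambda>i. X i y) [1..<Suc n]"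
  have pre: "?L -` {xs} \<inter> space M = (if length xs = n then space M \<inter> {y. \<forall>i<n. X (Suc i) y = xs ! i} else {})" for xs
  proof -
    have len: "length (?L y) = n" for y by simp
    have nth: "?L y ! i = X (Suc i) y" if "i < n" for i y
      using that by (simp add: nth_upt del: upt_Suc)
    have "?L y = xs \<longleftrightarrow> length xs = n \<and> (\<forall>i<n. X (Suc i) y = xs ! i)" for y
      unfolding list_eq_iff_nth_eq len using nth by metis
    then show ?thesis by auto
  qed
  have sets: "?L -` {xs} \<inter> space M \<in> sets M" for xs
    unfolding pre using meas by (auto intro!: sets.sets_Collect_finite_All')
  show meas_L: "?L \<in> measurable M (count_space UNIV)"
    by (rule measurable_count_space_eq_countable[THEN iffD2]) (use sets in auto)
  show "distr M (count_space UNIV) ?L = measure_pmf (replicate_pmf n p)"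
  proof (rule measure_eqI_countable[where A = UNIV])
    fix xs
    have "prob (?L -` {xs} \<inter> space M) = pmf (replicate_pmf n p) xs"
    \<comment> \<open>The empty list is treated apart, since the product formula for independent
      variables is applied to a nonempty index set.\<close>
    proof (cases "length xs = n \<and> n > 0")
      case False
      then show ?thesis unfolding pre pmf_replicate_pmf by (auto simp: prob_space)
    next
      case True
      have "?L -` {xs} \<inter> space M = (\<Inter>i\<in>{1..n}. X i -` {xs ! (i - 1)} \<inter> space M)"
      proof -
        have "(\<forall>i<n. X (Suc i) y = xs ! i) \<longleftrightarrow> (\<forall>i\<in>{1..n}. X i y = xs ! (i - 1))" for y
          unfolding image_Suc_lessThan[symmetric] by auto
        then show ?thesis unfolding pre using True by auto
      qed
      also have "prob \<dots> = (\<Prod>i\<in>{1..n}. prob (X i -` {xs ! (i - 1)} \<inter> space M))"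
        using True by (intro indep_varsD[OF indep]) auto
      also have "\<dots> = (\<Prod>i\<in>{1..n}. pmf p (xs ! (i - 1)))"
      proof (intro prod.cong refl)
        fix i assume "i \<in> {1..n}"
        then have "distr M (count_space UNIV) (X i) = measure_pmf p" by (intro law) simp
        then have "measure (distr M (count_space UNIV) (X i)) {xs ! (i - 1)} = pmf p (xs ! (i - 1))"
          by (simp add: measure_pmf_single)
        then show "prob (X i -` {xs ! (i - 1)} \<inter> space M) = pmf p (xs ! (i - 1))"
          using meas by (simp add: measure_distr)
      qed
      also have "\<dots> = (\<Prod>i<n. pmf p (xs ! i))"
        by (rule prod.reindex_bij_witness[where i = Suc and j = "\<lambda>i. i - 1"]) auto
      finally show ?thesis using True by (simp add: pmf_replicate_pmf)
    qed
    then show "emeasure (distr M (count_space UNIV) ?L) {xs} = emeasure (measure_pmf (replicate_pmf n p)) {xs}"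
      using meas_L by (simp add: emeasure_distr emeasure_eq_measure emeasure_pmf_single del: upt_Suc)
  qed auto
qed

text \<open>Needed to pass from a scenery indexed by \<open>int\<close> to its part on the
  nonnegative sites.\<close>

lemma (in prob_space) indep_vars_reindex_inj:
  assumes indep: "indep_vars M' X I" and inj: "inj_on h J" and sub: "h ` J \<subseteq> I"
  shows "indep_vars (\<lambda>i. M' (h i)) (\<lambda>i. X (h i)) J"
  unfolding indep_vars_def2
proof (intro conjI ballI)
  fix i assume "i \<in> J"
  then show "random_variable (M' (h i)) (X (h i))" using indep sub by (auto simp: indep_vars_def2)
next
  let ?F = "\<lambda>i. {X i -` A \<inter> space M |A. A \<in> sets (M' i)}"
  have F: "indep_sets ?F I" using indep by (simp add: indep_vars_def2)
  show "indep_sets (\<lambda>i. ?F (h i)) J"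
  proof (rule indep_setsI)
    fix i assume "i \<in> J"
    then show "?F (h i) \<subseteq> events" using F sub by (auto simp: indep_sets_def)
  next
    fix A K assume K: "K \<noteq> {}" "K \<subseteq> J" "finite K" "\<forall>j\<in>K. A j \<in> ?F (h j)"
    define B where "B = (\<lambda>i. A (the_inv_into K h i))"
    have injK: "inj_on h K" using inj K by (meson inj_on_subset)
    then have B: "B (h j) = A j" if "j \<in> K" for j using that by (simp add: B_def the_inv_into_f_f)
    have "prob (\<Inter>i\<in>h ` K. B i) = (\<Prod>i\<in>h ` K. prob (B i))"
    proof (rule indep_setsD[OF F])
      show "h ` K \<subseteq> I" using K(2) sub by blast
      show "\<forall>i\<in>h ` K. B i \<in> ?F i" using K(4) B by simp
    qed (use K in auto)
    then show "prob (\<Inter>j\<in>K. A j) = (\<Prod>j\<in>K. prob (A j))"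
      using B injK by (simp add: prod.reindex)
  qed
qed

lemma normal_law_properties:
  assumes v: "v \<ge> 0"
  shows "real_distribution (normal_law 0 v)" and "char (normal_law 0 v) t = exp (- (t\<^sup>2 * v / 2))"
proof -
  have "real_distribution (normal_law 0 v) \<and> char (normal_law 0 v) t = exp (- (t\<^sup>2 * v / 2))"
  proof (cases "v = 0")
    \<comment> \<open>The degenerate limit is a point mass; in the theorem it corresponds to
      \<open>m = 1\<close>, when almost every step equals 1.\<close>
    case True
    interpret P: prob_space "return borel (0::real)" by (rule prob_space_return) simp
    show ?thesis using True P.prob_space_axioms
      by (auto simp: normal_law_def real_distribution_def real_distribution_axioms_def char_def integral_return)
  next
    case False
    define \<sigma> where "\<sigma> = sqrt v"
    have \<sigma>: "\<sigma> > 0" "\<sigma>\<^sup>2 = v" using v False by (auto simp: \<sigma>_def)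
    let ?N = "density lborel (normal_density 0 \<sigma>)"
    interpret P: prob_space ?N by (rule prob_space_normal_density) fact
    have "distributed ?N lborel (\<lambda>x. x) (normal_density 0 \<sigma>)"
      by (auto simp: distributed_def distr_id2)
    then have "distributed ?N lborel (\<lambda>x. (x - 0) / \<sigma>) std_normal_density"
      by (subst (asm) P.normal_standard_normal_convert[OF \<sigma>(1)])
    then have d: "distr ?N lborel (\<lambda>x. x / \<sigma>) = std_normal_distribution"
      by (simp add: distributed_def)
    have "char ?N t = (\<integral>x. iexp ((t * \<sigma>) * (x / \<sigma>)) \<partial>?N)"
      using \<sigma> by (simp add: char_def)
    also have "\<dots> = (\<integral>x. iexp ((t * \<sigma>) * x) \<partial>distr ?N lborel (\<lambda>x. x / \<sigma>))"
      by (subst integral_distr) auto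
    also have "\<dots> = char std_normal_distribution (t * \<sigma>)" by (simp add: d char_def)
    also have "\<dots> = exp (- (t\<^sup>2 * v / 2))"
      using \<sigma> by (simp add: char_std_normal_distribution power_mult_distrib)
    finally have "char ?N t = exp (- (t\<^sup>2 * v / 2))" .
    moreover have "real_distribution ?N"
      using P.prob_space_axioms by (simp add: real_distribution_def real_distribution_axioms_def)
    ultimately show ?thesis using False by (simp add: normal_law_def \<sigma>_def)
  qed
  then show "real_distribution (normal_law 0 v)" and "char (normal_law 0 v) t = exp (- (t\<^sup>2 * v / 2))" by auto
qed

theorem theorem1:
  fixes M :: "'a measure" and N :: "'b measure"
    and \<omega> :: "int \<Rightarrow> 'a \<Rightarrow> real"
    and X :: "nat \<Rightarrow> 'b \<Rightarrow> nat"
  assumes M: "prob_space M"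
    and \<omega>_meas: "\<And>x. \<omega> x \<in> borel_measurable M"
    and \<omega>_indep: "prob_space.indep_vars M (\<lambda>_. borel) \<omega> UNIV"
    and \<omega>_ident: "\<And>x. distr M borel (\<omega> x) = distr M borel (\<omega> 0)"
    and \<omega>_symm: "distr M borel (\<omega> 0) = distr M borel (\<lambda>s. - \<omega> 0 s)"
    and \<omega>_moments: "\<And>k::nat. k \<ge> 1 \<Longrightarrow> integrable M (\<lambda>s. \<bar>\<omega> 0 s\<bar> ^ k)"
    and \<omega>_var: "(\<integral>s. (\<omega> 0 s)\<^sup>2 \<partial>M) = 1"
    and N: "prob_space N"
    and X_meas: "\<And>n. X n \<in> measurable N (count_space UNIV)"
    and X_indep: "prob_space.indep_vars N (\<lambda>_. count_space UNIV) X {1..}"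
    and X_ident: "\<And>n. n \<ge> 1 \<Longrightarrow> distr N (count_space UNIV) (X n) = distr N (count_space UNIV) (X 1)"
    and X_supp: "{k. measure N {y \<in> space N. X 1 y = k} > 0} \<subseteq> {1..}"
    and X_aper: "Gcd {k. measure N {y \<in> space N. X 1 y = k} > 0} = 1"
    and X_int: "integrable N (\<lambda>y. real (X 1 y))"
    and X_sq: "integrable N (\<lambda>y. (real (X 1 y))\<^sup>2)"
  defines "m \<equiv> \<integral>y. real (X 1 y) \<partial>N"
    and "Z \<equiv> (\<lambda>n s y. \<Sum>k\<in>{1..n}. \<omega> (int (\<Sum>j\<in>{1..k}. X j y)) s)"
  shows "AE s in M. weak_conv_m
           (\<lambda>n. distr N borel (\<lambda>y. (Z n s y - (\<integral>y'. Z n s y' \<partial>N)) / sqrt (real n)))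
           (normal_law 0 (1 - 1 / m))"
proof -
  interpret M: prob_space M by (rule M)
  interpret N: prob_space N by (rule N)
  obtain p where p: "measure_pmf p = distr N (count_space UNIV) (X 1)"
    by (rule N.pmf_of_random_variable[OF X_meas])
  have pmf: "pmf p k = measure N {y \<in> space N. X 1 y = k}" for k
  proof -
    have "pmf p k = measure (distr N (count_space UNIV) (X 1)) {k}"
      unfolding p[symmetric] by (simp add: measure_pmf_single)
    also have "\<dots> = measure N (X 1 -` {k} \<inter> space N)" using X_meas by (simp add: measure_distr)
    also have "X 1 -` {k} \<inter> space N = {y \<in> space N. X 1 y = k}" by auto
    finally show ?thesis .
  qed
  then have supp: "set_pmf p = {k. measure N {y \<in> space N. X 1 y = k} > 0}"
    by (auto simp: set_pmf_iff zero_less_measure_iff)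
  interpret R: renewal_law p
  proof
    show "0 \<notin> set_pmf p" using X_supp supp by auto
    show "Gcd (set_pmf p) = 1" using X_aper supp by simp
    show "integrable p (\<lambda>k. (real k)\<^sup>2)"
      unfolding p using X_sq X_meas by (subst integrable_distr_eq) auto
  qed
  have mean: "R.mean = m"
    unfolding R.mean_def p m_def using X_meas by (subst integral_distr) auto
  \<comment> \<open>The walk never visits negative sites, so the scenery is read on
    \<open>nat\<close>.\<close>
  define w where "w = (\<lambda>x::nat. \<omega> (int x))"
  interpret W: symmetric_iid M w
  proof
    show "M.indep_vars (\<lambda>_. borel) w UNIV"
      unfolding w_def by (rule M.indep_vars_reindex_inj[OF \<omega>_indep]) auto
    show "distr M borel (w x) = distr M borel (w 0)" for x
      unfolding w_def using \<omega>_ident by metis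
  qed (use \<omega>_symm \<omega>_moments \<omega>_var in \<open>auto simp: w_def\<close>)
  obtain B where B: "\<And>y. (\<Sum>x\<in>{1..<y}. (renewal p x * (renewal p (y - x) - renewal p y))\<^sup>2) \<le> B"
    using R.quadratic_coefficients by blast
  interpret Q: quadratic_scenery M w "\<lambda>y. renewal p y * (1 - renewal p y)"
    "\<lambda>y x. renewal p x * (renewal p (y - x) - renewal p y)" B
  proof
    show "\<bar>renewal p y * (1 - renewal p y)\<bar> \<le> 1" for y
      using renewal_bounds[of p y] by (auto simp: abs_mult intro!: mult_le_one)
  qed (rule B)
  let ?L = "\<lambda>n y. map (\<lambda>i. X i y) [1..<Suc n]"
  have law: "distr N (count_space UNIV) (X n) = measure_pmf p" if "n \<ge> 1" for n
    using X_ident[OF that] p by simp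
  have L_meas: "?L n \<in> measurable N (count_space UNIV)" for n
    by (rule N.distr_iid_list(1)[OF X_meas X_indep law])
  have L_law: "distr N (count_space UNIV) (?L n) = measure_pmf (replicate_pmf n p)" for n
    by (rule N.distr_iid_list(2)[OF X_meas X_indep law])
  have v: "1 - 1 / m \<ge> 0" using R.mean_ge_1 mean by simp
  \<comment> \<open>These two events are all that is used of the randomness of the scenery; on their
    intersection the argument concerns a single fixed \<open>s\<close>.\<close>
  from W.partial_sums_AE_bound Q.form_strong_law show ?thesis
  proof eventually_elim
    case (elim s)
    obtain C where C: "C \<ge> 0" "\<And>x y. x < y \<Longrightarrow> \<bar>\<Sum>i\<in>{x<..y}. w i s\<bar> \<le> C * real y powr (1/16) * sqrt (real (y - x))"
      using elim(1) by blast
    interpret S: quenched_scenery p "\<lambda>x. w x s" C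
      by unfold_locales (use C in auto)
    have V: "(\<lambda>n. renewal_scenery.variance_left p (\<lambda>x. w x s) (R.cutoff n) 0 / real n) \<longlonglongrightarrow> 1 - 1 / m"
      unfolding mean[symmetric]
      by (rule S.variance_limit) (use elim(2) in \<open>simp add: Q.form_def Q.incr_def Q.lin_def\<close>)
    have Z: "Z n s y = scenery_sum (\<lambda>x. w x s) 0 (?L n y)" for n y
      by (simp only: Z_def w_def scenery_sum_steps)
    have EZ: "(\<integral>y. f (?L n y) \<partial>N) = expect (replicate_pmf n p) f"
      for n and f :: "nat list \<Rightarrow> 'd::{banach, second_countable_topology}"
      unfolding L_law[symmetric] using L_meas by (subst integral_distr) auto
    have Z_meas: "(\<lambda>y. f (?L n y)) \<in> borel_measurable N" for n and f :: "nat list \<Rightarrow> real"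
      by (rule measurable_compose[OF L_meas]) simp
    let ?\<mu> = "\<lambda>n. expect (replicate_pmf n p) (scenery_sum (\<lambda>x. w x s) 0)"
    let ?f = "\<lambda>n xs. (scenery_sum (\<lambda>x. w x s) 0 xs - ?\<mu> n) / sqrt (real n)"
    have eq: "(\<lambda>y. (Z n s y - (\<integral>y'. Z n s y' \<partial>N)) / sqrt (real n)) = (\<lambda>y. ?f n (?L n y))" for n
      unfolding Z EZ ..
    show ?case
    proof (rule levy_continuity)
      show "real_distribution (distr N borel (\<lambda>y. (Z n s y - (\<integral>y'. Z n s y' \<partial>N)) / sqrt (real n)))" for n
        unfolding eq by (rule N.real_distribution_distr[OF Z_meas])
      show "real_distribution (normal_law 0 (1 - 1 / m))" by (rule normal_law_properties[OF v])
      fix t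
      have "char (distr N borel (\<lambda>y. (Z n s y - (\<integral>y'. Z n s y' \<partial>N)) / sqrt (real n))) t
        = expect (replicate_pmf n p) (\<lambda>xs. iexp (t * ?f n xs))" for n
      proof -
        have "char (distr N borel (\<lambda>y. ?f n (?L n y))) t = (\<integral>y. iexp (t * ?f n (?L n y)) \<partial>N)"
          unfolding char_def by (rule integral_distr[OF Z_meas]) simp
        also have "\<dots> = expect (replicate_pmf n p) (\<lambda>xs. iexp (t * ?f n xs))"
          by (rule EZ)
        finally show ?thesis unfolding eq .
      qed
      then show "(\<lambda>n. char (distr N borel (\<lambda>y. (Z n s y - (\<integral>y'. Z n s y' \<partial>N)) / sqrt (real n))) t)
         \<longlonglongrightarrow> char (normal_law 0 (1 - 1 / m)) t"
        using S.char_quenched_limit[OF V, of t] by (simp only: normal_law_properties(2)[OF v])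
    qed
  qed
qed

end
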